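(* Let $(M,g)$ be a time-orientable Lorentzian manifold, $L$ a null hypersurface and $\zeta$ a closed rigging for $L$ such that its rigged vector field $\xi$ is $g$-geodesic, i.e. $\nabla_\xi\xi=0$. Take $\gamma:I\to L$ an integral curve of $\xi$. 1. If $J$ is a Jacobi field in $(M,g)$ along $\gamma$ with values in $TL$, then the $\widetilde g$-orthogonal projection of $J$ onto $\mathcal S^\zeta$ is a Jacobi field in $(L,\widetilde g)$. 2. If $I=[0,a]$ and $V$ is a Jacobi vector field in $(L,\widetilde g)$ along $\gamma$ with $V(0)=V(a)=0$, then there exists a Jacobi field $J$ in $(M,g)$ along $\gamma$ with values in $TL$ such that $J(0)=J(a)=0$. In particular, $\gamma(a)$ is a conjugate point to $\gamma(0)$ along $\gamma$ in $(M,g)$ if and only if it is a conjugate point to $\gamma(0)$ along $\gamma$ in $(L,\widetilde g)$, and both share the same multiplicity.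
   Context: $\nabla$ is the Levi-Civita connection of $(M,g)$. A null hypersurface $i:L\hookrightarrow M$ is a hypersurface on which the induced metric is degenerate. A rigging for $L$ is a vector field $\zeta$ defined on an open set of $M$ containing $L$ with $\zeta_p\notin T_pL$ for all $p\in L$. Put $\alpha=g(\zeta,\cdot)$, $\omega=i^*\alpha$. The rigging is closed if $d\alpha=0$. The rigged metric $\widetilde g=i^*g+\omega\otimes\omega$ is a Riemannian metric on $L$. The rigged vector field $\xi\in\mathfrak X(L)$ is defined by $\widetilde g(\xi,\cdot)=\omega$; it is the unique null vector field in $L$ with $g(\zeta,\xi)=1$. The screen distribution is $\mathcal S^\zeta=TL\cap\zeta^\perp$, the $\widetilde g$-orthogonal complement of $\xi$ in $TL$. When $\zeta$ is closed, $\xi$ is also $\widetilde g$-geodesic, so $\gamma$ is a geodesic of both $(M,g)$ and $(L,\widetilde g)$. The multiplicity of a conjugate point $\gamma(a)$ is the dimension of the space of Jacobi fields along $\gamma$ vanishing at $0$ and $a$. *)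

theory Defs
  imports "HOL-Analysis.Analysis" "HOL-Library.Function_Algebras"
begin

section \<open>Functions as a real vector space\<close>

instantiation "fun" :: (type, real_vector) real_vector
begin

definition scaleR_fun :: "real \<Rightarrow> ('a \<Rightarrow> 'b) \<Rightarrow> 'a \<Rightarrow> 'b" where
  "scaleR_fun r f = (\<lambda>x. r *\<^sub>R f x)"

instance
  by standard (simp_all add: scaleR_fun_def fun_eq_iff scaleR_add_right scaleR_add_left)

end


section \<open>Smooth manifolds\<close>

primrec C_on :: "nat \<Rightarrow> 'e::real_normed_vector set \<Rightarrow> ('e \<Rightarrow> 'f::real_normed_vector) \<Rightarrow> bool" where
  "C_on 0 S f \<longleftrightarrow> continuous_on S f"
| "C_on (Suc k) S f \<longleftrightarrow>
     (\<forall>x\<in>S. f differentiable at x) \<and> (\<forall>v. C_on k S (\<lambda>x. frechet_derivative f (at x) v))"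

text \<open>Only used for open sets \<open>S\<close>.\<close>

definition smooth_on :: "'e::real_normed_vector set \<Rightarrow> ('e \<Rightarrow> 'f::real_normed_vector) \<Rightarrow> bool" where
  "smooth_on S f \<longleftrightarrow> (\<forall>k. C_on k S f)"

text \<open>A chart is a pair of its domain and its coordinate map; the values of the coordinate
  map outside the domain are irrelevant.\<close>

type_synonym ('a, 'e) chart = "'a set \<times> ('a \<Rightarrow> 'e)"

definition chart_inv :: "('a, 'e) chart \<Rightarrow> 'e \<Rightarrow> 'a" where
  "chart_inv c = inv_into (fst c) (snd c)"

definition points :: "('a, 'e) chart set \<Rightarrow> 'a set" where
  "points A = (\<Union>c\<in>A. fst c)"

definition charts_at :: "('a, 'e) chart set \<Rightarrow> 'a \<Rightarrow> ('a, 'e) chart set" where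
  "charts_at A p = {c \<in> A. p \<in> fst c}"

definition chart_at :: "('a, 'e) chart set \<Rightarrow> 'a \<Rightarrow> ('a, 'e) chart" where
  "chart_at A p = (SOME c. c \<in> charts_at A p)"

text \<open>A manifold is given by a smooth (not necessarily maximal) atlas on a Hausdorff second
  countable space; its underlying set \<open>points A\<close> is the union of the chart domains, an open
  subset of the type.\<close>

definition smooth_manifold ::
    "('a::{second_countable_topology, t2_space}, 'e::euclidean_space) chart set \<Rightarrow> bool" where
  "smooth_manifold A \<longleftrightarrow>
     (\<forall>c\<in>A. open (fst c) \<and> open (snd c ` fst c) \<and>
        homeomorphism (fst c) (snd c ` fst c) (snd c) (chart_inv c)) \<and>
     (\<forall>c\<in>A. \<forall>d\<in>A. smooth_on (snd c ` (fst c \<inter> fst d)) (snd d \<circ> chart_inv c))"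

definition smooth_map ::
    "('b::topological_space, 'f::euclidean_space) chart set \<Rightarrow>
     ('a::topological_space, 'e::euclidean_space) chart set \<Rightarrow> ('b \<Rightarrow> 'a) \<Rightarrow> bool" where
  "smooth_map B A f \<longleftrightarrow>
     f ` points B \<subseteq> points A \<and> continuous_on (points B) f \<and>
     (\<forall>d\<in>B. \<forall>c\<in>A. smooth_on (snd d ` (fst d \<inter> f -` fst c)) (snd c \<circ> f \<circ> chart_inv d))"


section \<open>Tangent vectors\<close>

text \<open>A tangent vector at \<open>p\<close> is the family of its components in all charts of the atlas around
  \<open>p\<close>, related by the derivatives of the coordinate changes. The component in every chart whose
  domain does not contain \<open>p\<close> is \<open>0\<close> by convention, which makes the tangent space a subspace
  of the function space.\<close>

type_synonym ('a, 'e) tvec = "('a, 'e) chart \<Rightarrow> 'e"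

definition tangent_space ::
    "('a, 'e::euclidean_space) chart set \<Rightarrow> 'a \<Rightarrow> ('a, 'e) tvec set" where
  "tangent_space A p =
     {v. (\<forall>c. c \<notin> charts_at A p \<longrightarrow> v c = 0) \<and>
         (\<forall>c\<in>charts_at A p. \<forall>d\<in>charts_at A p.
            v d = frechet_derivative (snd d \<circ> chart_inv c) (at (snd c p)) (v c))}"

text \<open>The tangent vector at \<open>p\<close> whose component in the chart \<open>c\<close> is \<open>u\<close>.\<close>

definition tangent_vector ::
    "('a, 'e::euclidean_space) chart set \<Rightarrow> ('a, 'e) chart \<Rightarrow> 'a \<Rightarrow> 'e \<Rightarrow> ('a, 'e) tvec" where
  "tangent_vector A c p u =
     (\<lambda>d. if d \<in> charts_at A p
          then frechet_derivative (snd d \<circ> chart_inv c) (at (snd c p)) u else 0)"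

definition smooth_vector_field ::
    "('a, 'e::euclidean_space) chart set \<Rightarrow> 'a set \<Rightarrow> ('a \<Rightarrow> ('a, 'e) tvec) \<Rightarrow> bool" where
  "smooth_vector_field A U X \<longleftrightarrow>
     (\<forall>p\<in>U. X p \<in> tangent_space A p) \<and>
     (\<forall>c\<in>A. smooth_on (snd c ` (U \<inter> fst c)) (\<lambda>x. X (chart_inv c x) c))"

text \<open>The differential of \<open>f\<close> at \<open>p\<close>; it does not depend on the choice of the chart at \<open>p\<close>.\<close>

definition differential ::
    "('b, 'f::euclidean_space) chart set \<Rightarrow> ('a, 'e::euclidean_space) chart set \<Rightarrow>
     ('b \<Rightarrow> 'a) \<Rightarrow> 'b \<Rightarrow> ('b, 'f) tvec \<Rightarrow> ('a, 'e) tvec" where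
  "differential B A f p v =
     (\<lambda>c. if c \<in> charts_at A (f p)
          then (let d = chart_at B p in
                  frechet_derivative (snd c \<circ> f \<circ> chart_inv d) (at (snd d p)) (v d))
          else 0)"

definition velocity ::
    "('a, 'e::euclidean_space) chart set \<Rightarrow> real set \<Rightarrow> (real \<Rightarrow> 'a) \<Rightarrow> real \<Rightarrow> ('a, 'e) tvec" where
  "velocity A I \<gamma> t =
     (\<lambda>c. if c \<in> charts_at A (\<gamma> t)
          then vector_derivative (snd c \<circ> \<gamma>) (at t within I) else 0)"

text \<open>Derivatives at the endpoints of \<open>I\<close> belonging to \<open>I\<close> are one-sided.\<close>

definition integral_curve ::
    "('a::topological_space, 'e::euclidean_space) chart set \<Rightarrow> ('a \<Rightarrow> ('a, 'e) tvec) \<Rightarrow>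
     real set \<Rightarrow> (real \<Rightarrow> 'a) \<Rightarrow> bool" where
  "integral_curve A X I \<gamma> \<longleftrightarrow>
     is_interval I \<and> interior I \<noteq> {} \<and> \<gamma> ` I \<subseteq> points A \<and> continuous_on I \<gamma> \<and>
     (\<forall>t\<in>I. \<forall>c\<in>charts_at A (\<gamma> t).
        ((snd c \<circ> \<gamma>) has_vector_derivative X (\<gamma> t) c) (at t within I))"


section \<open>Metrics, one-forms, Levi-Civita connection and curvature\<close>

type_synonym ('a, 'e) form1 = "'a \<Rightarrow> ('a, 'e) tvec \<Rightarrow> real"
type_synonym ('a, 'e) form2 = "'a \<Rightarrow> ('a, 'e) tvec \<Rightarrow> ('a, 'e) tvec \<Rightarrow> real"

definition metric_in_chart ::
    "('a, 'e::euclidean_space) chart set \<Rightarrow> ('a, 'e) form2 \<Rightarrow> ('a, 'e) chart \<Rightarrow>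
     'e \<Rightarrow> 'e \<Rightarrow> 'e \<Rightarrow> real" where
  "metric_in_chart A g c x u v =
     g (chart_inv c x) (tangent_vector A c (chart_inv c x) u) (tangent_vector A c (chart_inv c x) v)"

definition smooth_symmetric_tensor ::
    "('a, 'e::euclidean_space) chart set \<Rightarrow> ('a, 'e) form2 \<Rightarrow> bool" where
  "smooth_symmetric_tensor A g \<longleftrightarrow>
     (\<forall>p\<in>points A. \<forall>u\<in>tangent_space A p. \<forall>v\<in>tangent_space A p.
        g p u v = g p v u \<and>
        (\<forall>w\<in>tangent_space A p. g p (u + v) w = g p u w + g p v w) \<and>
        (\<forall>r. g p (r *\<^sub>R u) v = r * g p u v)) \<and>
     (\<forall>c\<in>A. \<forall>u v. smooth_on (snd c ` fst c) (\<lambda>x. metric_in_chart A g c x u v))"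

text \<open>Signature \<open>(-,+,\<dots>,+)\<close>: the space \<open>T\<close> has a \<open>b\<close>-orthonormal basis with exactly one
  timelike element.\<close>

definition lorentzian_signature :: "'v::real_vector set \<Rightarrow> ('v \<Rightarrow> 'v \<Rightarrow> real) \<Rightarrow> bool" where
  "lorentzian_signature T b \<longleftrightarrow>
     (\<exists>e E. e \<notin> E \<and> independent (insert e E) \<and> span (insert e E) = T \<and>
        b e e = -1 \<and> (\<forall>x\<in>E. b x x = 1) \<and>
        (\<forall>x\<in>insert e E. \<forall>y\<in>insert e E. x \<noteq> y \<longrightarrow> b x y = 0))"

definition lorentzian_manifold ::
    "('a::{second_countable_topology, t2_space}, 'e::euclidean_space) chart set \<Rightarrow>
     ('a, 'e) form2 \<Rightarrow> bool" where
  "lorentzian_manifold A g \<longleftrightarrow>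
     smooth_manifold A \<and> smooth_symmetric_tensor A g \<and>
     (\<forall>p\<in>points A. lorentzian_signature (tangent_space A p) (g p))"

definition time_orientable ::
    "('a, 'e::euclidean_space) chart set \<Rightarrow> ('a, 'e) form2 \<Rightarrow> bool" where
  "time_orientable A g \<longleftrightarrow>
     (\<exists>X. smooth_vector_field A (points A) X \<and> (\<forall>p\<in>points A. g p (X p) (X p) < 0))"

definition form1_in_chart ::
    "('a, 'e::euclidean_space) chart set \<Rightarrow> ('a, 'e) form1 \<Rightarrow> ('a, 'e) chart \<Rightarrow> 'e \<Rightarrow> 'e \<Rightarrow> real" where
  "form1_in_chart A \<alpha> c x u = \<alpha> (chart_inv c x) (tangent_vector A c (chart_inv c x) u)"

text \<open>The exterior derivative \<open>d\<alpha>(v,w) = v(\<alpha>(W)) - w(\<alpha>(V)) - \<alpha>([V,W])\<close>, computed with the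
  extensions \<open>V\<close>, \<open>W\<close> of \<open>v\<close>, \<open>w\<close> that are constant in a chart.\<close>

definition exterior_derivative ::
    "('a, 'e::euclidean_space) chart set \<Rightarrow> ('a, 'e) form1 \<Rightarrow> ('a, 'e) form2" where
  "exterior_derivative A \<alpha> p v w =
     (let c = chart_at A p in
        frechet_derivative (\<lambda>y. form1_in_chart A \<alpha> c y (w c)) (at (snd c p)) (v c)
      - frechet_derivative (\<lambda>y. form1_in_chart A \<alpha> c y (v c)) (at (snd c p)) (w c))"

text \<open>The Levi-Civita connection in the chart \<open>c\<close>: \<open>christoffel A g c x u v\<close> is the component of
  \<open>\<nabla>\<^sub>U V\<close> at the point with coordinates \<open>x\<close> for the vector fields \<open>U\<close>, \<open>V\<close> with constant
  components \<open>u\<close>, \<open>v\<close>. It is the unique bilinear map that is symmetric (no torsion) and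
  compatible with the metric.\<close>

definition christoffel ::
    "('a, 'e::euclidean_space) chart set \<Rightarrow> ('a, 'e) form2 \<Rightarrow> ('a, 'e) chart \<Rightarrow>
     'e \<Rightarrow> 'e \<Rightarrow> 'e \<Rightarrow> 'e" where
  "christoffel A g c x =
     (THE \<Gamma>. bilinear \<Gamma> \<and> (\<forall>u v. \<Gamma> u v = \<Gamma> v u) \<and>
        (\<forall>u v w. frechet_derivative (\<lambda>y. metric_in_chart A g c y v w) (at x) u =
           metric_in_chart A g c x (\<Gamma> u v) w + metric_in_chart A g c x v (\<Gamma> u w)))"

text \<open>\<open>cov_deriv_map A g B f X p v\<close> is \<open>\<nabla>\<^sub>v X\<close>, where \<open>\<nabla>\<close> is the Levi-Civita connection of
  \<open>(A,g)\<close>, \<open>X\<close> a vector field along the map \<open>f\<close> from \<open>B\<close> to \<open>A\<close> and \<open>v\<close> tangent to \<open>B\<close> at \<open>p\<close>.\<close>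

definition cov_deriv_map ::
    "('a, 'e::euclidean_space) chart set \<Rightarrow> ('a, 'e) form2 \<Rightarrow> ('b, 'f::euclidean_space) chart set \<Rightarrow>
     ('b \<Rightarrow> 'a) \<Rightarrow> ('b \<Rightarrow> ('a, 'e) tvec) \<Rightarrow> 'b \<Rightarrow> ('b, 'f) tvec \<Rightarrow> ('a, 'e) tvec" where
  "cov_deriv_map A g B f X p v =
     (\<lambda>c. if c \<in> charts_at A (f p)
          then (let d = chart_at B p in
                  frechet_derivative (\<lambda>y. X (chart_inv d y) c) (at (snd d p)) (v d)
                + christoffel A g c (snd c (f p)) (differential B A f p v c) (X p c))
          else 0)"

text \<open>\<open>R(u,v)w = \<nabla>\<^sub>u\<nabla>\<^sub>v w - \<nabla>\<^sub>v\<nabla>\<^sub>u w - \<nabla>\<^bsub>[u,v]\<^esub> w\<close>, computed with extensions that are constant in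
  the chart.\<close>

definition curvature ::
    "('a, 'e::euclidean_space) chart set \<Rightarrow> ('a, 'e) form2 \<Rightarrow> 'a \<Rightarrow>
     ('a, 'e) tvec \<Rightarrow> ('a, 'e) tvec \<Rightarrow> ('a, 'e) tvec \<Rightarrow> ('a, 'e) tvec" where
  "curvature A g p u v w =
     (\<lambda>c. if c \<in> charts_at A p
          then (let x = snd c p; \<Gamma> = christoffel A g c in
                  frechet_derivative (\<lambda>y. \<Gamma> y (v c) (w c)) (at x) (u c)
                - frechet_derivative (\<lambda>y. \<Gamma> y (u c) (w c)) (at x) (v c)
                + \<Gamma> x (u c) (\<Gamma> x (v c) (w c)) - \<Gamma> x (v c) (\<Gamma> x (u c) (w c)))
          else 0)"


section \<open>Jacobi fields and conjugate points\<close>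

text \<open>Fields along a curve defined on \<open>I\<close> are \<open>0\<close> outside \<open>I\<close> by convention, so that they form a
  subspace of the function space and equality of fields is equality of functions.\<close>

definition differentiable_field_along ::
    "('a, 'e::euclidean_space) chart set \<Rightarrow> real set \<Rightarrow> (real \<Rightarrow> 'a) \<Rightarrow>
     (real \<Rightarrow> ('a, 'e) tvec) \<Rightarrow> bool" where
  "differentiable_field_along A I \<gamma> X \<longleftrightarrow>
     (\<forall>t. t \<notin> I \<longrightarrow> X t = 0) \<and>
     (\<forall>t\<in>I. X t \<in> tangent_space A (\<gamma> t) \<and>
        (\<forall>c\<in>charts_at A (\<gamma> t). (\<lambda>s. X s c) differentiable (at t within I)))"

definition cov_deriv_along ::
    "('a, 'e::euclidean_space) chart set \<Rightarrow> ('a, 'e) form2 \<Rightarrow> real set \<Rightarrow> (real \<Rightarrow> 'a) \<Rightarrow>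
     (real \<Rightarrow> ('a, 'e) tvec) \<Rightarrow> real \<Rightarrow> ('a, 'e) tvec" where
  "cov_deriv_along A g I \<gamma> X t =
     (\<lambda>c. if t \<in> I \<and> c \<in> charts_at A (\<gamma> t)
          then vector_derivative (\<lambda>s. X s c) (at t within I)
             + christoffel A g c (snd c (\<gamma> t)) (velocity A I \<gamma> t c) (X t c)
          else 0)"

text \<open>\<open>J'' + R(J,\<gamma>')\<gamma>' = 0\<close>. Twice differentiable solutions of this linear equation are smooth.\<close>

definition jacobi_field ::
    "('a, 'e::euclidean_space) chart set \<Rightarrow> ('a, 'e) form2 \<Rightarrow> real set \<Rightarrow> (real \<Rightarrow> 'a) \<Rightarrow>
     (real \<Rightarrow> ('a, 'e) tvec) \<Rightarrow> bool" where
  "jacobi_field A g I \<gamma> J \<longleftrightarrow>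
     differentiable_field_along A I \<gamma> J \<and>
     differentiable_field_along A I \<gamma> (cov_deriv_along A g I \<gamma> J) \<and>
     (\<forall>t\<in>I. cov_deriv_along A g I \<gamma> (cov_deriv_along A g I \<gamma> J) t
            + curvature A g (\<gamma> t) (J t) (velocity A I \<gamma> t) (velocity A I \<gamma> t) = 0)"

definition jacobi_fields_vanishing ::
    "('a, 'e::euclidean_space) chart set \<Rightarrow> ('a, 'e) form2 \<Rightarrow> (real \<Rightarrow> 'a) \<Rightarrow> real \<Rightarrow>
     (real \<Rightarrow> ('a, 'e) tvec) set" where
  "jacobi_fields_vanishing A g \<gamma> a = {J. jacobi_field A g {0..a} \<gamma> J \<and> J 0 = 0 \<and> J a = 0}"

definition conjugate_point ::
    "('a, 'e::euclidean_space) chart set \<Rightarrow> ('a, 'e) form2 \<Rightarrow> (real \<Rightarrow> 'a) \<Rightarrow> real \<Rightarrow> bool" where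
  "conjugate_point A g \<gamma> a \<longleftrightarrow> (\<exists>J\<in>jacobi_fields_vanishing A g \<gamma> a. J \<noteq> 0)"

definition conjugate_multiplicity ::
    "('a, 'e::euclidean_space) chart set \<Rightarrow> ('a, 'e) form2 \<Rightarrow> (real \<Rightarrow> 'a) \<Rightarrow> real \<Rightarrow> nat" where
  "conjugate_multiplicity A g \<gamma> a = dim (jacobi_fields_vanishing A g \<gamma> a)"


section \<open>Null hypersurfaces and riggings\<close>

text \<open>A hypersurface is an injectively immersed manifold \<open>B\<close> of codimension one; embedded
  hypersurfaces are a special case.\<close>

definition hypersurface ::
    "('a::{second_countable_topology, t2_space}, 'e::euclidean_space) chart set \<Rightarrow>
     ('b::{second_countable_topology, t2_space}, 'f::euclidean_space) chart set \<Rightarrow>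
     ('b \<Rightarrow> 'a) \<Rightarrow> bool" where
  "hypersurface A B i \<longleftrightarrow>
     smooth_manifold B \<and> DIM('e) = DIM('f) + 1 \<and> smooth_map B A i \<and> inj_on i (points B) \<and>
     (\<forall>p\<in>points B. inj_on (differential B A i p) (tangent_space B p))"

definition pullback_metric ::
    "('a, 'e::euclidean_space) chart set \<Rightarrow> ('a, 'e) form2 \<Rightarrow> ('b, 'f::euclidean_space) chart set \<Rightarrow>
     ('b \<Rightarrow> 'a) \<Rightarrow> ('b, 'f) form2" where
  "pullback_metric A g B i p v w = g (i p) (differential B A i p v) (differential B A i p w)"

definition null_hypersurface ::
    "('a::{second_countable_topology, t2_space}, 'e::euclidean_space) chart set \<Rightarrow> ('a, 'e) form2 \<Rightarrow>
     ('b::{second_countable_topology, t2_space}, 'f::euclidean_space) chart set \<Rightarrow>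
     ('b \<Rightarrow> 'a) \<Rightarrow> bool" where
  "null_hypersurface A g B i \<longleftrightarrow>
     hypersurface A B i \<and>
     (\<forall>p\<in>points B. \<exists>v\<in>tangent_space B p. v \<noteq> 0 \<and>
        (\<forall>w\<in>tangent_space B p. pullback_metric A g B i p v w = 0))"

text \<open>The subspace of the tangent space of \<open>A\<close> at \<open>i p\<close> formed by the vectors tangent to the
  hypersurface.\<close>

definition hypersurface_tangent ::
    "('a, 'e::euclidean_space) chart set \<Rightarrow> ('b, 'f::euclidean_space) chart set \<Rightarrow>
     ('b \<Rightarrow> 'a) \<Rightarrow> 'b \<Rightarrow> ('a, 'e) tvec set" where
  "hypersurface_tangent A B i p = differential B A i p ` tangent_space B p"

definition rigging ::
    "('a::topological_space, 'e::euclidean_space) chart set \<Rightarrow>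
     ('b, 'f::euclidean_space) chart set \<Rightarrow> ('b \<Rightarrow> 'a) \<Rightarrow> 'a set \<Rightarrow> ('a \<Rightarrow> ('a, 'e) tvec) \<Rightarrow> bool" where
  "rigging A B i U \<zeta> \<longleftrightarrow>
     open U \<and> U \<subseteq> points A \<and> i ` points B \<subseteq> U \<and> smooth_vector_field A U \<zeta> \<and>
     (\<forall>p\<in>points B. \<zeta> (i p) \<notin> hypersurface_tangent A B i p)"

definition rigging_form ::
    "('a, 'e) form2 \<Rightarrow> ('a \<Rightarrow> ('a, 'e) tvec) \<Rightarrow> ('a, 'e) form1" where
  "rigging_form g \<zeta> p v = g p (\<zeta> p) v"

definition closed_rigging ::
    "('a::topological_space, 'e::euclidean_space) chart set \<Rightarrow> ('a, 'e) form2 \<Rightarrow>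
     ('b, 'f::euclidean_space) chart set \<Rightarrow> ('b \<Rightarrow> 'a) \<Rightarrow> 'a set \<Rightarrow> ('a \<Rightarrow> ('a, 'e) tvec) \<Rightarrow> bool" where
  "closed_rigging A g B i U \<zeta> \<longleftrightarrow>
     rigging A B i U \<zeta> \<and>
     (\<forall>p\<in>U. \<forall>v\<in>tangent_space A p. \<forall>w\<in>tangent_space A p.
        exterior_derivative A (rigging_form g \<zeta>) p v w = 0)"

text \<open>\<open>\<omega> = i\<^sup>*\<alpha>\<close>\<close>

definition rigged_form ::
    "('a, 'e::euclidean_space) chart set \<Rightarrow> ('a, 'e) form2 \<Rightarrow> ('b, 'f::euclidean_space) chart set \<Rightarrow>
     ('b \<Rightarrow> 'a) \<Rightarrow> ('a \<Rightarrow> ('a, 'e) tvec) \<Rightarrow> ('b, 'f) form1" where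
  "rigged_form A g B i \<zeta> p v = rigging_form g \<zeta> (i p) (differential B A i p v)"

definition rigged_metric ::
    "('a, 'e::euclidean_space) chart set \<Rightarrow> ('a, 'e) form2 \<Rightarrow> ('b, 'f::euclidean_space) chart set \<Rightarrow>
     ('b \<Rightarrow> 'a) \<Rightarrow> ('a \<Rightarrow> ('a, 'e) tvec) \<Rightarrow> ('b, 'f) form2" where
  "rigged_metric A g B i \<zeta> p v w =
     pullback_metric A g B i p v w + rigged_form A g B i \<zeta> p v * rigged_form A g B i \<zeta> p w"

definition rigged_vector_field ::
    "('a, 'e::euclidean_space) chart set \<Rightarrow> ('a, 'e) form2 \<Rightarrow> ('b, 'f::euclidean_space) chart set \<Rightarrow>
     ('b \<Rightarrow> 'a) \<Rightarrow> ('a \<Rightarrow> ('a, 'e) tvec) \<Rightarrow> ('b \<Rightarrow> ('b, 'f) tvec) \<Rightarrow> bool" where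
  "rigged_vector_field A g B i \<zeta> \<xi> \<longleftrightarrow>
     smooth_vector_field B (points B) \<xi> \<and>
     (\<forall>p\<in>points B. \<forall>w\<in>tangent_space B p.
        rigged_metric A g B i \<zeta> p (\<xi> p) w = rigged_form A g B i \<zeta> p w)"

text \<open>\<open>\<nabla>\<^sub>\<xi> \<xi> = 0\<close> for the ambient connection, with \<open>\<xi>\<close> regarded as a vector field along \<open>i\<close>.\<close>

definition ambient_geodesic_field ::
    "('a, 'e::euclidean_space) chart set \<Rightarrow> ('a, 'e) form2 \<Rightarrow> ('b, 'f::euclidean_space) chart set \<Rightarrow>
     ('b \<Rightarrow> 'a) \<Rightarrow> ('b \<Rightarrow> ('b, 'f) tvec) \<Rightarrow> bool" where
  "ambient_geodesic_field A g B i \<xi> \<longleftrightarrow>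
     (\<forall>p\<in>points B. cov_deriv_map A g B i (\<lambda>q. differential B A i q (\<xi> q)) p (\<xi> p) = 0)"

definition screen ::
    "('a, 'e::euclidean_space) chart set \<Rightarrow> ('a, 'e) form2 \<Rightarrow> ('b, 'f::euclidean_space) chart set \<Rightarrow>
     ('b \<Rightarrow> 'a) \<Rightarrow> ('a \<Rightarrow> ('a, 'e) tvec) \<Rightarrow> 'b \<Rightarrow> ('b, 'f) tvec set" where
  "screen A g B i \<zeta> p =
     {v \<in> tangent_space B p. g (i p) (\<zeta> (i p)) (differential B A i p v) = 0}"

definition orthogonal_projection ::
    "('v::real_vector \<Rightarrow> 'v \<Rightarrow> real) \<Rightarrow> 'v set \<Rightarrow> 'v \<Rightarrow> 'v" where
  "orthogonal_projection b S w = (THE s. s \<in> S \<and> (\<forall>u\<in>S. b (w - s) u = 0))"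

text \<open>The projection onto the screen, for the rigged metric, of a field along \<open>i \<circ> \<gamma>\<close> that is tangent
  to the hypersurface. Its values are first identified with tangent vectors of \<open>B\<close>.\<close>

definition screen_projection ::
    "('a, 'e::euclidean_space) chart set \<Rightarrow> ('a, 'e) form2 \<Rightarrow> ('b, 'f::euclidean_space) chart set \<Rightarrow>
     ('b \<Rightarrow> 'a) \<Rightarrow> ('a \<Rightarrow> ('a, 'e) tvec) \<Rightarrow> real set \<Rightarrow> (real \<Rightarrow> 'b) \<Rightarrow>
     (real \<Rightarrow> ('a, 'e) tvec) \<Rightarrow> real \<Rightarrow> ('b, 'f) tvec" where
  "screen_projection A g B i \<zeta> I \<gamma> J t =
     (if t \<in> I
      then orthogonal_projection (rigged_metric A g B i \<zeta> (\<gamma> t)) (screen A g B i \<zeta> (\<gamma> t))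
             (inv_into (tangent_space B (\<gamma> t)) (differential B A i (\<gamma> t)) (J t))
      else 0)"

end

theory Submission
  imports Defs
begin

text \<open>Write a field along \<open>\<gamma>\<close> tangent to \<open>L\<close> as \<open>V\<close> and let \<open>W = L\<^sub>\<xi> V\<close> be its Lie derivative along the
  flow of \<open>\<xi>\<close>. Since \<open>\<xi>\<close> is geodesic for both metrics, differentiating the geodesic equation in the
  direction \<open>V\<close> absorbs the curvature: in both manifolds the Jacobi equation reads
  \<open>\<nabla>\<^sub>\<xi> W + \<nabla>\<^sub>W \<xi> = 0\<close>. As \<open>\<nabla>\<xi>\<close> is self-adjoint on \<open>TL\<close> (the forms \<open>g(\<xi>, \<cdot>) = 0\<close> on \<open>TL\<close> and
  \<open>g\<^sub>L(\<xi>, \<cdot>) = \<omega>\<close>, with \<open>g\<^sub>L\<close> the rigged metric, are closed), pairing with vectors tangent to \<open>L\<close>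
  turns it into \<open>L\<^sub>\<xi> (h(W, \<cdot>)) = 0\<close> with the same degenerate form \<open>h = i\<^sup>*g\<close>. The remaining scalar
  equation is \<open>\<omega>(W)' = 0\<close> for the rigged metric and \<open>\<omega>(W)' = -2 g(\<nabla>\<^sub>W \<xi>, \<zeta>)\<close> for \<open>g\<close>. Adding
  \<open>f \<xi>\<close> to \<open>V\<close> leaves \<open>h(W, \<cdot>)\<close> unchanged and adds \<open>f''\<close> to \<open>\<omega>(W)'\<close>; hence screen projections of
  Jacobi fields are Jacobi fields, and a Jacobi field of the rigged metric that vanishes at both ends
  is lifted by solving a Dirichlet problem for \<open>f\<close>. A Jacobi field of \<open>g\<close> that vanishes at both ends
  is tangent to \<open>L\<close> because \<open>g(J, \<gamma>')'' = 0\<close>.\<close>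

section \<open>Differential calculus on open sets\<close>

text \<open>Let D be the covariant derivative along the curve. Torsion-freeness gives D V = W +
  \<nabla>_V \<xi>, and \<nabla>_\<xi> \<xi> = 0 on all of L gives D (\<nabla>_V \<xi>) = \<nabla>_W
  \<xi> - R(V, \<xi>) \<xi>; this is how the curvature cancels. The factor 2 arises because D W is
  itself L_\<xi> W + \<nabla>_W \<xi>. A vector orthogonal to TL is a multiple of \<xi>, so exactly
  one scalar equation, the pairing with \<zeta>, remains. Two obstacles shape the rest. The
  Dirichlet problem must be solved on the whole interval, while computations take place in charts;
  its right-hand side is therefore built from a Lie derivative and a covariant derivative proved
  independent of charts. And a tangent Jacobi field of \<open>g\<close> is differentiable only as an
  ambient field, so the differentiability of V and W in L has to be recovered from their images.
  Multiplicities agree because a Jacobi field f \<xi> of \<open>g\<close> has f'' = 0, so the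
  projection is injective on fields vanishing at both ends.\<close>

primrec diff_on :: "nat \<Rightarrow> 'e::euclidean_space set \<Rightarrow> ('e \<Rightarrow> 'f::real_normed_vector) \<Rightarrow> bool" where
  "diff_on 0 S f \<longleftrightarrow> True"
| "diff_on (Suc k) S f \<longleftrightarrow>
     (\<forall>x\<in>S. f differentiable at x) \<and> (\<forall>v. diff_on k S (\<lambda>x. frechet_derivative f (at x) v))"

text \<open>\<open>diff_on\<close> drops the continuity that \<open>C_on\<close> asks for at level
  0, which makes the base cases of the closure proofs trivial. Continuity of a derivative is
  regained by asking for one level more.\<close>

lemma C_on_imp_diff_on: "C_on k S f \<Longrightarrow> diff_on k S f"
  by (induction k arbitrary: f) auto

lemma smooth_on_imp_diff_on: "smooth_on S f \<Longrightarrow> diff_on k S f"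
  by (simp add: smooth_on_def C_on_imp_diff_on)

lemma diff_on_Suc_imp: "diff_on (Suc k) S f \<Longrightarrow> diff_on k S f"
proof (induction k arbitrary: f)
  case (Suc k)
  then show ?case by (metis diff_on.simps(2))
qed simp

lemma diff_on_le: "diff_on k S f \<Longrightarrow> l \<le> k \<Longrightarrow> diff_on l S f"
proof (induction k)
  case (Suc k)
  then show ?case by (metis diff_on_Suc_imp le_SucE)
qed simp

lemma diff_on_subset: "diff_on k S f \<Longrightarrow> T \<subseteq> S \<Longrightarrow> diff_on k T f"
  by (induction k arbitrary: f) auto

lemma diff_onD: "diff_on k S f \<Longrightarrow> 0 < k \<Longrightarrow> x \<in> S \<Longrightarrow> (f has_derivative frechet_derivative f (at x)) (at x)"
  by (cases k) (auto simp: frechet_derivative_works[symmetric])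

lemma frechet_derivative_eq: "(f has_derivative f') (at x) \<Longrightarrow> frechet_derivative f (at x) = f'"
  by (simp add: frechet_derivative_at[symmetric])

lemma frechet_derivative_cong_open:
  assumes "open S" "x \<in> S" "\<And>y. y \<in> S \<Longrightarrow> f y = g y"
  shows "frechet_derivative f (at x) = frechet_derivative g (at x)"
proof -
  have "(f has_derivative f') (at x) \<longleftrightarrow> (g has_derivative f') (at x)" for f'
    using assms by (metis has_derivative_transform_within_open)
  then show ?thesis by (simp add: frechet_derivative_def)
qed

lemma diff_on_cong:
  assumes "open S" "\<And>x. x \<in> S \<Longrightarrow> f x = g x"
  shows "diff_on k S f \<longleftrightarrow> diff_on k S g"
  using assms(2)
proof (induction k arbitrary: f g)
  case (Suc k)
  have "f differentiable at x \<longleftrightarrow> g differentiable at x" if "x \<in> S" for x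
    unfolding differentiable_def using Suc.prems assms(1) that
    by (metis has_derivative_transform_within_open)
  moreover have "diff_on k S (\<lambda>x. frechet_derivative f (at x) v) \<longleftrightarrow>
      diff_on k S (\<lambda>x. frechet_derivative g (at x) v)" for v
    by (rule Suc.IH) (metis frechet_derivative_cong_open assms(1) Suc.prems)
  ultimately show ?case by auto
qed simp

lemma diff_on_const: "diff_on k S (\<lambda>x. a)"
  by (induction k arbitrary: a) auto

text \<open>Derivatives are usually known by a formula; on an open set the formula may stand in for
  the chosen \<open>frechet_derivative\<close> at the next level.\<close>

lemma diff_on_SucI:
  assumes "open S" "\<And>x. x \<in> S \<Longrightarrow> (f has_derivative f' x) (at x)"
    and "\<And>v. diff_on k S (\<lambda>x. f' x v)"
  shows "diff_on (Suc k) S f"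
proof -
  have "diff_on k S (\<lambda>x. frechet_derivative f (at x) v)" for v
    using assms by (subst diff_on_cong[where g = "\<lambda>x. f' x v"]) (simp_all add: frechet_derivative_eq[of f "f' x" x for x])
  then show ?thesis using assms(2) by (auto simp: differentiable_def)
qed

lemma diff_on_linear:
  assumes "open S" "linear l"
  shows "diff_on k S l"
proof (cases k)
  case (Suc n)
  show ?thesis unfolding Suc
    by (rule diff_on_SucI[where f' = "\<lambda>x. l"])
       (use assms in \<open>auto simp: diff_on_const linear_conv_bounded_linear bounded_linear_imp_has_derivative\<close>)
qed simp

lemma diff_on_add:
  assumes "open S" "diff_on k S f" "diff_on k S g"
  shows "diff_on k S (\<lambda>x. f x + g x)"
  using assms(2,3)
proof (induction k arbitrary: f g)
  case (Suc k)
  show ?case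
  proof (rule diff_on_SucI[where f' = "\<lambda>x v. frechet_derivative f (at x) v + frechet_derivative g (at x) v"])
    show "((\<lambda>x. f x + g x) has_derivative
        (\<lambda>v. frechet_derivative f (at x) v + frechet_derivative g (at x) v)) (at x)" if "x \<in> S" for x
      using diff_onD[OF Suc.prems(1) _ that] diff_onD[OF Suc.prems(2) _ that]
      by (intro has_derivative_add) auto
  qed (use Suc assms(1) in auto)
qed simp

lemma diff_on_sum:
  assumes "open S" "\<And>b. b \<in> B \<Longrightarrow> diff_on k S (f b)"
  shows "diff_on k S (\<lambda>x. \<Sum>b\<in>B. f b x)"
  using assms(2) by (induction B rule: infinite_finite_induct) (auto intro: diff_on_const diff_on_add[OF assms(1)])

lemma diff_on_scaleR:
  assumes "open S" "diff_on k S f" "diff_on k S g"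
  shows "diff_on k S (\<lambda>x. f x *\<^sub>R g x)"
  using assms(2,3)
proof (induction k arbitrary: f g)
  case (Suc k)
  show ?case
  proof (rule diff_on_SucI[where f' = "\<lambda>x v. f x *\<^sub>R frechet_derivative g (at x) v + frechet_derivative f (at x) v *\<^sub>R g x"])
    show "((\<lambda>x. f x *\<^sub>R g x) has_derivative
        (\<lambda>v. f x *\<^sub>R frechet_derivative g (at x) v + frechet_derivative f (at x) v *\<^sub>R g x)) (at x)" if "x \<in> S" for x
      using diff_onD[OF Suc.prems(1) _ that] diff_onD[OF Suc.prems(2) _ that]
      by (intro has_derivative_scaleR) auto
    show "diff_on k S (\<lambda>x. f x *\<^sub>R frechet_derivative g (at x) v + frechet_derivative f (at x) v *\<^sub>R g x)" for v
      by (rule diff_on_add[OF assms(1)]; rule Suc.IH)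
         (use Suc.prems in \<open>auto simp: diff_on_Suc_imp[unfolded diff_on.simps(2)] simp del: diff_on.simps intro: diff_on_Suc_imp\<close>, use Suc.prems in auto)
  qed (use assms(1) in auto)
qed simp

lemma diff_on_inner_left:
  assumes "open S" "diff_on k S f"
  shows "diff_on k S (\<lambda>x. f x \<bullet> a)"
  using assms(2)
proof (induction k arbitrary: f)
  case (Suc k)
  show ?case
  proof (rule diff_on_SucI[where f' = "\<lambda>x v. frechet_derivative f (at x) v \<bullet> a"])
    show "((\<lambda>x. f x \<bullet> a) has_derivative (\<lambda>v. frechet_derivative f (at x) v \<bullet> a)) (at x)" if "x \<in> S" for x
      using diff_onD[OF Suc.prems(1) _ that] by (intro has_derivative_inner_left) auto
  qed (use Suc assms(1) in auto)
qed simp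

lemma linear_euclidean_sum:
  fixes l :: "'a::euclidean_space \<Rightarrow> 'b::real_vector"
  assumes "linear l"
  shows "l u = (\<Sum>b\<in>Basis. (u \<bullet> b) *\<^sub>R l b)"
proof -
  have "l u = l (\<Sum>b\<in>Basis. (u \<bullet> b) *\<^sub>R b)" by (simp add: euclidean_representation)
  then show ?thesis using assms by (simp add: linear_sum linear_cmul)
qed

lemma diff_on_apply:
  fixes L :: "'e::euclidean_space \<Rightarrow> 'f::euclidean_space \<Rightarrow> 'g::real_normed_vector"
  assumes "open S" "\<And>x. x \<in> S \<Longrightarrow> linear (L x)" "\<And>b. b \<in> Basis \<Longrightarrow> diff_on k S (\<lambda>x. L x b)" "diff_on k S u"
  shows "diff_on k S (\<lambda>x. L x (u x))"
proof -
  have "diff_on k S (\<lambda>x. \<Sum>b\<in>Basis. (u x \<bullet> b) *\<^sub>R L x b)"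
    by (intro diff_on_sum diff_on_scaleR diff_on_inner_left assms)
  then show ?thesis
    by (subst diff_on_cong[OF assms(1)]) (use assms(2) linear_euclidean_sum in auto)
qed

text \<open>The chain rule leaves the linear maps given by the derivative of \<open>f\<close> at
  \<open>g x\<close>, applied to the derivative of \<open>g\<close>. The induction runs over all
  \<open>f\<close>, so that it covers the derivative of \<open>f\<close> composed with
  \<open>g\<close>.\<close>

lemma diff_on_compose:
  assumes "open S" "diff_on k T f" "diff_on k S g" "g ` S \<subseteq> T"
  shows "diff_on k S (\<lambda>x. f (g x))"
  using assms(2,3)
proof (induction k arbitrary: f)
  case (Suc k)
  show ?case
  proof (rule diff_on_SucI[where f' = "\<lambda>x v. frechet_derivative f (at (g x)) (frechet_derivative g (at x) v)"])
    show "((\<lambda>x. f (g x)) has_derivative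
        (\<lambda>v. frechet_derivative f (at (g x)) (frechet_derivative g (at x) v))) (at x)" if "x \<in> S" for x
      using diff_chain_at[OF diff_onD[OF Suc.prems(2) _ that] diff_onD[OF Suc.prems(1)], of ] assms(4) that
      by (auto simp: o_def)
    show "diff_on k S (\<lambda>x. frechet_derivative f (at (g x)) (frechet_derivative g (at x) v))" for v
    proof (rule diff_on_apply[OF assms(1)])
      show "linear (frechet_derivative f (at (g x)))" if "x \<in> S" for x
        using Suc.prems(1) assms(4) that by (auto intro: linear_frechet_derivative)
      show "diff_on k S (\<lambda>x. frechet_derivative f (at (g x)) b)" for b
        using Suc.prems assms(1) by (intro Suc.IH) (auto dest: diff_on_Suc_imp simp del: diff_on.simps, auto)
    qed (use Suc.prems in auto)
  qed (use assms(1) in auto)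
qed simp

text \<open>A family of linear maps occurs here as a plain function, without a norm on the space of
  maps. Expanding the argument in the basis reduces the product rule to finitely many scalar
  multiplications.\<close>

lemma has_derivative_apply:
  fixes L :: "'p::real_normed_vector \<Rightarrow> 'f::euclidean_space \<Rightarrow> 'g::real_normed_vector"
  assumes L: "\<And>b. b \<in> Basis \<Longrightarrow> ((\<lambda>t. L t b) has_derivative (\<lambda>h. L' h b)) (at t within N)"
    and lin: "\<And>s. s \<in> N \<Longrightarrow> linear (L s)" "\<And>h. linear (L' h)" and t: "t \<in> N"
    and u: "(u has_derivative u') (at t within N)"
  shows "((\<lambda>s. L s (u s)) has_derivative (\<lambda>h. L' h (u t) + L t (u' h))) (at t within N)"
proof -
  have "((\<lambda>s. \<Sum>b\<in>Basis. (u s \<bullet> b) *\<^sub>R L s b) has_derivative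
      (\<lambda>h. \<Sum>b\<in>Basis. (u t \<bullet> b) *\<^sub>R L' h b + (u' h \<bullet> b) *\<^sub>R L t b)) (at t within N)"
    by (intro has_derivative_sum has_derivative_scaleR has_derivative_inner_left L u)
  moreover have "(\<Sum>b\<in>Basis. (u t \<bullet> b) *\<^sub>R L' h b + (u' h \<bullet> b) *\<^sub>R L t b) = L' h (u t) + L t (u' h)" for h
    by (simp add: sum.distrib linear_euclidean_sum[OF lin(2), of h "u t"] linear_euclidean_sum[OF lin(1)[OF t], of "u' h"])
  ultimately have "((\<lambda>s. \<Sum>b\<in>Basis. (u s \<bullet> b) *\<^sub>R L s b) has_derivative
      (\<lambda>h. L' h (u t) + L t (u' h))) (at t within N)" by simp
  then show ?thesis
    by (rule has_derivative_transform[OF t, rotated]) (use lin(1) linear_euclidean_sum in blast)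
qed

text \<open>Supplies the linearity of \<open>L'\<close> that \<open>has_derivative_apply\<close>
  demands.\<close>

lemma frechet_derivative_linear_family:
  fixes L :: "'e::real_normed_vector \<Rightarrow> 'f::real_vector \<Rightarrow> 'g::real_normed_vector"
  assumes "open S" "x \<in> S" "\<And>y. y \<in> S \<Longrightarrow> linear (L y)" "\<And>b. (\<lambda>y. L y b) differentiable at x"
  shows "linear (\<lambda>b. frechet_derivative (\<lambda>y. L y b) (at x) h)"
proof (rule linearI)
  note d = assms(4)[unfolded frechet_derivative_works]
  fix a b :: 'f and r :: real
  have "((\<lambda>y. L y (a + b)) has_derivative (\<lambda>h. frechet_derivative (\<lambda>y. L y a) (at x) h
      + frechet_derivative (\<lambda>y. L y b) (at x) h)) (at x)"
    by (rule has_derivative_transform_within_open[OF has_derivative_add[OF d[of a] d[of b]] assms(1,2)])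
       (use assms(3) in \<open>auto simp: linear_add\<close>)
  from frechet_derivative_eq[OF this]
  show "frechet_derivative (\<lambda>y. L y (a + b)) (at x) h = frechet_derivative (\<lambda>y. L y a) (at x) h
      + frechet_derivative (\<lambda>y. L y b) (at x) h" by simp
  have "((\<lambda>y. L y (r *\<^sub>R a)) has_derivative (\<lambda>h. r *\<^sub>R frechet_derivative (\<lambda>y. L y a) (at x) h)) (at x)"
    by (rule has_derivative_transform_within_open[OF has_derivative_scaleR_right[OF d[of a]] assms(1,2)])
       (use assms(3) in \<open>auto simp: linear_cmul\<close>)
  from frechet_derivative_eq[OF this]
  show "frechet_derivative (\<lambda>y. L y (r *\<^sub>R a)) (at x) h = r *\<^sub>R frechet_derivative (\<lambda>y. L y a) (at x) h" by simp
qed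

lemma has_derivative_compose_at:
  assumes "(f has_derivative f') (at (x t))" "(x has_derivative x') (at t within N)"
  shows "((\<lambda>s. f (x s)) has_derivative (\<lambda>h. f' (x' h))) (at t within N)"
  using has_derivative_compose[OF assms(2,1)] .

text \<open>The parameter \<open>t\<close> lives in any normed space: with the identity for
  \<open>x\<close> the rule differentiates over an open set of coordinates, with real
  \<open>t\<close> along a curve.\<close>

lemma has_derivative_family_apply:
  fixes L :: "'e::real_normed_vector \<Rightarrow> 'f::euclidean_space \<Rightarrow> 'g::real_normed_vector"
  assumes "open S" "\<And>y. y \<in> S \<Longrightarrow> linear (L y)" "\<And>b. (\<lambda>y. L y b) differentiable at (x t)"
    and "x ` N \<subseteq> S" "t \<in> N" "(x has_derivative x') (at t within N)" "(u has_derivative u') (at t within N)"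
  shows "((\<lambda>s. L (x s) (u s)) has_derivative
    (\<lambda>h. frechet_derivative (\<lambda>y. L y (u t)) (at (x t)) (x' h) + L (x t) (u' h))) (at t within N)"
proof (rule has_derivative_apply[where L' = "\<lambda>h b. frechet_derivative (\<lambda>y. L y b) (at (x t)) (x' h)"])
  show "((\<lambda>s. L (x s) b) has_derivative (\<lambda>h. frechet_derivative (\<lambda>y. L y b) (at (x t)) (x' h))) (at t within N)" for b
    by (rule has_derivative_compose_at[OF assms(3)[unfolded frechet_derivative_works] assms(6)])
  show "linear (\<lambda>b. frechet_derivative (\<lambda>y. L y b) (at (x t)) (x' h))" for h
    by (rule frechet_derivative_linear_family[OF assms(1)]) (use assms in auto)
qed (use assms in auto)

lemma bilinear_linear1: "bilinear B \<Longrightarrow> linear (\<lambda>a. B a b)"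
  and bilinear_linear2: "bilinear B \<Longrightarrow> linear (B a)"
  by (simp_all add: bilinear_def)

lemma has_derivative_family_apply2:
  fixes B :: "'e::real_normed_vector \<Rightarrow> 'f::euclidean_space \<Rightarrow> 'h::euclidean_space \<Rightarrow> 'g::real_normed_vector"
  assumes "open S" "\<And>y. y \<in> S \<Longrightarrow> bilinear (B y)" "\<And>a b. (\<lambda>y. B y a b) differentiable at (x t)"
    and "x ` N \<subseteq> S" "t \<in> N" "(x has_derivative x') (at t within N)"
    and "(u has_derivative u') (at t within N)" "(v has_derivative v') (at t within N)"
  shows "((\<lambda>s. B (x s) (u s) (v s)) has_derivative
    (\<lambda>h. frechet_derivative (\<lambda>y. B y (u t) (v t)) (at (x t)) (x' h)
        + B (x t) (u' h) (v t) + B (x t) (u t) (v' h))) (at t within N)"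
\<comment> \<open>Currying: the linear case treats the point and the first argument for each fixed
  \<open>b\<close>, and the resulting family is again linear in \<open>b\<close>.\<close>
proof (rule has_derivative_apply[where L = "\<lambda>s. B (x s) (u s)" and L' = "\<lambda>h b. frechet_derivative (\<lambda>y. B y (u t) b) (at (x t)) (x' h)
        + B (x t) (u' h) b"])
  show "((\<lambda>s. B (x s) (u s) b) has_derivative
     (\<lambda>h. frechet_derivative (\<lambda>y. B y (u t) b) (at (x t)) (x' h) + B (x t) (u' h) b)) (at t within N)" for b
    by (rule has_derivative_family_apply[where L = "\<lambda>y a. B y a b", OF assms(1)])
       (use assms in \<open>auto intro: bilinear_linear1\<close>)
  show "linear (\<lambda>b. frechet_derivative (\<lambda>y. B y (u t) b) (at (x t)) (x' h) + B (x t) (u' h) b)" for h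
    by (rule linear_compose_add[OF frechet_derivative_linear_family[OF assms(1)]])
       (use assms(2-5) in \<open>auto intro!: bilinear_linear2\<close>)
qed (use assms in \<open>auto intro!: bilinear_linear2\<close>)

lemma has_vector_derivative_compose_at:
  assumes "(f has_derivative f') (at (x t))" "(x has_vector_derivative x') (at t within N)"
  shows "((\<lambda>s. f (x s)) has_vector_derivative f' x') (at t within N)"
proof -
  have "(\<lambda>h. f' (h *\<^sub>R x')) = (\<lambda>h. h *\<^sub>R f' x')"
    using has_derivative_linear[OF assms(1)] by (simp add: linear_cmul)
  then show ?thesis
    using has_derivative_compose_at[OF assms(1) assms(2)[unfolded has_vector_derivative_def]]
    by (simp add: has_vector_derivative_def)
qed

lemma has_vector_derivative_family_apply:
  fixes L :: "'e::real_normed_vector \<Rightarrow> 'f::euclidean_space \<Rightarrow> 'g::real_normed_vector"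
  assumes "open S" "\<And>y. y \<in> S \<Longrightarrow> linear (L y)" "\<And>b. (\<lambda>y. L y b) differentiable at (x t)"
    and "x ` N \<subseteq> S" "t \<in> N" "(x has_vector_derivative x') (at t within N)" "(u has_vector_derivative u') (at t within N)"
  shows "((\<lambda>s. L (x s) (u s)) has_vector_derivative
    (frechet_derivative (\<lambda>y. L y (u t)) (at (x t)) x' + L (x t) u')) (at t within N)"
proof -
  have "linear (frechet_derivative (\<lambda>y. L y (u t)) (at (x t)))" "linear (L (x t))"
    using assms by (auto intro: linear_frechet_derivative)
  then show ?thesis
    using has_derivative_family_apply[OF assms(1-5) assms(6,7)[unfolded has_vector_derivative_def]]
    by (simp add: has_vector_derivative_def linear_cmul scaleR_add_right)
qed

lemma has_vector_derivative_family_apply2: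
  fixes B :: "'e::real_normed_vector \<Rightarrow> 'f::euclidean_space \<Rightarrow> 'h::euclidean_space \<Rightarrow> 'g::real_normed_vector"
  assumes "open S" "\<And>y. y \<in> S \<Longrightarrow> bilinear (B y)" "\<And>a b. (\<lambda>y. B y a b) differentiable at (x t)"
    and "x ` N \<subseteq> S" "t \<in> N" "(x has_vector_derivative x') (at t within N)"
    and "(u has_vector_derivative u') (at t within N)" "(v has_vector_derivative v') (at t within N)"
  shows "((\<lambda>s. B (x s) (u s) (v s)) has_vector_derivative
    (frechet_derivative (\<lambda>y. B y (u t) (v t)) (at (x t)) x'
        + B (x t) u' (v t) + B (x t) (u t) v')) (at t within N)"
proof -
  have "linear (frechet_derivative (\<lambda>y. B y (u t) (v t)) (at (x t)))" "bilinear (B (x t))"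
    using assms by (auto intro: linear_frechet_derivative)
  then show ?thesis
    using has_derivative_family_apply2[OF assms(1-5) assms(6-8)[unfolded has_vector_derivative_def]]
    by (simp add: has_vector_derivative_def linear_cmul scaleR_add_right bilinear_lmul bilinear_rmul)
qed

text \<open>Two uses of the mean value theorem: first in the direction \<open>u\<close>, for the
  increment of \<open>f\<close> by \<open>s\<close> times \<open>v\<close>, then in the direction
  \<open>v\<close>, for the derivative of \<open>f\<close> along \<open>u\<close>.\<close>

lemma second_difference_mvt:
  fixes f :: "'e::euclidean_space \<Rightarrow> real"
  assumes "open S" "diff_on 2 S f" "s > 0"
    and S: "\<And>p q. 0 \<le> p \<Longrightarrow> p \<le> s \<Longrightarrow> 0 \<le> q \<Longrightarrow> q \<le> s \<Longrightarrow> a + p *\<^sub>R u + q *\<^sub>R v \<in> S"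
  obtains p q where "0 \<le> p" "p \<le> s" "0 \<le> q" "q \<le> s"
    "f (a + s *\<^sub>R u + s *\<^sub>R v) - f (a + s *\<^sub>R u) - f (a + s *\<^sub>R v) + f a
      = s * s * frechet_derivative (\<lambda>x. frechet_derivative f (at x) u) (at (a + p *\<^sub>R u + q *\<^sub>R v)) v"
proof -
  have f1: "(f has_derivative frechet_derivative f (at x)) (at x)" if "x \<in> S" for x
    using diff_onD[OF assms(2) _ that] by simp
  let ?g = "\<lambda>x. frechet_derivative f (at x) u"
  have "diff_on 1 S ?g" using assms(2) by (simp add: numeral_2_eq_2)
  then have f2: "(?g has_derivative frechet_derivative ?g (at x)) (at x)" if "x \<in> S" for x
    by (rule diff_onD) (use that in auto)
  have line: "((\<lambda>r. b + r *\<^sub>R w) has_vector_derivative w) (at r within T)" for b w :: 'e and r T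
    by (auto intro!: derivative_eq_intros)
  let ?h = "\<lambda>p. f ((a + s *\<^sub>R v) + p *\<^sub>R u) - f (a + p *\<^sub>R u)"
  have h: "(?h has_real_derivative (?g ((a + s *\<^sub>R v) + p *\<^sub>R u) - ?g (a + p *\<^sub>R u))) (at p)" if "0 \<le> p" "p \<le> s" for p
    unfolding has_real_derivative_iff_has_vector_derivative
    using S[of p s] S[of p 0] that assms(3)
    by (intro has_vector_derivative_diff has_vector_derivative_compose_at[OF f1 line]) (auto simp: ac_simps)
  obtain p where p: "0 < p" "p < s" "?h s - ?h 0 = s * (?g ((a + s *\<^sub>R v) + p *\<^sub>R u) - ?g (a + p *\<^sub>R u))"
    using MVT2[of 0 s ?h, OF assms(3) h] by auto
  let ?k = "\<lambda>q. ?g ((a + p *\<^sub>R u) + q *\<^sub>R v)"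
  have k: "(?k has_real_derivative (frechet_derivative ?g (at ((a + p *\<^sub>R u) + q *\<^sub>R v)) v)) (at q)" if "0 \<le> q" "q \<le> s" for q
    unfolding has_real_derivative_iff_has_vector_derivative
    using S[of p q] that p
    by (intro has_vector_derivative_compose_at[OF f2 line]) auto
  obtain q where q: "0 < q" "q < s" "?k s - ?k 0 = s * frechet_derivative ?g (at ((a + p *\<^sub>R u) + q *\<^sub>R v)) v"
    using MVT2[of 0 s ?k, OF assms(3) k] by auto
  have "?h s - ?h 0 = s * (?k s - ?k 0)" using p(3) by (simp add: ac_simps)
  with q p show ?thesis by (intro that[of p q]) (auto simp: ac_simps)
qed

text \<open>The second difference is symmetric in \<open>u\<close> and \<open>v\<close>, so the two
  mixed derivatives take a common value at two points of an arbitrarily small parallelogram at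
  \<open>a\<close>. Their continuity, which the third level provides, carries this to
  \<open>a\<close>.\<close>

lemma symmetric_second_derivative_real:
  fixes f :: "'e::euclidean_space \<Rightarrow> real"
  assumes S: "open S" "a \<in> S" and f: "diff_on 3 S f"
  shows "frechet_derivative (\<lambda>x. frechet_derivative f (at x) u) (at a) v
       = frechet_derivative (\<lambda>x. frechet_derivative f (at x) v) (at a) u"
proof (rule ccontr)
  define P where "P u v x = frechet_derivative (\<lambda>x. frechet_derivative f (at x) u) (at x) v" for u v x
  assume "\<not> ?thesis"
  then have "P u v a \<noteq> P v u a" by (simp add: P_def)
  \<comment> \<open>Half of the gap: a common value cannot lie within this distance of both
    derivatives at \<open>a\<close>.\<close>
  then have e: "\<bar>P u v a - P v u a\<bar> / 2 > 0" (is "?e > 0") by simp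
  have "isCont (P u v) a" for u v
  proof -
    have "diff_on 1 S (P u v)" using f by (simp add: P_def[abs_def] numeral_3_eq_3)
    from diff_onD[OF this _ S(2)] show ?thesis using has_derivative_continuous by auto
  qed
  then have "\<exists>d>0. \<forall>x. dist x a < d \<longrightarrow> dist (P u v x) (P u v a) < ?e" for u v
    using e unfolding continuous_at_eps_delta by blast
  then obtain d1 d2 where d1: "d1 > 0" "\<And>x. dist x a < d1 \<Longrightarrow> dist (P u v x) (P u v a) < ?e"
    and d2: "d2 > 0" "\<And>x. dist x a < d2 \<Longrightarrow> dist (P v u x) (P v u a) < ?e" by metis
  obtain d3 where d3: "d3 > 0" "ball a d3 \<subseteq> S" using S open_contains_ball by blast
  define d where "d = min d1 (min d2 d3)"
  \<comment> \<open>Makes the parallelogram with sides \<open>s\<close> times \<open>u\<close> and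
    \<open>v\<close> fit into the ball of radius \<open>d\<close>; the summand 1 keeps the
    denominator positive when \<open>u\<close> and \<open>v\<close> are 0.\<close>
  define s where "s = d / 2 / (norm u + norm v + 1)"
  have d: "d > 0" using d1 d2 d3 by (simp add: d_def)
  have nuv: "norm u + norm v + 1 > 0" by (simp add: add_nonneg_pos)
  then have s: "s > 0" using d by (simp add: s_def)
  have near: "dist (a + p *\<^sub>R u + q *\<^sub>R v) a < d" if "0 \<le> p" "p \<le> s" "0 \<le> q" "q \<le> s" for p q
  proof -
    have "dist (a + p *\<^sub>R u + q *\<^sub>R v) a = norm (p *\<^sub>R u + q *\<^sub>R v)" by (simp add: dist_norm algebra_simps)
    also have "\<dots> \<le> p * norm u + q * norm v" using that norm_triangle_ineq[of "p *\<^sub>R u" "q *\<^sub>R v"] by simp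
    also have "\<dots> \<le> s * norm u + s * norm v" using that by (intro add_mono mult_right_mono) auto
    also have "\<dots> \<le> s * (norm u + norm v + 1)" using s by (simp add: algebra_simps)
    also have "\<dots> = d / 2" using nuv unfolding s_def by (metis less_irrefl nonzero_eq_divide_eq)
    finally show ?thesis using d by simp
  qed
  have near': "dist (a + p *\<^sub>R v + q *\<^sub>R u) a < d" if "0 \<le> p" "p \<le> s" "0 \<le> q" "q \<le> s" for p q
    using near[OF that(3,4,1,2)] by (simp add: ac_simps)
  have inS: "x \<in> S" if "dist x a < d" for x
    using that d3 by (auto simp: d_def mem_ball dist_commute)
  have f2: "diff_on 2 S f" by (rule diff_on_le[OF f]) simp
  obtain p q where pq: "0 \<le> p" "p \<le> s" "0 \<le> q" "q \<le> s"
    "f (a + s *\<^sub>R u + s *\<^sub>R v) - f (a + s *\<^sub>R u) - f (a + s *\<^sub>R v) + f a = s * s * P u v (a + p *\<^sub>R u + q *\<^sub>R v)"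
    using second_difference_mvt[OF S(1) f2 s, of a u v] near inS unfolding P_def by metis
  obtain p' q' where pq': "0 \<le> p'" "p' \<le> s" "0 \<le> q'" "q' \<le> s"
    "f (a + s *\<^sub>R v + s *\<^sub>R u) - f (a + s *\<^sub>R v) - f (a + s *\<^sub>R u) + f a = s * s * P v u (a + p' *\<^sub>R v + q' *\<^sub>R u)"
    using second_difference_mvt[OF S(1) f2 s, of a v u] near' inS unfolding P_def by metis
  have "f (a + s *\<^sub>R v + s *\<^sub>R u) = f (a + s *\<^sub>R u + s *\<^sub>R v)" by (simp add: add.commute add.left_commute)
  then have "s * s * P u v (a + p *\<^sub>R u + q *\<^sub>R v) = s * s * P v u (a + p' *\<^sub>R v + q' *\<^sub>R u)"
    using pq(5) pq'(5) by linarith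
  then have "P u v (a + p *\<^sub>R u + q *\<^sub>R v) = P v u (a + p' *\<^sub>R v + q' *\<^sub>R u)" using s by simp
  moreover have "dist (P u v (a + p *\<^sub>R u + q *\<^sub>R v)) (P u v a) < ?e"
    using near[OF pq(1-4)] by (intro d1) (simp add: d_def)
  moreover have "dist (P v u (a + p' *\<^sub>R v + q' *\<^sub>R u)) (P v u a) < ?e"
    using near'[OF pq'(1-4)] by (intro d2) (simp add: d_def)
  ultimately show False unfolding dist_real_def by argo
qed

lemma frechet_derivative_inner_left:
  assumes "f differentiable at x"
  shows "frechet_derivative (\<lambda>x. f x \<bullet> b) (at x) = (\<lambda>h. frechet_derivative f (at x) h \<bullet> b)"
  using assms by (intro frechet_derivative_eq has_derivative_inner_left) (simp add: frechet_derivative_works)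

lemma symmetric_second_derivative:
  fixes f :: "'e::euclidean_space \<Rightarrow> 'f::euclidean_space"
  assumes S: "open S" "a \<in> S" and f: "diff_on 3 S f"
  shows "frechet_derivative (\<lambda>x. frechet_derivative f (at x) u) (at a) v
       = frechet_derivative (\<lambda>x. frechet_derivative f (at x) v) (at a) u"
proof (rule euclidean_eqI)
  fix b :: 'f assume "b \<in> Basis"
  have "frechet_derivative (\<lambda>x. frechet_derivative (\<lambda>x. f x \<bullet> b) (at x) u) (at a) v
      = frechet_derivative (\<lambda>x. frechet_derivative f (at x) u) (at a) v \<bullet> b" for u v
  proof -
    have "frechet_derivative (\<lambda>x. frechet_derivative (\<lambda>x. f x \<bullet> b) (at x) u) (at a)
       = frechet_derivative (\<lambda>x. frechet_derivative f (at x) u \<bullet> b) (at a)"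
      by (rule frechet_derivative_cong_open[OF S])
         (use f in \<open>simp add: frechet_derivative_inner_left numeral_3_eq_3\<close>)
    then show ?thesis using f S(2) by (simp add: frechet_derivative_inner_left numeral_3_eq_3)
  qed
  then show "frechet_derivative (\<lambda>x. frechet_derivative f (at x) u) (at a) v \<bullet> b
       = frechet_derivative (\<lambda>x. frechet_derivative f (at x) v) (at a) u \<bullet> b"
    using symmetric_second_derivative_real[OF S diff_on_inner_left[OF S(1) f, of b], of u v] by simp
qed

section \<open>Non-degenerate bilinear forms\<close>

definition nondegenerate :: "('e::real_vector \<Rightarrow> 'e \<Rightarrow> real) \<Rightarrow> bool" where
  "nondegenerate b \<longleftrightarrow> (\<forall>u. (\<forall>v. b u v = 0) \<longrightarrow> u = 0)"

text \<open>Raising of an index. The covector is stored as the vector \<open>k\<close> through the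
  Euclidean inner product, so that raising and lowering are maps of one space to itself.\<close>

definition riesz :: "('e::euclidean_space \<Rightarrow> 'e \<Rightarrow> real) \<Rightarrow> 'e \<Rightarrow> 'e" where
  "riesz b k = (THE w. \<forall>v. b w v = k \<bullet> v)"

lemma nondegenerate_eqI:
  assumes "bilinear b" "nondegenerate b" "\<And>v. b u v = b w v"
  shows "u = w"
proof -
  have "b (u - w) v = 0" for v using assms(1,3) by (simp add: bilinear_lsub)
  then have "u - w = 0" using assms(2) unfolding nondegenerate_def by blast
  then show ?thesis by simp
qed

text \<open>Lowering of an index, the inverse of \<open>riesz b\<close> for non-degenerate
  \<open>b\<close>.\<close>

definition lower :: "('e::euclidean_space \<Rightarrow> 'e \<Rightarrow> real) \<Rightarrow> 'e \<Rightarrow> 'e" where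
  "lower b u = (\<Sum>i\<in>Basis. b u i *\<^sub>R i)"

lemma lower_inner:
  assumes "bilinear b"
  shows "lower b u \<bullet> v = b u v"
  using linear_euclidean_sum[OF bilinear_linear2[OF assms], of u v]
  by (simp add: lower_def inner_sum_left inner_commute[of v] mult.commute)

lemma linear_lower: "bilinear b \<Longrightarrow> linear (lower b)"
  unfolding lower_def
  by (intro linear_compose_sum) (auto intro!: linearI simp: bilinear_ladd bilinear_lmul scaleR_add_left)

text \<open>Non-degeneracy makes \<open>lower b\<close> injective, hence surjective in finite
  dimension.\<close>

lemma
  assumes "bilinear b" "nondegenerate b"
  shows riesz: "b (riesz b k) v = k \<bullet> v"
    and riesz_eqI: "(\<And>v. b w v = k \<bullet> v) \<Longrightarrow> riesz b k = w"
proof -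
  have "inj (lower b)"
    using assms by (subst linear_injective_0[OF linear_lower[OF assms(1)]])
      (metis lower_inner inner_zero_left nondegenerate_def)
  then have "surj (lower b)"
    using linear_lower[OF assms(1)] linear_injective_imp_surjective by blast
  then obtain w0 where w0: "lower b w0 = k" by (metis surjD)
  have *: "riesz b k = w" if "\<And>v. b w v = k \<bullet> v" for w
    unfolding riesz_def
    by (rule the_equality) (use that nondegenerate_eqI[OF assms] in auto)
  show "b (riesz b k) v = k \<bullet> v"
    using *[of w0] w0 lower_inner[OF assms(1)] by metis
  show "(\<And>v. b w v = k \<bullet> v) \<Longrightarrow> riesz b k = w" by (rule *)
qed

lemma lower_riesz:
  assumes "bilinear b" "nondegenerate b"
  shows "lower b (riesz b k) = k" "riesz b (lower b u) = u"
proof -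
  show "lower b (riesz b k) = k"
    by (rule vector_eq_rdot[THEN iffD1]) (use assms in \<open>auto simp: lower_inner riesz\<close>)
  show "riesz b (lower b u) = u"
    by (rule riesz_eqI) (use assms in \<open>auto simp: lower_inner\<close>)
qed

lemma differentiable_scaleR_const:
  "f differentiable (at x within N) \<Longrightarrow> (\<lambda>x. f x *\<^sub>R a) differentiable (at x within N)"
  unfolding differentiable_def by (blast intro: has_derivative_scaleR_left)

text \<open>The inverse of \<open>(x, u) \<mapsto> (x, lower (G x) u)\<close> is differentiable by the inverse function
  theorem.\<close>

lemma riesz_differentiable:
  fixes G :: "'e::euclidean_space \<Rightarrow> 'f::euclidean_space \<Rightarrow> 'f \<Rightarrow> real"
  assumes S: "open S" and G: "\<And>x. x \<in> S \<Longrightarrow> bilinear (G x)" "\<And>x. x \<in> S \<Longrightarrow> nondegenerate (G x)"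
    and dG: "\<And>u v x. x \<in> S \<Longrightarrow> (\<lambda>x. G x u v) differentiable at x"
    and x0: "x0 \<in> S"
  shows "(\<lambda>(x, k). riesz (G x) k) differentiable at (x0, k0)"
proof -
  define f where "f = (\<lambda>z::'e \<times> 'f. (fst z, lower (G (fst z)) (snd z)))"
  define g where "g = (\<lambda>z::'e \<times> 'f. (fst z, riesz (G (fst z)) (snd z)))"
  define D where "D w x h = frechet_derivative (\<lambda>y. lower (G y) w) (at x) h" for w x h
  define f' where "f' = (\<lambda>z h::'e \<times> 'f. (fst h, D (snd z) (fst z) (fst h) + lower (G (fst z)) (snd h)))"
  let ?T = "S \<times> (UNIV :: 'f set)"
  have oT: "open ?T" using S by (simp add: open_Times)
  have df: "(f has_derivative f' z) (at z)" if "z \<in> ?T" for z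
  proof -
    have z: "fst z \<in> S" using that by auto
    have dl: "(\<lambda>y. lower (G y) b) differentiable at (fst z)" for b
      unfolding lower_def
      by (intro differentiable_sum finite_Basis ballI)
        (rule differentiable_scaleR_const[OF dG[OF z]])
    have "((\<lambda>s. lower (G (fst s)) (snd s)) has_derivative
      (\<lambda>h. frechet_derivative (\<lambda>y. lower (G y) (snd z)) (at (fst z)) (fst h) + lower (G (fst z)) (snd h))) (at z within ?T)"
      by (rule has_derivative_family_apply[where x = fst and u = snd and x' = fst and u' = snd, OF S])
         (use that dl in \<open>auto intro!: linear_lower G bounded_linear_imp_has_derivative bounded_linear_fst bounded_linear_snd\<close>)
    then show ?thesis unfolding f_def f'_def D_def at_within_open[OF that oT]
      by (rule has_derivative_Pair[OF bounded_linear_imp_has_derivative[OF bounded_linear_fst]])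
  qed
  define z0 where "z0 = (x0, riesz (G x0) k0)"
  have lr: "lower (G x0) (riesz (G x0) k) = k" for k by (rule lower_riesz) (use G x0 in auto)
  \<comment> \<open>The derivative of \<open>f\<close> is block triangular with the identity as
    first block; solving its second component for \<open>snd h\<close> gives this inverse.\<close>
  have "(g has_derivative (\<lambda>h. (fst h, riesz (G x0) (snd h - D (snd z0) x0 (fst h))))) (at (f z0))"
  proof (rule has_derivative_inverse_strong[OF oT _ _ _ df])
    show "continuous_on ?T f"
      by (intro continuous_at_imp_continuous_on ballI has_derivative_continuous[OF df])
    show "f' z0 \<circ> (\<lambda>h. (fst h, riesz (G x0) (snd h - D (snd z0) x0 (fst h)))) = id"
      by (auto simp: f'_def z0_def fun_eq_iff lr)
    show "g (f z) = z" if "z \<in> ?T" for z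
      using that by (auto simp: f_def g_def lower_riesz G)
  qed (use x0 in \<open>auto simp: z0_def\<close>)
  moreover have "f z0 = (x0, k0)" by (simp add: f_def z0_def lr)
  ultimately have "g differentiable at (x0, k0)" unfolding differentiable_def by metis
  then have "(\<lambda>z. snd (g z)) differentiable at (x0, k0)"
    unfolding differentiable_def using has_derivative_snd by blast
  then show ?thesis by (simp add: g_def case_prod_unfold)
qed

lemma riesz_differentiable_compose:
  fixes G :: "'e::euclidean_space \<Rightarrow> 'f::euclidean_space \<Rightarrow> 'f \<Rightarrow> real"
  assumes S: "open S" and G: "\<And>x. x \<in> S \<Longrightarrow> bilinear (G x)" "\<And>x. x \<in> S \<Longrightarrow> nondegenerate (G x)"
    and dG: "\<And>u v x. x \<in> S \<Longrightarrow> (\<lambda>x. G x u v) differentiable at x"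
    and x: "x t \<in> S" "x differentiable (at t within N)" and k: "k differentiable (at t within N)"
  shows "(\<lambda>s. riesz (G (x s)) (k s)) differentiable (at t within N)"
proof -
  obtain R where R: "((\<lambda>(x, k). riesz (G x) k) has_derivative R) (at (x t, k t))"
    using riesz_differentiable[OF S G dG x(1)] unfolding differentiable_def by blast
  obtain x' k' where "(x has_derivative x') (at t within N)" "(k has_derivative k') (at t within N)"
    using x k unfolding differentiable_def by blast
  then have "((\<lambda>s. (x s, k s)) has_derivative (\<lambda>h. (x' h, k' h))) (at t within N)"
    by (rule has_derivative_Pair)
  from has_derivative_compose_at[where x = "\<lambda>s. (x s, k s)", OF R this]
  show ?thesis unfolding differentiable_def by auto
qed

section \<open>The Levi-Civita connection in coordinates\<close>

abbreviation fd :: "('e::real_normed_vector \<Rightarrow> 'f::real_normed_vector) \<Rightarrow> 'e \<Rightarrow> 'e \<Rightarrow> 'f" where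
  "fd f x \<equiv> frechet_derivative f (at x)"

text \<open>\<open>christoffel\<close> for an arbitrary family \<open>G\<close> of bilinear forms in
  place of the metric in a chart, so that the calculations below involve neither manifolds nor
  charts.\<close>

definition chris :: "('e::euclidean_space \<Rightarrow> 'e \<Rightarrow> 'e \<Rightarrow> real) \<Rightarrow> 'e \<Rightarrow> 'e \<Rightarrow> 'e \<Rightarrow> 'e" where
  "chris G x = (THE \<Gamma>. bilinear \<Gamma> \<and> (\<forall>u v. \<Gamma> u v = \<Gamma> v u) \<and>
     (\<forall>u v w. fd (\<lambda>y. G y v w) x u = G x (\<Gamma> u v) w + G x v (\<Gamma> u w)))"

definition curv :: "('e::euclidean_space \<Rightarrow> 'e \<Rightarrow> 'e \<Rightarrow> 'e) \<Rightarrow> 'e \<Rightarrow> 'e \<Rightarrow> 'e \<Rightarrow> 'e \<Rightarrow> 'e" where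
  "curv \<Gamma> x u v w = fd (\<lambda>y. \<Gamma> y v w) x u - fd (\<lambda>y. \<Gamma> y u w) x v
     + \<Gamma> x u (\<Gamma> x v w) - \<Gamma> x v (\<Gamma> x u w)"

text \<open>No signature is fixed, since the locale serves both the Lorentzian and the Riemannian
  metric. Level 3 is what the symmetry of second derivatives of \<open>G\<close> asks for in
  \<open>curv_skew\<close>.\<close>

locale metric_coords =
  fixes S :: "'e::euclidean_space set" and G :: "'e \<Rightarrow> 'e \<Rightarrow> 'e \<Rightarrow> real"
  assumes open_S: "open S"
    and bilinear_G: "\<And>x. x \<in> S \<Longrightarrow> bilinear (G x)"
    and G_sym: "\<And>x u v. x \<in> S \<Longrightarrow> G x u v = G x v u"
    and nondegenerate_G: "\<And>x. x \<in> S \<Longrightarrow> nondegenerate (G x)"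
    and diff_on_G: "\<And>u v. diff_on 3 S (\<lambda>x. G x u v)"
begin

lemma G_differentiable: "x \<in> S \<Longrightarrow> (\<lambda>x. G x u v) differentiable at x"
  using diff_on_G[of u v] by (simp add: numeral_3_eq_3)

lemma dG_differentiable: "x \<in> S \<Longrightarrow> (\<lambda>x. fd (\<lambda>y. G y u v) x w) differentiable at x"
  using diff_on_G[of u v] by (simp add: numeral_3_eq_3)

lemma dG_linear:
  assumes "x \<in> S"
  shows "linear (fd (\<lambda>y. G y u v) x)" "linear (\<lambda>u. fd (\<lambda>y. G y u v) x w)" "linear (\<lambda>v. fd (\<lambda>y. G y u v) x w)"
proof -
  show "linear (fd (\<lambda>y. G y u v) x)"
    by (rule linear_frechet_derivative[OF G_differentiable[OF assms]])
  show "linear (\<lambda>u. fd (\<lambda>y. G y u v) x w)" "linear (\<lambda>v. fd (\<lambda>y. G y u v) x w)"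
    by (rule frechet_derivative_linear_family[OF open_S assms _ G_differentiable[OF assms]];
        simp add: bilinear_linear1 bilinear_linear2 bilinear_G)+
qed

lemma dG_sym: "x \<in> S \<Longrightarrow> fd (\<lambda>y. G y u v) x w = fd (\<lambda>y. G y v u) x w"
  using frechet_derivative_cong_open[OF open_S, of x "\<lambda>y. G y u v" "\<lambda>y. G y v u"] G_sym by simp

text \<open>The lowered Christoffel symbols according to Koszul's formula; raising them with
  \<open>riesz\<close> yields the connection.\<close>

definition koszul :: "'e \<Rightarrow> 'e \<Rightarrow> 'e \<Rightarrow> 'e" where
  "koszul x u v = (\<Sum>b\<in>Basis.
     ((fd (\<lambda>y. G y v b) x u + fd (\<lambda>y. G y u b) x v - fd (\<lambda>y. G y u v) x b) / 2) *\<^sub>R b)"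

lemma koszul_inner:
  assumes "x \<in> S"
  shows "koszul x u v \<bullet> w = (fd (\<lambda>y. G y v w) x u + fd (\<lambda>y. G y u w) x v - fd (\<lambda>y. G y u v) x w) / 2"
    (is "_ = ?k w")
proof -
  have "linear ?k"
    by (intro linearI)
       (simp_all add: dG_linear[OF assms, THEN linear_add] dG_linear[OF assms, THEN linear_cmul] field_simps)
  from linear_euclidean_sum[OF this, of w] show ?thesis
    by (simp add: koszul_def inner_sum_left inner_commute[of w] mult.commute)
qed

lemma riesz_koszul:
  assumes "x \<in> S"
  shows "G x (riesz (G x) (koszul x u v)) w
    = (fd (\<lambda>y. G y v w) x u + fd (\<lambda>y. G y u w) x v - fd (\<lambda>y. G y u v) x w) / 2"
  using assms by (simp add: riesz bilinear_G nondegenerate_G koszul_inner)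

text \<open>Koszul's formula gives existence. For uniqueness, the cyclic combination of the
  compatibility condition and the symmetry fix the pairing of \<Gamma> u v with every
  \<open>w\<close>, and \<open>G x\<close> is non-degenerate. This resolves the definite description
  in \<open>chris\<close>.\<close>

lemma chris_eq_riesz_koszul:
  assumes x: "x \<in> S"
  shows "chris G x = (\<lambda>u v. riesz (G x) (koszul x u v))"
proof -
  note lin = dG_linear[OF x, THEN linear_add] dG_linear[OF x, THEN linear_cmul]
  note bil = bilinear_G[OF x]
  let ?\<Gamma> = "\<lambda>u v. riesz (G x) (koszul x u v)"
  note eqI = nondegenerate_eqI[OF bil nondegenerate_G[OF x]]
  have sym: "?\<Gamma> u v = ?\<Gamma> v u" for u v
    by (rule eqI) (simp add: riesz_koszul[OF x] dG_sym[OF x, of u v])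
  have lin1: "linear (?\<Gamma> u)" for u
  proof (rule linearI)
    show "?\<Gamma> u (a + b) = ?\<Gamma> u a + ?\<Gamma> u b" for a b
      by (rule eqI) (simp add: bilinear_ladd[OF bil] riesz_koszul[OF x] lin field_simps)
    show "?\<Gamma> u (r *\<^sub>R a) = r *\<^sub>R ?\<Gamma> u a" for r a
      by (rule eqI) (simp add: bilinear_lmul[OF bil] riesz_koszul[OF x] lin field_simps)
  qed
  have "linear (\<lambda>u. ?\<Gamma> u v)" for v using lin1[of v] by (simp add: sym[of _ v])
  with lin1 have "bilinear ?\<Gamma>" by (simp add: bilinear_def)
  moreover have "fd (\<lambda>y. G y v w) x u = G x (?\<Gamma> u v) w + G x v (?\<Gamma> u w)" for u v w
    by (subst G_sym[OF x, of v]) (simp add: riesz_koszul[OF x] dG_sym[OF x, of w v] field_simps)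
  moreover have "\<Gamma> = ?\<Gamma>" if \<Gamma>: "\<And>u v. \<Gamma> u v = \<Gamma> v u"
    "\<And>u v w. fd (\<lambda>y. G y v w) x u = G x (\<Gamma> u v) w + G x v (\<Gamma> u w)" for \<Gamma>
  proof (intro ext eqI)
    fix u v w
    show "G x (\<Gamma> u v) w = G x (?\<Gamma> u v) w"
      unfolding riesz_koszul[OF x] \<Gamma>(2)
      using \<Gamma>(1)[of u v] \<Gamma>(1)[of u w] \<Gamma>(1)[of v w] G_sym[OF x] by simp
  qed
  ultimately show ?thesis
    unfolding chris_def using sym by (intro the_equality) blast+
qed

lemma chris_metric:
  assumes "x \<in> S"
  shows "G x (chris G x u v) w
    = (fd (\<lambda>y. G y v w) x u + fd (\<lambda>y. G y u w) x v - fd (\<lambda>y. G y u v) x w) / 2"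
  using assms by (simp add: chris_eq_riesz_koszul riesz_koszul)

lemma chris_compat: "x \<in> S \<Longrightarrow> fd (\<lambda>y. G y v w) x u = G x (chris G x u v) w + G x v (chris G x u w)"
  by (subst G_sym[of x v]) (simp_all add: chris_metric dG_sym[of x w v] field_simps)

lemma chris_sym:
  assumes x: "x \<in> S"
  shows "chris G x u v = chris G x v u"
  by (rule nondegenerate_eqI[OF bilinear_G[OF x] nondegenerate_G[OF x]])
     (simp add: chris_metric[OF x] dG_sym[OF x, of u v])

lemma bilinear_chris:
  assumes x: "x \<in> S"
  shows "bilinear (chris G x)"
proof -
  note lin = dG_linear[OF x, THEN linear_add] dG_linear[OF x, THEN linear_cmul]
  note bil = bilinear_G[OF x]
  note eqI = nondegenerate_eqI[OF bil nondegenerate_G[OF x]]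
  have lin1: "linear (chris G x u)" for u
  proof (rule linearI)
    show "chris G x u (a + b) = chris G x u a + chris G x u b" for a b
      by (rule eqI) (simp add: bilinear_ladd[OF bil] chris_metric[OF x] lin field_simps)
    show "chris G x u (r *\<^sub>R a) = r *\<^sub>R chris G x u a" for r a
      by (rule eqI) (simp add: bilinear_lmul[OF bil] chris_metric[OF x] lin field_simps)
  qed
  have "linear (\<lambda>u. chris G x u v)" for v using lin1[of v] by (simp add: chris_sym[OF x, of _ v])
  with lin1 show ?thesis by (simp add: bilinear_def)
qed

lemma chris_unique:
  assumes x: "x \<in> S" and \<Gamma>: "\<And>u v. \<Gamma> u v = \<Gamma> v u"
    "\<And>u v w. fd (\<lambda>y. G y v w) x u = G x (\<Gamma> u v) w + G x v (\<Gamma> u w)"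
  shows "chris G x u v = \<Gamma> u v"
proof (rule nondegenerate_eqI[OF bilinear_G nondegenerate_G])
  show "G x (chris G x u v) w = G x (\<Gamma> u v) w" for w
    unfolding chris_metric[OF x] \<Gamma>(2)
    using \<Gamma>(1)[of u v] \<Gamma>(1)[of u w] \<Gamma>(1)[of v w] G_sym[OF x] by simp
qed (use x in auto)

text \<open>The Christoffel symbols solve a linear system whose coefficients vary with the point, so
  their differentiability rests on that of \<open>riesz\<close>.\<close>

lemma chris_differentiable:
  assumes x: "x \<in> S"
  shows "(\<lambda>x. chris G x u v) differentiable at x"
proof -
  have "(\<lambda>x. koszul x u v) differentiable at x"
    unfolding koszul_def divide_inverse
    by (intro differentiable_sum finite_Basis ballI differentiable_scaleR_const
        differentiable_mult differentiable_add differentiable_diff dG_differentiable x differentiable_const)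
  then have "(\<lambda>x. riesz (G x) (koszul x u v)) differentiable at x"
    by (intro riesz_differentiable_compose[where x = "\<lambda>s. s", OF open_S])
       (use x in \<open>auto simp: bilinear_G nondegenerate_G G_differentiable\<close>)
  moreover have "riesz (G y) (koszul y u v) = chris G y u v" if "y \<in> S" for y
    using that by (simp add: chris_eq_riesz_koszul)
  ultimately show ?thesis
    unfolding differentiable_def by (metis (no_types, lifting) has_derivative_transform_within_open open_S x)
qed

text \<open>Here \<open>u'\<close> and \<open>v'\<close> are covariant derivatives: an ordinary
  derivative is written throughout as the covariant one minus its Christoffel term, which turns
  compatibility into a plain product rule.\<close>

lemma metric_has_vector_derivative:
  fixes p :: "'p::real_normed_vector"
  assumes x: "x ` N \<subseteq> S" "t \<in> N" "(x has_vector_derivative x') (at t within N)"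
    and u: "(u has_vector_derivative u' - chris G (x t) x' (u t)) (at t within N)"
    and v: "(v has_vector_derivative v' - chris G (x t) x' (v t)) (at t within N)"
  shows "((\<lambda>s. G (x s) (u s) (v s)) has_vector_derivative (G (x t) u' (v t) + G (x t) (u t) v')) (at t within N)"
proof -
  have xt: "x t \<in> S" using x by auto
  have "((\<lambda>s. G (x s) (u s) (v s)) has_vector_derivative (fd (\<lambda>y. G y (u t) (v t)) (x t) x'
        + G (x t) (u' - chris G (x t) x' (u t)) (v t) + G (x t) (u t) (v' - chris G (x t) x' (v t)))) (at t within N)"
    by (rule has_vector_derivative_family_apply2[OF open_S]) (use x u v xt in \<open>auto simp: bilinear_G G_differentiable\<close>)
  then show ?thesis
    by (simp add: chris_compat[OF xt] bilinear_lsub[OF bilinear_G[OF xt]] bilinear_rsub[OF bilinear_G[OF xt]] algebra_simps)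
qed

lemma chris_has_vector_derivative:
  assumes x: "x ` N \<subseteq> S" "t \<in> N" "(x has_vector_derivative x') (at t within N)"
    and u: "(u has_vector_derivative u') (at t within N)"
    and v: "(v has_vector_derivative v') (at t within N)"
  shows "((\<lambda>s. chris G (x s) (u s) (v s)) has_vector_derivative
    (fd (\<lambda>y. chris G y (u t) (v t)) (x t) x' + chris G (x t) u' (v t) + chris G (x t) (u t) v')) (at t within N)"
  by (rule has_vector_derivative_family_apply2[OF open_S])
     (use x u v in \<open>auto simp: bilinear_chris chris_differentiable\<close>)

text \<open>Second derivatives of \<open>G y w z\<close> commute. Each of them is expanded twice by
  compatibility with the metric, and the products of two first-order terms cancel.\<close>

lemma curv_skew:
  assumes x: "x \<in> S"
  shows "G x (curv (chris G) x u v w) z + G x w (curv (chris G) x u v z) = 0"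
proof -
  let ?\<Gamma> = "chris G x" and ?d = "\<lambda>u v w. fd (\<lambda>y. chris G y v w) x u"
  note bil = bilinear_G[OF x]
  have *: "fd (\<lambda>y. fd (\<lambda>y. G y w z) y v) x u =
      G x (?\<Gamma> u (?\<Gamma> v w)) z + G x (?\<Gamma> v w) (?\<Gamma> u z) + G x (?d u v w) z
    + G x (?\<Gamma> u w) (?\<Gamma> v z) + G x w (?\<Gamma> u (?\<Gamma> v z)) + G x w (?d u v z)" for u v
  proof -
    have c: "((\<lambda>y. chris G y v w) has_derivative (\<lambda>h. ?d h v w)) (at x within S)" for w
      using chris_differentiable[OF x, of v w] unfolding at_within_open[OF x open_S] frechet_derivative_works .
    have 1: "((\<lambda>y. G y (chris G y v w) z) has_derivative
       (\<lambda>h. fd (\<lambda>y. G y (?\<Gamma> v w) z) x h + G x (?d h v w) z + G x (?\<Gamma> v w) 0)) (at x within S)"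
      by (rule has_derivative_family_apply2[where x = "\<lambda>s. s" and x' = "\<lambda>h. h" and v' = "\<lambda>h. 0", OF open_S])
         (use x c in \<open>auto simp: bilinear_G G_differentiable\<close>)
    have 2: "((\<lambda>y. G y w (chris G y v z)) has_derivative
       (\<lambda>h. fd (\<lambda>y. G y w (?\<Gamma> v z)) x h + G x 0 (?\<Gamma> v z) + G x w (?d h v z))) (at x within S)"
      by (rule has_derivative_family_apply2[where x = "\<lambda>s. s" and x' = "\<lambda>h. h" and u' = "\<lambda>h. 0", OF open_S])
         (use x c in \<open>auto simp: bilinear_G G_differentiable\<close>)
    have "((\<lambda>y. fd (\<lambda>y. G y w z) y v) has_derivative
       (\<lambda>h. (fd (\<lambda>y. G y (?\<Gamma> v w) z) x h + G x (?d h v w) z + G x (?\<Gamma> v w) 0)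
          + (fd (\<lambda>y. G y w (?\<Gamma> v z)) x h + G x 0 (?\<Gamma> v z) + G x w (?d h v z)))) (at x within S)"
      by (rule has_derivative_transform[OF x _ has_derivative_add[OF 1 2]]) (simp add: chris_compat)
    from frechet_derivative_eq[OF this[unfolded at_within_open[OF x open_S]]]
    show ?thesis by (simp add: chris_compat[OF x] bilinear_lzero[OF bil] bilinear_rzero[OF bil])
  qed
  have "fd (\<lambda>y. fd (\<lambda>y. G y w z) y v) x u = fd (\<lambda>y. fd (\<lambda>y. G y w z) y u) x v"
    by (rule symmetric_second_derivative[OF open_S x diff_on_G])
  then show ?thesis
    unfolding * curv_def
    by (simp add: bilinear_lsub[OF bil] bilinear_rsub[OF bil] bilinear_ladd[OF bil] bilinear_radd[OF bil])
qed

end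

section \<open>Change of coordinates\<close>

locale metric_coord_change = S: metric_coords S G + T: metric_coords T H
  for S T :: "'e::euclidean_space set" and G H +
  fixes \<phi> :: "'e \<Rightarrow> 'e"
  assumes \<phi>_image: "\<phi> ` S \<subseteq> T"
    and diff_on_\<phi>: "diff_on 4 S \<phi>"
    and inj_\<phi>: "\<And>x. x \<in> S \<Longrightarrow> inj (fd \<phi> x)"
    and isometry: "\<And>x u v. x \<in> S \<Longrightarrow> G x u v = H (\<phi> x) (fd \<phi> x u) (fd \<phi> x v)"
begin

lemma \<phi>_differentiable: "x \<in> S \<Longrightarrow> \<phi> differentiable at x" "x \<in> S \<Longrightarrow> (\<lambda>y. fd \<phi> y v) differentiable at x"
  using diff_on_\<phi> by (auto simp: eval_nat_numeral)

text \<open>The connection pulled back along \<open>\<phi>\<close> is symmetric and compatible with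
  \<open>G\<close>, hence is the one of \<open>G\<close> by uniqueness. Symmetry of the second
  derivative of \<open>\<phi>\<close> enters for the first property.\<close>

lemma chris_transform:
  assumes x: "x \<in> S"
  shows "fd \<phi> x (chris G x u v) = chris H (\<phi> x) (fd \<phi> x u) (fd \<phi> x v) + fd (\<lambda>y. fd \<phi> y v) x u"
proof -
  have lin: "linear (fd \<phi> x)" using \<phi>_differentiable x by (auto intro: linear_frechet_derivative)
  then have surj: "surj (fd \<phi> x)" using inj_\<phi>[OF x] linear_injective_imp_surjective by blast
  have \<phi>x: "\<phi> x \<in> T" using \<phi>_image x by auto
  note bil = T.bilinear_G[OF \<phi>x]
  define \<psi> where "\<psi> = inv (fd \<phi> x)"
  have \<psi>: "fd \<phi> x (\<psi> u) = u" for u by (simp add: \<psi>_def surj surj_f_inv_f)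
  \<comment> \<open>The transformation law solved for its left-hand side.\<close>
  define \<Gamma> where "\<Gamma> u v = \<psi> (chris H (\<phi> x) (fd \<phi> x u) (fd \<phi> x v) + fd (\<lambda>y. fd \<phi> y v) x u)" for u v
  have "chris G x u v = \<Gamma> u v"
  proof (rule S.chris_unique[OF x])
    fix u v w
    have d3: "diff_on 3 S \<phi>" using diff_on_\<phi> by (rule diff_on_le) simp
    show "\<Gamma> u v = \<Gamma> v u"
      unfolding \<Gamma>_def T.chris_sym[OF \<phi>x, of "fd \<phi> x u"]
      by (simp add: symmetric_second_derivative[OF S.open_S x d3, of u v])
    have c: "((\<lambda>y. fd \<phi> y v) has_derivative (\<lambda>h. fd (\<lambda>y. fd \<phi> y v) x h)) (at x within S)" for v
      using \<phi>_differentiable(2)[OF x] unfolding at_within_open[OF x S.open_S] frechet_derivative_works .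
    have d\<phi>: "(\<phi> has_derivative fd \<phi> x) (at x within S)"
      using \<phi>_differentiable(1)[OF x] unfolding at_within_open[OF x S.open_S] frechet_derivative_works .
    have "((\<lambda>y. H (\<phi> y) (fd \<phi> y v) (fd \<phi> y w)) has_derivative
       (\<lambda>h. fd (\<lambda>y. H y (fd \<phi> x v) (fd \<phi> x w)) (\<phi> x) (fd \<phi> x h)
          + H (\<phi> x) (fd (\<lambda>y. fd \<phi> y v) x h) (fd \<phi> x w) + H (\<phi> x) (fd \<phi> x v) (fd (\<lambda>y. fd \<phi> y w) x h))) (at x within S)"
      by (rule has_derivative_family_apply2[OF T.open_S])
         (use x \<phi>x c d\<phi> \<phi>_image in \<open>auto simp: T.bilinear_G T.G_differentiable\<close>)
    then have "((\<lambda>y. G y v w) has_derivative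
       (\<lambda>h. fd (\<lambda>y. H y (fd \<phi> x v) (fd \<phi> x w)) (\<phi> x) (fd \<phi> x h)
          + H (\<phi> x) (fd (\<lambda>y. fd \<phi> y v) x h) (fd \<phi> x w) + H (\<phi> x) (fd \<phi> x v) (fd (\<lambda>y. fd \<phi> y w) x h))) (at x within S)"
      by (rule has_derivative_transform[OF x, rotated]) (simp add: isometry)
    from frechet_derivative_eq[OF this[unfolded at_within_open[OF x S.open_S]]]
    show "fd (\<lambda>y. G y v w) x u = G x (\<Gamma> u v) w + G x v (\<Gamma> u w)"
      by (simp add: isometry[OF x] \<Gamma>_def \<psi> T.chris_compat[OF \<phi>x] bilinear_ladd[OF bil] bilinear_radd[OF bil])
  qed
  then show ?thesis by (simp add: \<Gamma>_def \<psi>)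
qed

lemma pushforward_has_vector_derivative:
  assumes x: "x ` N \<subseteq> S" "t \<in> N" "(x has_vector_derivative x') (at t within N)"
    and X: "(X has_vector_derivative X') (at t within N)"
  shows "((\<lambda>s. fd \<phi> (x s) (X s)) has_vector_derivative fd (\<lambda>y. fd \<phi> y (X t)) (x t) x' + fd \<phi> (x t) X') (at t within N)"
  by (rule has_vector_derivative_family_apply[OF S.open_S])
     (use x X in \<open>auto intro!: linear_frechet_derivative \<phi>_differentiable\<close>)

text \<open>The second derivative of \<open>\<phi>\<close> from the product rule is the
  inhomogeneous term of the Christoffel symbols; this is why covariant derivatives along curves do
  not depend on the chart.\<close>

lemma covariant_derivative_transform:
  assumes "x \<in> S"
  shows "fd \<phi> x (X' + chris G x x' X)
    = (fd (\<lambda>y. fd \<phi> y X) x x' + fd \<phi> x X') + chris H (\<phi> x) (fd \<phi> x x') (fd \<phi> x X)"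
  using chris_transform[OF assms, of x' X] \<phi>_differentiable(1)[OF assms]
  by (simp add: linear_frechet_derivative linear_add)

end

section \<open>Jacobi fields in coordinates\<close>

lemma diff_on_apply2:
  fixes B :: "'e::euclidean_space \<Rightarrow> 'f::euclidean_space \<Rightarrow> 'h::euclidean_space \<Rightarrow> 'g::real_normed_vector"
  assumes "open S" "\<And>x. x \<in> S \<Longrightarrow> bilinear (B x)" "\<And>a b. diff_on k S (\<lambda>x. B x a b)"
    and "diff_on k S u" "diff_on k S v"
  shows "diff_on k S (\<lambda>x. B x (u x) (v x))"
proof (rule diff_on_apply[OF assms(1) _ _ assms(5)])
  show "diff_on k S (\<lambda>x. B x (u x) b)" for b
    by (rule diff_on_apply[OF assms(1), where L = "\<lambda>x a. B x a b"]) (use assms in \<open>auto intro: bilinear_linear1\<close>)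
qed (use assms in \<open>auto intro!: bilinear_linear2\<close>)

lemma vector_derivative_unique:
  assumes "(f has_vector_derivative a) (at t within N)" "(f has_vector_derivative b) (at t within N)"
    "at t within N \<noteq> bot"
  shows "a = b"
  using assms vector_derivative_unique_within by blast

text \<open>The Jacobi equation in coordinates; \<open>P\<close> and \<open>Q\<close> are the first and second covariant
  derivatives of \<open>J\<close>.\<close>

definition cjac :: "('e::euclidean_space \<Rightarrow> 'e \<Rightarrow> 'e \<Rightarrow> real) \<Rightarrow> real set \<Rightarrow> (real \<Rightarrow> 'e) \<Rightarrow> (real \<Rightarrow> 'e) \<Rightarrow>
    (real \<Rightarrow> 'e) \<Rightarrow> bool" where
  "cjac G N x x' J \<longleftrightarrow> (\<exists>P Q. \<forall>t\<in>N.
     (J has_vector_derivative P t - chris G (x t) (x' t) (J t)) (at t within N) \<and>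
     (P has_vector_derivative Q t - chris G (x t) (x' t) (P t)) (at t within N) \<and>
     Q t + curv (chris G) (x t) (J t) (x' t) (x' t) = 0)"

text \<open>Skew-symmetry gives g(R(J, x') x', x') = 0, so the Jacobi equation leaves g(J'', x') = 0
  along a geodesic. The function \<open>q\<close> is g(J', x').\<close>

lemma (in metric_coords) cjac_velocity_component:
  assumes J: "cjac G N x x' J" and xN: "x ` N \<subseteq> S"
    and x: "\<And>t. t \<in> N \<Longrightarrow> (x has_vector_derivative x' t) (at t within N)"
    and x': "\<And>t. t \<in> N \<Longrightarrow> (x' has_vector_derivative - chris G (x t) (x' t) (x' t)) (at t within N)"
  obtains q where "\<And>t. t \<in> N \<Longrightarrow> ((\<lambda>t. G (x t) (J t) (x' t)) has_vector_derivative q t) (at t within N)"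
    "\<And>t. t \<in> N \<Longrightarrow> (q has_vector_derivative 0) (at t within N)"
proof -
  obtain P Q where PQ: "\<And>t. t \<in> N \<Longrightarrow> (J has_vector_derivative P t - chris G (x t) (x' t) (J t)) (at t within N)"
    "\<And>t. t \<in> N \<Longrightarrow> (P has_vector_derivative Q t - chris G (x t) (x' t) (P t)) (at t within N)"
    "\<And>t. t \<in> N \<Longrightarrow> Q t + curv (chris G) (x t) (J t) (x' t) (x' t) = 0"
    using J unfolding cjac_def by blast
  have x'0: "(x' has_vector_derivative 0 - chris G (x t) (x' t) (x' t)) (at t within N)" if "t \<in> N" for t
    using x'[OF that] by simp
  show thesis
  proof (rule that)
    fix t assume t: "t \<in> N"
    then have xt: "x t \<in> S" using xN by auto
    note bil = bilinear_G[OF xt]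
    show "((\<lambda>t. G (x t) (J t) (x' t)) has_vector_derivative G (x t) (P t) (x' t)) (at t within N)"
      using metric_has_vector_derivative[OF xN t x[OF t] PQ(1)[OF t] x'0[OF t]]
      by (simp add: bilinear_rzero[OF bil])
    have "G (x t) (curv (chris G) (x t) (J t) (x' t) (x' t)) (x' t) = 0"
      using curv_skew[OF xt, of "J t" "x' t" "x' t" "x' t"] G_sym[OF xt, of "x' t"] by simp
    moreover have "Q t = - curv (chris G) (x t) (J t) (x' t) (x' t)"
      using PQ(3)[OF t] by (simp add: eq_neg_iff_add_eq_0)
    ultimately have "G (x t) (Q t) (x' t) = 0" by (simp add: bilinear_lneg[OF bil])
    then show "((\<lambda>t. G (x t) (P t) (x' t)) has_vector_derivative 0) (at t within N)"
      using metric_has_vector_derivative[OF xN t x[OF t] PQ(2)[OF t] x'0[OF t]]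
      by (simp add: bilinear_rzero[OF bil])
  qed
qed

text \<open>\<open>F\<close> is a parametrized submanifold and \<open>\<xi>\<close> a vector field on the parameter domain; \<open>K y\<close> is the
  operator \<open>v \<mapsto> \<nabla>\<^sub>v \<xi>\<close>.\<close>

locale flow_coords = metric_coords S G for S :: "'e::euclidean_space set" and G +
  fixes \<Omega> :: "'f::euclidean_space set" and F :: "'f \<Rightarrow> 'e" and \<xi> :: "'f \<Rightarrow> 'f"
  assumes open_\<Omega>: "open \<Omega>" and F_image: "F ` \<Omega> \<subseteq> S"
    and diff_on_F: "diff_on 4 \<Omega> F" and diff_on_\<xi>: "diff_on 3 \<Omega> \<xi>"
begin

definition X :: "'f \<Rightarrow> 'e" where "X y = fd F y (\<xi> y)"

definition K :: "'f \<Rightarrow> 'f \<Rightarrow> 'e" where "K y v = fd X y v + chris G (F y) (fd F y v) (X y)"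

lemma F_in: "y \<in> \<Omega> \<Longrightarrow> F y \<in> S" using F_image by auto

lemma diff_on_dF: "diff_on 3 \<Omega> (\<lambda>y. fd F y v)"
  using diff_on_F by (simp add: eval_nat_numeral)

lemma F_differentiable: "y \<in> \<Omega> \<Longrightarrow> F differentiable at y"
  and dF_differentiable: "y \<in> \<Omega> \<Longrightarrow> (\<lambda>y. fd F y v) differentiable at y"
  and \<xi>_differentiable: "y \<in> \<Omega> \<Longrightarrow> \<xi> differentiable at y"
  using diff_on_F diff_on_\<xi> by (simp_all add: eval_nat_numeral)

lemma linear_dF: "y \<in> \<Omega> \<Longrightarrow> linear (fd F y)"
  by (intro linear_frechet_derivative F_differentiable)

lemma linear_d\<xi>: "y \<in> \<Omega> \<Longrightarrow> linear (fd \<xi> y)"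
  by (intro linear_frechet_derivative \<xi>_differentiable)

lemma ddF_sym:
  assumes "y \<in> \<Omega>"
  shows "fd (\<lambda>z. fd F z u) y v = fd (\<lambda>z. fd F z v) y u"
  by (rule symmetric_second_derivative[OF open_\<Omega> assms diff_on_le[OF diff_on_F]]) simp

lemma diff_on_X: "diff_on 3 \<Omega> X"
  unfolding X_def[abs_def] using diff_on_apply[OF open_\<Omega> linear_dF diff_on_dF diff_on_\<xi>] .

lemma X_differentiable: "y \<in> \<Omega> \<Longrightarrow> X differentiable at y"
  and dX_differentiable: "y \<in> \<Omega> \<Longrightarrow> (\<lambda>y. fd X y v) differentiable at y"
  using diff_on_X by (simp_all add: eval_nat_numeral)

lemma linear_dX: "y \<in> \<Omega> \<Longrightarrow> linear (fd X y)"
  by (intro linear_frechet_derivative X_differentiable)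

lemma linear_K: "y \<in> \<Omega> \<Longrightarrow> linear (K y)"
  unfolding K_def[abs_def]
  using linear_compose[OF linear_dF bilinear_linear1[OF bilinear_chris[OF F_in]]]
  by (intro linear_compose_add linear_dX) (auto simp: o_def)

lemma has_derivative_within_\<Omega>:
  "f differentiable at y \<Longrightarrow> y \<in> \<Omega> \<Longrightarrow> (f has_derivative fd f y) (at y within \<Omega>)"
  using at_within_open[OF _ open_\<Omega>, of y] by (simp add: frechet_derivative_works)

lemma dX_eq:
  assumes y: "y \<in> \<Omega>"
  shows "fd X y v = fd (\<lambda>z. fd F z (\<xi> y)) y v + fd F y (fd \<xi> y v)"
proof -
  have "((\<lambda>z. fd F z (\<xi> z)) has_derivative (\<lambda>h. fd (\<lambda>z. fd F z (\<xi> y)) y h + fd F y (fd \<xi> y h))) (at y within \<Omega>)"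
    by (rule has_derivative_family_apply[where x = "\<lambda>z. z" and x' = "\<lambda>h. h", OF open_\<Omega>])
       (use y in \<open>auto intro!: linear_dF dF_differentiable has_derivative_within_\<Omega> \<xi>_differentiable\<close>)
  from frechet_derivative_eq[OF this[unfolded at_within_open[OF y open_\<Omega>]]]
  show ?thesis by (simp add: X_def[abs_def])
qed

lemma metric_has_derivative:
  assumes y: "y \<in> \<Omega>" and u: "(u has_derivative u') (at y within \<Omega>)" and v: "(v has_derivative v') (at y within \<Omega>)"
  shows "((\<lambda>z. G (F z) (u z) (v z)) has_derivative
     (\<lambda>h. G (F y) (u' h + chris G (F y) (fd F y h) (u y)) (v y) + G (F y) (u y) (v' h + chris G (F y) (fd F y h) (v y))))
     (at y within \<Omega>)"
proof -
  note bil = bilinear_G[OF F_in[OF y]]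
  have "((\<lambda>z. G (F z) (u z) (v z)) has_derivative (\<lambda>h. fd (\<lambda>p. G p (u y) (v y)) (F y) (fd F y h)
      + G (F y) (u' h) (v y) + G (F y) (u y) (v' h))) (at y within \<Omega>)"
    by (rule has_derivative_family_apply2[OF open_S])
       (use y u v F_in in \<open>auto intro!: bilinear_G G_differentiable has_derivative_within_\<Omega> F_differentiable\<close>)
  then show ?thesis
    by (simp add: chris_compat[OF F_in[OF y]] bilinear_ladd[OF bil] bilinear_radd[OF bil] algebra_simps)
qed

text \<open>As the connection has no torsion, the exterior derivative of \<open>\<beta>\<close> at
  (u, v) is g(K u, v) - g(K v, u). It is applied with \<beta> = 0 for the ambient metric and \<beta>
  = \<omega> for the rigged one.\<close>

lemma K_self_adjoint:
  assumes y: "y \<in> \<Omega>"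
    and \<beta>: "\<And>z v. z \<in> \<Omega> \<Longrightarrow> G (F z) (X z) (fd F z v) = \<beta> z v"
    and closed: "\<And>u v. fd (\<lambda>z. \<beta> z v) y u = fd (\<lambda>z. \<beta> z u) y v"
  shows "G (F y) (K y u) (fd F y v) = G (F y) (fd F y u) (K y v)"
proof -
  note bil = bilinear_G[OF F_in[OF y]]
  have *: "fd (\<lambda>z. \<beta> z v) y u = G (F y) (K y u) (fd F y v)
      + G (F y) (X y) (fd (\<lambda>z. fd F z v) y u + chris G (F y) (fd F y u) (fd F y v))" for u v
  proof -
    have "((\<lambda>z. G (F z) (X z) (fd F z v)) has_derivative
     (\<lambda>h. G (F y) (fd X y h + chris G (F y) (fd F y h) (X y)) (fd F y v)
        + G (F y) (X y) (fd (\<lambda>z. fd F z v) y h + chris G (F y) (fd F y h) (fd F y v)))) (at y within \<Omega>)"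
      by (intro metric_has_derivative y has_derivative_within_\<Omega> X_differentiable dF_differentiable)
    then have "((\<lambda>z. \<beta> z v) has_derivative
     (\<lambda>h. G (F y) (fd X y h + chris G (F y) (fd F y h) (X y)) (fd F y v)
        + G (F y) (X y) (fd (\<lambda>z. fd F z v) y h + chris G (F y) (fd F y h) (fd F y v)))) (at y within \<Omega>)"
      by (rule has_derivative_transform[OF y, rotated]) (simp add: \<beta>)
    from frechet_derivative_eq[OF this[unfolded at_within_open[OF y open_\<Omega>]]] show ?thesis
      by (simp add: K_def)
  qed
  have "G (F y) (K y u) (fd F y v) = G (F y) (K y v) (fd F y u)"
    using *[of v u] *[of u v] closed[of u v] ddF_sym[OF y, of u v] chris_sym[OF F_in[OF y], of "fd F y u" "fd F y v"] by simp
  then show ?thesis using G_sym[OF F_in[OF y]] by simp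
qed

text \<open>The derivative of the constant g(X, X) in the direction \<open>v\<close> is 2 g(K v,
  X).\<close>

lemma K_orthogonal:
  assumes y: "y \<in> \<Omega>" and c: "\<And>z. z \<in> \<Omega> \<Longrightarrow> G (F z) (X z) (X z) = c"
  shows "G (F y) (K y v) (X y) = 0"
proof -
  have "((\<lambda>z. G (F z) (X z) (X z)) has_derivative
     (\<lambda>h. G (F y) (fd X y h + chris G (F y) (fd F y h) (X y)) (X y)
        + G (F y) (X y) (fd X y h + chris G (F y) (fd F y h) (X y)))) (at y within \<Omega>)"
    by (intro metric_has_derivative y has_derivative_within_\<Omega> X_differentiable)
  then have "((\<lambda>z. c) has_derivative
     (\<lambda>h. G (F y) (fd X y h + chris G (F y) (fd F y h) (X y)) (X y)
        + G (F y) (X y) (fd X y h + chris G (F y) (fd F y h) (X y)))) (at y within \<Omega>)"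
    by (rule has_derivative_transform[OF y, rotated]) (simp add: c)
  from frechet_derivative_eq[OF this[unfolded at_within_open[OF y open_\<Omega>]]]
  have "G (F y) (K y v) (X y) + G (F y) (X y) (K y v) = 0"
    by (simp add: K_def fun_eq_iff)
  then show ?thesis using G_sym[OF F_in[OF y], of "X y"] by simp
qed

end

text \<open>The curve is observed only at the times in \<open>N\<close>, with one-sided derivatives
  at the ends. As \<open>N\<close> has no isolated points, derivatives within it are unique, which
  allows comparing two formulas for one derivative.\<close>

locale flow_curve_coords = flow_coords S G \<Omega> F \<xi> for S :: "'e::euclidean_space set" and G
    and \<Omega> :: "'f::euclidean_space set" and F \<xi> +
  fixes N :: "real set" and y :: "real \<Rightarrow> 'f"
  assumes y_image: "y ` N \<subseteq> \<Omega>"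
    and y_deriv: "\<And>t. t \<in> N \<Longrightarrow> (y has_vector_derivative \<xi> (y t)) (at t within N)"
    and N_perfect: "\<And>t. t \<in> N \<Longrightarrow> at t within N \<noteq> bot"
begin

lemma y_in: "t \<in> N \<Longrightarrow> y t \<in> \<Omega>" using y_image by auto

lemma Fy_image: "(\<lambda>s. F (y s)) ` N \<subseteq> S" using y_in F_in by auto

lemma Fy_deriv:
  assumes "t \<in> N"
  shows "((\<lambda>s. F (y s)) has_vector_derivative X (y t)) (at t within N)"
  unfolding X_def
  by (rule has_vector_derivative_compose_at[OF _ y_deriv[OF assms]])
     (use F_differentiable[OF y_in[OF assms]] in \<open>simp add: frechet_derivative_works\<close>)

lemma Xy_deriv:
  assumes "t \<in> N"
  shows "((\<lambda>s. X (y s)) has_vector_derivative fd X (y t) (\<xi> (y t))) (at t within N)"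
  by (rule has_vector_derivative_compose_at[OF _ y_deriv[OF assms]])
     (use X_differentiable[OF y_in[OF assms]] in \<open>simp add: frechet_derivative_works\<close>)

lemma \<xi>y_deriv:
  assumes "t \<in> N"
  shows "((\<lambda>s. \<xi> (y s)) has_vector_derivative fd \<xi> (y t) (\<xi> (y t))) (at t within N)"
  by (rule has_vector_derivative_compose_at[OF _ y_deriv[OF assms]])
     (use \<xi>_differentiable[OF y_in[OF assms]] in \<open>simp add: frechet_derivative_works\<close>)

lemma dF_deriv:
  assumes t: "t \<in> N" and V: "(V has_vector_derivative V') (at t within N)"
  shows "((\<lambda>s. fd F (y s) (V s)) has_vector_derivative
     (fd (\<lambda>z. fd F z (V t)) (y t) (\<xi> (y t)) + fd F (y t) V')) (at t within N)"
  by (rule has_vector_derivative_family_apply[OF open_\<Omega>])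
     (use t V y_image in \<open>auto intro!: linear_dF dF_differentiable y_in y_deriv\<close>)

text \<open>\<open>V' - d\<xi>(V)\<close> is the Lie derivative of \<open>V\<close> along the flow of \<open>\<xi>\<close>.\<close>

lemma covariant_derivative_eq_Lie:
  assumes t: "t \<in> N" and V: "(V has_vector_derivative V') (at t within N)"
  shows "((\<lambda>s. fd F (y s) (V s)) has_vector_derivative
     (fd F (y t) (V' - fd \<xi> (y t) (V t)) + K (y t) (V t) - chris G (F (y t)) (X (y t)) (fd F (y t) (V t)))) (at t within N)"
proof -
  note yt = y_in[OF t]
  have "fd (\<lambda>z. fd F z (V t)) (y t) (\<xi> (y t)) + fd F (y t) V'
    = fd F (y t) (V' - fd \<xi> (y t) (V t)) + K (y t) (V t) - chris G (F (y t)) (X (y t)) (fd F (y t) (V t))"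
    by (simp add: linear_diff[OF linear_dF[OF yt]] K_def dX_eq[OF yt] ddF_sym[OF yt, of "V t"]
        chris_sym[OF F_in[OF yt], of "X (y t)"])
  with dF_deriv[OF assms] show ?thesis by simp
qed

text \<open>For h the pulled back metric and E = \<nabla>_\<xi> W + \<nabla>_W \<xi>, this is the
  identity L_\<xi> (h(W, \<cdot>)) = h(E, \<cdot>) evaluated at a constant \<open>u\<close>, whose
  Lie derivative is -d\<xi>(u). Self-adjointness moves \<open>K\<close> from \<open>u\<close> to
  \<open>W\<close>, where it cancels.\<close>

lemma metric_pairing:
  assumes t: "t \<in> N"
    and W: "((\<lambda>s. fd F (y s) (W s)) has_vector_derivative
       (E - chris G (F (y t)) (X (y t)) (fd F (y t) (W t)) - K (y t) (W t))) (at t within N)"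
    and K: "\<And>u v. G (F (y t)) (K (y t) u) (fd F (y t) v) = G (F (y t)) (fd F (y t) u) (K (y t) v)"
  shows "((\<lambda>s. G (F (y s)) (fd F (y s) (W s)) (fd F (y s) u)) has_vector_derivative
     G (F (y t)) E (fd F (y t) u) - G (F (y t)) (fd F (y t) (W t)) (fd F (y t) (fd \<xi> (y t) u))) (at t within N)"
proof -
  note yt = y_in[OF t]
  note bil = bilinear_G[OF F_in[OF yt]]
  note lin = linear_dF[OF yt]
  have 1: "((\<lambda>s. fd F (y s) (W s)) has_vector_derivative
       ((E - K (y t) (W t)) - chris G (F (y t)) (X (y t)) (fd F (y t) (W t)))) (at t within N)"
    using W by (simp add: algebra_simps)
  have 2: "((\<lambda>s. fd F (y s) u) has_vector_derivative
       ((fd F (y t) (0 - fd \<xi> (y t) u) + K (y t) u) - chris G (F (y t)) (X (y t)) (fd F (y t) u))) (at t within N)"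
    by (rule covariant_derivative_eq_Lie[OF t, of "\<lambda>s. u" 0]) simp
  show ?thesis
    using metric_has_vector_derivative[OF Fy_image t Fy_deriv[OF t] 1 2]
    by (simp add: bilinear_lsub[OF bil] bilinear_rsub[OF bil] K linear_neg[OF lin])
qed

end

section \<open>Geodesic flows and the first-order form of the Jacobi equation\<close>

locale geodesic_flow_coords = flow_curve_coords S G \<Omega> F \<xi> N y
  for S :: "'e::euclidean_space set" and G and \<Omega> :: "'f::euclidean_space set" and F \<xi> N y +
  assumes geodesic: "\<And>y. y \<in> \<Omega> \<Longrightarrow> fd X y (\<xi> y) + chris G (F y) (X y) (X y) = 0"
begin

lemma K_\<xi>: "p \<in> \<Omega> \<Longrightarrow> K p (\<xi> p) = 0"
  using geodesic by (simp add: K_def X_def)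

lemma geodesic_derivative:
  assumes p: "p \<in> \<Omega>"
  shows "fd (\<lambda>z. fd X z (\<xi> p)) p v + fd X p (fd \<xi> p v)
    + (fd (\<lambda>q. chris G q (X p) (X p)) (F p) (fd F p v) + chris G (F p) (fd X p v) (X p) + chris G (F p) (X p) (fd X p v)) = 0"
proof -
  have 1: "((\<lambda>z. fd X z (\<xi> z)) has_derivative (\<lambda>h. fd (\<lambda>z. fd X z (\<xi> p)) p h + fd X p (fd \<xi> p h))) (at p within \<Omega>)"
    by (rule has_derivative_family_apply[where x = "\<lambda>z. z" and x' = "\<lambda>h. h", OF open_\<Omega>])
       (use p in \<open>auto intro!: linear_dX dX_differentiable has_derivative_within_\<Omega> \<xi>_differentiable\<close>)
  have 2: "((\<lambda>z. chris G (F z) (X z) (X z)) has_derivative (\<lambda>h. fd (\<lambda>q. chris G q (X p) (X p)) (F p) (fd F p h)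
      + chris G (F p) (fd X p h) (X p) + chris G (F p) (X p) (fd X p h))) (at p within \<Omega>)"
    by (rule has_derivative_family_apply2[OF open_S])
       (use p F_in in \<open>auto intro!: bilinear_chris chris_differentiable has_derivative_within_\<Omega> F_differentiable X_differentiable\<close>)
  have "((\<lambda>z. 0) has_derivative (\<lambda>h. fd (\<lambda>z. fd X z (\<xi> p)) p h + fd X p (fd \<xi> p h)
    + (fd (\<lambda>q. chris G q (X p) (X p)) (F p) (fd F p h) + chris G (F p) (fd X p h) (X p) + chris G (F p) (X p) (fd X p h)))) (at p within \<Omega>)"
    by (rule has_derivative_transform[OF p _ has_derivative_add[OF 1 2]]) (simp add: geodesic)
  from frechet_derivative_eq[OF this[unfolded at_within_open[OF p open_\<Omega>]]]
  show ?thesis by (simp add: fun_eq_iff)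
qed

text \<open>The derivative of the geodesic equation in the direction \<open>V\<close> turns the curvature term of the
  Jacobi equation into derivatives of \<open>K\<close>.\<close>

lemma K_deriv:
  assumes t: "t \<in> N" and V: "(V has_vector_derivative V') (at t within N)"
  shows "((\<lambda>s. K (y s) (V s)) has_vector_derivative
     (K (y t) (V' - fd \<xi> (y t) (V t)) - curv (chris G) (F (y t)) (fd F (y t) (V t)) (X (y t)) (X (y t))
      - chris G (F (y t)) (X (y t)) (K (y t) (V t)))) (at t within N)"
proof -
  note yt = y_in[OF t]
  note Fyt = F_in[OF yt]
  let ?v = "V t" and ?\<Gamma> = "chris G (F (y t))" and ?X = "X (y t)" and ?\<xi> = "\<xi> (y t)"
  let ?J = "fd F (y t) ?v"
  note \<Gamma> = bilinear_chris[OF Fyt]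
  note \<Gamma>simps = bilinear_ladd[OF \<Gamma>] bilinear_radd[OF \<Gamma>] bilinear_lsub[OF \<Gamma>] bilinear_rsub[OF \<Gamma>]
  have 1: "((\<lambda>s. fd X (y s) (V s)) has_vector_derivative (fd (\<lambda>z. fd X z ?v) (y t) ?\<xi> + fd X (y t) V')) (at t within N)"
    by (rule has_vector_derivative_family_apply[OF open_\<Omega>])
       (use t V y_image in \<open>auto intro!: linear_dX dX_differentiable y_in y_deriv\<close>)
  have 2: "((\<lambda>s. chris G (F (y s)) (fd F (y s) (V s)) (X (y s))) has_vector_derivative
      (fd (\<lambda>p. chris G p ?J ?X) (F (y t)) ?X + ?\<Gamma> (fd (\<lambda>z. fd F z ?v) (y t) ?\<xi> + fd F (y t) V') ?X
        + ?\<Gamma> ?J (fd X (y t) ?\<xi>))) (at t within N)"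
    by (rule chris_has_vector_derivative[OF Fy_image t Fy_deriv[OF t] dF_deriv[OF t V] Xy_deriv[OF t]])
  \<comment> \<open>Interchanging the two directions produces the second derivative that the
    differentiated geodesic equation determines.\<close>
  have d3: "fd (\<lambda>z. fd X z ?v) (y t) ?\<xi> = fd (\<lambda>z. fd X z ?\<xi>) (y t) ?v"
    by (rule symmetric_second_derivative[OF open_\<Omega> yt diff_on_X])
  have geo: "fd X (y t) ?\<xi> = - ?\<Gamma> ?X ?X"
    using geodesic[OF yt] by (simp add: eq_neg_iff_add_eq_0)
  have s1: "?\<Gamma> u v = ?\<Gamma> v u" for u v by (rule chris_sym[OF Fyt])
  have geo': "fd (\<lambda>z. fd X z ?\<xi>) (y t) ?v = - fd X (y t) (fd \<xi> (y t) ?v)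
     - fd (\<lambda>p. chris G p ?X ?X) (F (y t)) ?J - ?\<Gamma> (fd X (y t) ?v) ?X - ?\<Gamma> (fd X (y t) ?v) ?X"
    using geodesic_derivative[OF yt, of ?v] s1[of ?X "fd X (y t) ?v"] by (simp add: algebra_simps eq_neg_iff_add_eq_0)
  have "(fd (\<lambda>z. fd X z ?v) (y t) ?\<xi> + fd X (y t) V')
     + (fd (\<lambda>p. chris G p ?J ?X) (F (y t)) ?X + ?\<Gamma> (fd (\<lambda>z. fd F z ?v) (y t) ?\<xi> + fd F (y t) V') ?X
        + ?\<Gamma> ?J (fd X (y t) ?\<xi>))
     = K (y t) (V' - fd \<xi> (y t) (V t)) - curv (chris G) (F (y t)) ?J ?X ?X - ?\<Gamma> ?X (K (y t) ?v)"
    unfolding K_def curv_def d3 geo geo' ddF_sym[OF yt, of ?v]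
    by (simp add: s1 \<Gamma>simps linear_diff[OF linear_dX[OF yt]] linear_diff[OF linear_dF[OF yt]] dX_eq[OF yt, of ?v]
        bilinear_rneg[OF \<Gamma>] algebra_simps)
  with has_vector_derivative_add[OF 1 2] show ?thesis by (simp add: K_def[abs_def])
qed

text \<open>The first covariant derivative of the field is forced to be dF W + K V. Subtracting the
  derivative of K V removes the curvature and leaves an equation for dF W alone; its
  differentiability is equivalent to that of the first covariant derivative.\<close>

lemma cjac_iff:
  assumes V: "\<And>t. t \<in> N \<Longrightarrow> (V has_vector_derivative V' t) (at t within N)"
    and W: "\<And>t. t \<in> N \<Longrightarrow> W t = V' t - fd \<xi> (y t) (V t)"
  shows "cjac G N (\<lambda>t. F (y t)) (\<lambda>t. X (y t)) (\<lambda>t. fd F (y t) (V t)) \<longleftrightarrow>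
    (\<forall>t\<in>N. ((\<lambda>s. fd F (y s) (W s)) has_vector_derivative
      (0 - chris G (F (y t)) (X (y t)) (fd F (y t) (W t)) - K (y t) (W t))) (at t within N))"
proof -
  let ?R = "\<lambda>t. curv (chris G) (F (y t)) (fd F (y t) (V t)) (X (y t)) (X (y t))"
  let ?P = "\<lambda>t. fd F (y t) (W t) + K (y t) (V t)"
  have J: "((\<lambda>s. fd F (y s) (V s)) has_vector_derivative
     (?P t - chris G (F (y t)) (X (y t)) (fd F (y t) (V t)))) (at t within N)" if "t \<in> N" for t
    using covariant_derivative_eq_Lie[OF that V[OF that]] by (simp add: W[OF that])
  have K: "((\<lambda>s. K (y s) (V s)) has_vector_derivative
     (K (y t) (W t) - ?R t - chris G (F (y t)) (X (y t)) (K (y t) (V t)))) (at t within N)" if "t \<in> N" for t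
    using K_deriv[OF that V[OF that]] by (simp add: W[OF that])
  have add: "chris G (F (y t)) (X (y t)) (a + b) = chris G (F (y t)) (X (y t)) a + chris G (F (y t)) (X (y t)) b"
    if "t \<in> N" for t a b
    by (rule bilinear_radd[OF bilinear_chris[OF F_in[OF y_in[OF that]]]])
  show ?thesis
  proof (intro iffI ballI)
    fix t assume t: "t \<in> N" and "cjac G N (\<lambda>t. F (y t)) (\<lambda>t. X (y t)) (\<lambda>t. fd F (y t) (V t))"
    then obtain P Q where PQ: "\<And>t. t \<in> N \<Longrightarrow> ((\<lambda>t. fd F (y t) (V t)) has_vector_derivative
         P t - chris G (F (y t)) (X (y t)) (fd F (y t) (V t))) (at t within N)"
       "\<And>t. t \<in> N \<Longrightarrow> (P has_vector_derivative Q t - chris G (F (y t)) (X (y t)) (P t)) (at t within N)"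
       "\<And>t. t \<in> N \<Longrightarrow> Q t + ?R t = 0"
      unfolding cjac_def by blast
    have P: "P s = ?P s" if "s \<in> N" for s
      using vector_derivative_unique[OF PQ(1)[OF that] J[OF that] N_perfect[OF that]] by simp
    have Q: "Q t = - ?R t" using PQ(3)[OF t] by (simp add: eq_neg_iff_add_eq_0)
    have "((\<lambda>s. P s - K (y s) (V s)) has_vector_derivative
       (Q t - chris G (F (y t)) (X (y t)) (P t)) - (K (y t) (W t) - ?R t - chris G (F (y t)) (X (y t)) (K (y t) (V t)))) (at t within N)"
      by (intro has_vector_derivative_diff PQ K t)
    moreover have "(Q t - chris G (F (y t)) (X (y t)) (P t)) - (K (y t) (W t) - ?R t - chris G (F (y t)) (X (y t)) (K (y t) (V t)))
       = 0 - chris G (F (y t)) (X (y t)) (fd F (y t) (W t)) - K (y t) (W t)"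
      by (simp add: P[OF t] Q add[OF t])
    ultimately show "((\<lambda>s. fd F (y s) (W s)) has_vector_derivative
      (0 - chris G (F (y t)) (X (y t)) (fd F (y t) (W t)) - K (y t) (W t))) (at t within N)"
      unfolding has_vector_derivative_def
      by (intro has_derivative_transform[OF t, of "\<lambda>s. fd F (y s) (W s)" "\<lambda>s. P s - K (y s) (V s)"]) (simp_all add: P)
  next
    assume W': "\<forall>t\<in>N. ((\<lambda>s. fd F (y s) (W s)) has_vector_derivative
      (0 - chris G (F (y t)) (X (y t)) (fd F (y t) (W t)) - K (y t) (W t))) (at t within N)"
    show "cjac G N (\<lambda>t. F (y t)) (\<lambda>t. X (y t)) (\<lambda>t. fd F (y t) (V t))"
      unfolding cjac_def
    proof (rule exI[of _ ?P], rule exI[of _ "\<lambda>t. - ?R t"], intro ballI conjI)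
      fix t assume t: "t \<in> N"
      show "((\<lambda>s. fd F (y s) (V s)) has_vector_derivative
        (?P t - chris G (F (y t)) (X (y t)) (fd F (y t) (V t)))) (at t within N)" by (rule J[OF t])
      show "- ?R t + ?R t = 0" by simp
      show "(?P has_vector_derivative - ?R t - chris G (F (y t)) (X (y t)) (?P t)) (at t within N)"
        by (rule has_vector_derivative_eq_rhs[OF has_vector_derivative_add[OF bspec[OF W' t] K[OF t]]])
           (simp add: add[OF t])
    qed
  qed
qed

end

section \<open>The rigged metric in coordinates\<close>

lemma differentiable_eq_on:
  assumes "t \<in> N" "\<And>s. s \<in> N \<Longrightarrow> g s = f s" "f differentiable (at t within N)"
  shows "g differentiable (at t within N)"
  using assms unfolding differentiable_def by (metis has_derivative_transform)

lemma has_vector_derivative_scaleR_real: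
  fixes f :: "real \<Rightarrow> real"
  assumes "(f has_vector_derivative f') (at t within N)" "(g has_vector_derivative g') (at t within N)"
  shows "((\<lambda>s. f s *\<^sub>R g s) has_vector_derivative (f t *\<^sub>R g' + f' *\<^sub>R g t)) (at t within N)"
  using assms by (auto intro!: has_vector_derivative_scaleR simp: has_real_derivative_iff_has_vector_derivative)

text \<open>A null hypersurface with its rigging in a pair of charts: \<open>Z\<close> is the
  rigging in coordinates and \<open>Gt\<close> the rigged metric. That \<open>\<xi>\<close> spans
  the null direction of \<open>null\<close> and satisfies \<omega>(\<xi>) = 1 is derived from
  \<open>rigged\<close>.\<close>

locale rigged_coords = geodesic_flow_coords S G \<Omega> F \<xi> N y
  for S :: "'e::euclidean_space set" and G and \<Omega> :: "'f::euclidean_space set" and F \<xi> N y +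
  fixes Z :: "'e \<Rightarrow> 'e" and \<omega> :: "'f \<Rightarrow> 'f \<Rightarrow> real" and Gt :: "'f \<Rightarrow> 'f \<Rightarrow> 'f \<Rightarrow> real"
  assumes \<omega>_eq: "\<And>p v. p \<in> \<Omega> \<Longrightarrow> \<omega> p v = G (F p) (Z (F p)) (fd F p v)"
    and Gt_eq: "\<And>p u v. p \<in> \<Omega> \<Longrightarrow> Gt p u v = G (F p) (fd F p u) (fd F p v) + \<omega> p u * \<omega> p v"
    and dims: "DIM('e) = DIM('f) + 1"
    and diff_on_Z: "diff_on 3 S Z"
    and inj_dF: "\<And>p. p \<in> \<Omega> \<Longrightarrow> inj (fd F p)"
    and Z_transversal: "\<And>p. p \<in> \<Omega> \<Longrightarrow> Z (F p) \<notin> range (fd F p)"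
    and null: "\<And>p. p \<in> \<Omega> \<Longrightarrow> \<exists>n. n \<noteq> 0 \<and> (\<forall>w. G (F p) (fd F p n) (fd F p w) = 0)"
    and rigged: "\<And>p w. p \<in> \<Omega> \<Longrightarrow> Gt p (\<xi> p) w = \<omega> p w"
    and \<omega>_closed: "\<And>p u v. p \<in> \<Omega> \<Longrightarrow> fd (\<lambda>z. \<omega> z v) p u = fd (\<lambda>z. \<omega> z u) p v"
begin

text \<open>The tangent space has codimension one, so a transversal vector completes it.\<close>

lemma tangent_decomposition:
  assumes p: "p \<in> \<Omega>"
  obtains v s where "e = fd F p v + s *\<^sub>R Z (F p)"
proof -
  let ?T = "range (fd F p)"
  have lin: "linear (fd F p)" by (rule linear_dF[OF p])
  have sub: "subspace ?T" using lin by (simp add: linear_subspace_image)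
  have "dim ?T = DIM('f)"
    using dim_image_eq[OF lin, of UNIV] inj_dF[OF p] by simp
  then have "dim (insert (Z (F p)) ?T) = DIM('e)"
    using Z_transversal[OF p] sub dims by (simp add: dim_insert span_eq_iff[THEN iffD2])
  then have "span (insert (Z (F p)) ?T) = UNIV" by (rule dim_eq_full[THEN iffD1])
  then have "e \<in> span (insert (Z (F p)) ?T)" by simp
  then obtain s where "e - s *\<^sub>R Z (F p) \<in> span ?T" unfolding span_breakdown_eq by blast
  then obtain v where "e - s *\<^sub>R Z (F p) = fd F p v" using sub by (auto simp: span_eq_iff[THEN iffD2])
  then show thesis by (intro that[of v s]) (simp add: algebra_simps)
qed

lemma orthogonal_eq_0:
  assumes p: "p \<in> \<Omega>" and "\<And>v. G (F p) e (fd F p v) = 0" "G (F p) e (Z (F p)) = 0"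
  shows "e = 0"
proof -
  note bil = bilinear_G[OF F_in[OF p]]
  have "G (F p) e w = 0" for w
    by (rule tangent_decomposition[OF p, of w]) (simp add: bilinear_radd[OF bil] bilinear_rmul[OF bil] assms)
  then show ?thesis using nondegenerate_G[OF F_in[OF p]] unfolding nondegenerate_def by blast
qed

lemma linear_\<omega>: "p \<in> \<Omega> \<Longrightarrow> linear (\<omega> p)"
  by (rule linearI)
     (simp_all add: \<omega>_eq linear_add[OF linear_dF] linear_cmul[OF linear_dF]
       bilinear_radd[OF bilinear_G[OF F_in]] bilinear_rmul[OF bilinear_G[OF F_in]])

lemma dF_eq_0: "p \<in> \<Omega> \<Longrightarrow> fd F p u = 0 \<Longrightarrow> u = 0"
  using inj_dF[of p] linear_dF[of p] linear_injective_0 by blast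

text \<open>A null direction \<open>n\<close> has \<omega>(n) \<noteq> 0, as it would otherwise be
  orthogonal to the tangent space and to \<open>Z\<close>, hence 0. The equation defining
  \<open>\<xi>\<close>, paired with \<open>n\<close>, reads \<omega>(\<xi>) \<omega>(n) =
  \<omega>(n).\<close>

lemma \<omega>_\<xi>:
  assumes p: "p \<in> \<Omega>"
  shows "\<omega> p (\<xi> p) = 1"
proof -
  note sym = G_sym[OF F_in[OF p]]
  obtain n where n: "n \<noteq> 0" "\<And>w. G (F p) (fd F p n) (fd F p w) = 0" using null[OF p] by blast
  have "\<omega> p n \<noteq> 0"
    using orthogonal_eq_0[OF p, of "fd F p n"] n dF_eq_0[OF p, of n] sym[of "Z (F p)"] by (auto simp: \<omega>_eq[OF p])
  moreover have "\<omega> p (\<xi> p) * \<omega> p n = \<omega> p n"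
    using rigged[OF p, of n] n(2)[of "\<xi> p"] sym[of "fd F p n"] by (simp add: Gt_eq[OF p])
  ultimately show ?thesis by simp
qed

lemma G_X_tangent: "p \<in> \<Omega> \<Longrightarrow> G (F p) (X p) (fd F p v) = 0"
  using rigged[of p v] \<omega>_\<xi>[of p] by (simp add: Gt_eq X_def)

lemma G_X_Z: "p \<in> \<Omega> \<Longrightarrow> G (F p) (X p) (Z (F p)) = 1"
  using \<omega>_\<xi>[of p] G_sym[OF F_in[of p]] by (simp add: \<omega>_eq X_def)

text \<open>The coefficient of \<open>Z\<close> in the decomposition of \<open>e\<close> is g(e, X),
  because X is orthogonal to tangent vectors and g(X, Z) = 1.\<close>

lemma G_X_eq_0_imp_tangent:
  assumes p: "p \<in> \<Omega>" and "G (F p) e (X p) = 0"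
  shows "e \<in> range (fd F p)"
proof -
  note bil = bilinear_G[OF F_in[OF p]]
  obtain v s where e: "e = fd F p v + s *\<^sub>R Z (F p)" using tangent_decomposition[OF p] .
  have "s = 0" using assms(2) G_X_tangent[OF p] G_X_Z[OF p] G_sym[OF F_in[OF p], of _ "X p"]
    by (simp add: e bilinear_radd[OF bil] bilinear_rmul[OF bil])
  then show ?thesis using e by simp
qed

lemma bilinear_Gt:
  assumes p: "p \<in> \<Omega>"
  shows "bilinear (Gt p)"
  unfolding bilinear_def
  by (auto intro!: linearI simp: Gt_eq[OF p] linear_add[OF linear_\<omega>[OF p]] linear_cmul[OF linear_\<omega>[OF p]]
      linear_add[OF linear_dF[OF p]] linear_cmul[OF linear_dF[OF p]]
      bilinear_ladd[OF bilinear_G[OF F_in[OF p]]] bilinear_radd[OF bilinear_G[OF F_in[OF p]]]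
      bilinear_lmul[OF bilinear_G[OF F_in[OF p]]] bilinear_rmul[OF bilinear_G[OF F_in[OF p]]] algebra_simps)

lemma Gt_sym: "p \<in> \<Omega> \<Longrightarrow> Gt p u v = Gt p v u"
  using G_sym[OF F_in] by (simp add: Gt_eq mult.commute)

text \<open>Pairing a vector \<open>u\<close> of the kernel with \<open>\<xi>\<close> gives
  \<omega>(u) = 0; then \<open>u\<close> is orthogonal for \<open>G\<close> both to the tangent
  space and to \<open>Z\<close>.\<close>

lemma nondegenerate_Gt:
  assumes p: "p \<in> \<Omega>"
  shows "nondegenerate (Gt p)"
  unfolding nondegenerate_def
proof (intro allI impI)
  fix u assume u: "\<forall>v. Gt p u v = 0"
  then have \<omega>: "\<omega> p u = 0" using Gt_sym[OF p, of u "\<xi> p"] rigged[OF p, of u] by simp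
  then have "G (F p) (fd F p u) (fd F p v) = 0" for v using u by (simp add: Gt_eq[OF p])
  moreover have "G (F p) (fd F p u) (Z (F p)) = 0"
    using \<omega> G_sym[OF F_in[OF p]] by (simp add: \<omega>_eq[OF p])
  ultimately show "u = 0" using orthogonal_eq_0[OF p] dF_eq_0[OF p] by blast
qed

lemma diff_on_G_F: "diff_on 3 \<Omega> (\<lambda>p. G (F p) a b)"
  by (rule diff_on_compose[OF open_\<Omega> diff_on_G diff_on_le[OF diff_on_F] F_image]) simp

lemma diff_on_\<omega>: "diff_on 3 \<Omega> (\<lambda>p. \<omega> p v)"
proof -
  have "diff_on 3 \<Omega> (\<lambda>p. G (F p) (Z (F p)) (fd F p v))"
    by (rule diff_on_apply2[OF open_\<Omega> bilinear_G[OF F_in] diff_on_G_F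
          diff_on_compose[OF open_\<Omega> diff_on_Z diff_on_le[OF diff_on_F] F_image] diff_on_dF]) simp_all
  then show ?thesis by (subst diff_on_cong[OF open_\<Omega> \<omega>_eq])
qed

lemma diff_on_Gt: "diff_on 3 \<Omega> (\<lambda>p. Gt p u v)"
proof -
  have "diff_on 3 \<Omega> (\<lambda>p. G (F p) (fd F p u) (fd F p v) + \<omega> p u *\<^sub>R \<omega> p v)"
    by (rule diff_on_add[OF open_\<Omega> diff_on_apply2[OF open_\<Omega> bilinear_G[OF F_in] diff_on_G_F diff_on_dF diff_on_dF]
         diff_on_scaleR[OF open_\<Omega> diff_on_\<omega> diff_on_\<omega>]])
  then show ?thesis by (subst diff_on_cong[OF open_\<Omega> Gt_eq]) simp_all
qed

text \<open>The hypersurface with its rigged metric is treated as a submanifold of itself,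
  parametrized by the identity, so that the general results on \<open>K\<close> apply to both
  metrics.\<close>

sublocale B: flow_coords \<Omega> Gt \<Omega> "\<lambda>x. x" \<xi>
  by unfold_locales
     (auto intro: open_\<Omega> bilinear_Gt Gt_sym nondegenerate_Gt diff_on_Gt diff_on_\<xi> diff_on_linear simp: linear_ident)

lemma BX [simp]: "B.X = \<xi>" by (simp add: fun_eq_iff B.X_def)

lemma BK_self_adjoint: "p \<in> \<Omega> \<Longrightarrow> Gt p (B.K p u) v = Gt p u (B.K p v)"
  using B.K_self_adjoint[of p \<omega> u v] \<omega>_closed rigged by simp

lemma \<omega>_BK: "p \<in> \<Omega> \<Longrightarrow> \<omega> p (B.K p v) = 0"
  using B.K_orthogonal[of p 1 v] \<omega>_\<xi> rigged Gt_sym[of p "\<xi> p"] by simp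

text \<open>A unit field whose dual form is closed is geodesic: moving the operator to the other
  side by self-adjointness leaves \<omega>(B.K v), which is 0.\<close>

lemma BK_\<xi>:
  assumes p: "p \<in> \<Omega>"
  shows "B.K p (\<xi> p) = 0"
proof (rule nondegenerate_eqI[OF bilinear_Gt[OF p] nondegenerate_Gt[OF p]])
  show "Gt p (B.K p (\<xi> p)) v = Gt p 0 v" for v
    by (simp add: BK_self_adjoint[OF p] rigged[OF p] \<omega>_BK[OF p] bilinear_lzero[OF bilinear_Gt[OF p]])
qed

sublocale B: geodesic_flow_coords \<Omega> Gt \<Omega> "\<lambda>x. x" \<xi> N y
  by unfold_locales (use BK_\<xi> in \<open>auto simp: y_in y_deriv N_perfect B.K_def\<close>)

lemma B_cjac_iff:
  assumes "\<And>t. t \<in> N \<Longrightarrow> (V has_vector_derivative V' t) (at t within N)"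
    and "\<And>t. t \<in> N \<Longrightarrow> W t = V' t - fd \<xi> (y t) (V t)"
  shows "cjac Gt N y (\<lambda>t. \<xi> (y t)) V \<longleftrightarrow>
    (\<forall>t\<in>N. (W has_vector_derivative (0 - chris Gt (y t) (\<xi> (y t)) (W t) - B.K (y t) (W t))) (at t within N))"
  using B.cjac_iff[OF assms] by simp

lemma K_self_adjoint_tangent: "p \<in> \<Omega> \<Longrightarrow> G (F p) (K p u) (fd F p v) = G (F p) (fd F p u) (K p v)"
  using K_self_adjoint[of p "\<lambda>_ _. 0" u v] G_X_tangent by simp

lemma \<omega>_differentiable: "p \<in> \<Omega> \<Longrightarrow> (\<lambda>z. \<omega> z v) differentiable at p"
  using diff_on_\<omega>[of v] by (simp add: eval_nat_numeral)

text \<open>Cartan's formula: L_\<xi> \<omega> = 0, because \<omega>(\<xi>) is constant and \<omega>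
  is closed.\<close>

lemma d\<omega>_\<xi>:
  assumes p: "p \<in> \<Omega>"
  shows "fd (\<lambda>z. \<omega> z v) p (\<xi> p) + \<omega> p (fd \<xi> p v) = 0"
proof -
  have "((\<lambda>z. \<omega> z (\<xi> z)) has_derivative (\<lambda>h. fd (\<lambda>z. \<omega> z (\<xi> p)) p h + \<omega> p (fd \<xi> p h))) (at p within \<Omega>)"
    by (rule has_derivative_family_apply[where x = "\<lambda>z. z" and x' = "\<lambda>h. h", OF open_\<Omega>])
       (use p in \<open>auto intro!: linear_\<omega> \<omega>_differentiable has_derivative_within_\<Omega> \<xi>_differentiable\<close>)
  then have "((\<lambda>z. 1) has_derivative (\<lambda>h. fd (\<lambda>z. \<omega> z (\<xi> p)) p h + \<omega> p (fd \<xi> p h))) (at p within \<Omega>)"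
    by (rule has_derivative_transform[OF p, rotated]) (simp add: \<omega>_\<xi>)
  from frechet_derivative_eq[OF this[unfolded at_within_open[OF p open_\<Omega>]]]
  have "fd (\<lambda>z. \<omega> z (\<xi> p)) p v + \<omega> p (fd \<xi> p v) = 0" by (simp add: fun_eq_iff)
  then show ?thesis unfolding \<omega>_closed[OF p, of "\<xi> p" v] .
qed

text \<open>The flow of \<open>\<xi>\<close> preserves \<open>\<omega>\<close>, so differentiating
  \<open>\<omega>(V)\<close> replaces \<open>V\<close> by its Lie derivative.\<close>

lemma \<omega>_deriv:
  assumes t: "t \<in> N" and V: "(V has_vector_derivative V') (at t within N)"
  shows "((\<lambda>s. \<omega> (y s) (V s)) has_vector_derivative \<omega> (y t) (V' - fd \<xi> (y t) (V t))) (at t within N)"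
proof -
  have "((\<lambda>s. \<omega> (y s) (V s)) has_vector_derivative
      (fd (\<lambda>z. \<omega> z (V t)) (y t) (\<xi> (y t)) + \<omega> (y t) V')) (at t within N)"
    by (rule has_vector_derivative_family_apply[OF open_\<Omega>])
       (use t V y_image in \<open>auto intro!: linear_\<omega> \<omega>_differentiable y_in y_deriv\<close>)
  moreover have "fd (\<lambda>z. \<omega> z (V t)) (y t) (\<xi> (y t)) + \<omega> (y t) V' = \<omega> (y t) (V' - fd \<xi> (y t) (V t))"
    using d\<omega>_\<xi>[OF y_in[OF t], of "V t"] by (simp add: linear_diff[OF linear_\<omega>[OF y_in[OF t]]])
  ultimately show ?thesis by simp
qed

text \<open>The components of \<open>V\<close> lowered by \<open>Gt\<close> can be computed from its
  image dF V alone; raising them again with \<open>riesz\<close> recovers \<open>V\<close>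
  differentiably.\<close>

lemma tangent_field_differentiable:
  assumes t: "t \<in> N" and J: "(\<lambda>s. fd F (y s) (V s)) differentiable (at t within N)"
  shows "V differentiable (at t within N)"
proof -
  obtain J' where J': "((\<lambda>s. fd F (y s) (V s)) has_vector_derivative J') (at t within N)"
    using J vector_derivative_works by blast
  have ZF: "((\<lambda>s. Z (F (y s))) has_vector_derivative fd Z (F (y t)) (X (y t))) (at t within N)"
    by (rule has_vector_derivative_compose_at[OF diff_onD[OF diff_on_Z] Fy_deriv[OF t]])
       (use F_in y_in t in auto)
  have dFb: "((\<lambda>s. fd F (y s) b) has_vector_derivative fd (\<lambda>z. fd F z b) (y t) (\<xi> (y t)) + fd F (y t) 0) (at t within N)" for b
    by (rule dF_deriv[OF t]) simp
  have G: "(\<lambda>s. G (F (y s)) (u s) (v s)) differentiable (at t within N)"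
    if "(u has_vector_derivative u') (at t within N)" "(v has_vector_derivative v') (at t within N)" for u u' v v'
    by (rule differentiableI_vector[OF has_vector_derivative_family_apply2[where B = G and x = "\<lambda>s. F (y s)"
          and u = u and v = v and N = N, OF open_S bilinear_G G_differentiable[OF F_in[OF y_in[OF t]]]
          Fy_image t Fy_deriv[OF t] that]])
  have "(\<lambda>s. Gt (y s) (V s) b) differentiable (at t within N)" for b
  proof -
    have 1: "(\<lambda>s. G (F (y s)) (fd F (y s) (V s)) (fd F (y s) b)) differentiable (at t within N)"
      and 2: "(\<lambda>s. G (F (y s)) (Z (F (y s))) (fd F (y s) (V s))) differentiable (at t within N)"
      and 3: "(\<lambda>s. G (F (y s)) (Z (F (y s))) (fd F (y s) b)) differentiable (at t within N)"
      by (rule G[OF J' dFb], rule G[OF ZF J'], rule G[OF ZF dFb])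
    have "(\<lambda>s. G (F (y s)) (fd F (y s) (V s)) (fd F (y s) b)
         + G (F (y s)) (Z (F (y s))) (fd F (y s) (V s)) * G (F (y s)) (Z (F (y s))) (fd F (y s) b)) differentiable (at t within N)"
      by (rule differentiable_add[OF 1 differentiable_mult[OF 2 3]])
    then show ?thesis by (rule differentiable_eq_on[OF t, rotated]) (simp add: Gt_eq \<omega>_eq y_in)
  qed
  then have "(\<lambda>s. lower (Gt (y s)) (V s)) differentiable (at t within N)"
    unfolding lower_def by (intro differentiable_sum finite_Basis ballI differentiable_scaleR_const)
  then have "(\<lambda>s. riesz (Gt (y s)) (lower (Gt (y s)) (V s))) differentiable (at t within N)"
    by (intro riesz_differentiable_compose[where x = y, OF open_\<Omega>])
       (use y_in t y_deriv[OF t] differentiableI_vector in \<open>auto intro: bilinear_Gt nondegenerate_Gt B.G_differentiable\<close>)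
  then show ?thesis
    by (rule differentiable_eq_on[OF t, rotated]) (simp add: lower_riesz bilinear_Gt nondegenerate_Gt y_in)
qed

text \<open>A bootstrap: differentiability of dF V yields that of \<open>V\<close>, which makes the
  Lie derivative available; the Jacobi equation then provides the derivative of its image, and the
  same argument applies once more.\<close>

lemma cjac_tangent_differentiable:
  assumes "cjac G N (\<lambda>t. F (y t)) (\<lambda>t. X (y t)) (\<lambda>t. fd F (y t) (V t))"
  obtains V' W' where "\<And>t. t \<in> N \<Longrightarrow> (V has_vector_derivative V' t) (at t within N)"
    "\<And>t. t \<in> N \<Longrightarrow> ((\<lambda>t. V' t - fd \<xi> (y t) (V t)) has_vector_derivative W' t) (at t within N)"
    "\<And>t. t \<in> N \<Longrightarrow> ((\<lambda>s. fd F (y s) (V' s - fd \<xi> (y s) (V s))) has_vector_derivative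
      (0 - chris G (F (y t)) (X (y t)) (fd F (y t) (V' t - fd \<xi> (y t) (V t))) - K (y t) (V' t - fd \<xi> (y t) (V t)))) (at t within N)"
proof -
  have "V differentiable (at t within N)" if "t \<in> N" for t
    using assms that unfolding cjac_def
    by (intro tangent_field_differentiable[OF that]) (blast intro: differentiableI_vector)
  then have V: "\<And>t. t \<in> N \<Longrightarrow> (V has_vector_derivative vector_derivative V (at t within N)) (at t within N)"
    using vector_derivative_works by blast
  let ?W = "\<lambda>t. vector_derivative V (at t within N) - fd \<xi> (y t) (V t)"
  have W: "\<And>t. t \<in> N \<Longrightarrow> ((\<lambda>s. fd F (y s) (?W s)) has_vector_derivative
      (0 - chris G (F (y t)) (X (y t)) (fd F (y t) (?W t)) - K (y t) (?W t))) (at t within N)"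
    using iffD1[OF cjac_iff[of V "\<lambda>t. vector_derivative V (at t within N)" ?W, OF V refl] assms] by blast
  then have "?W differentiable (at t within N)" if "t \<in> N" for t
    by (intro tangent_field_differentiable[OF that] differentiableI_vector) (use that in auto)
  then have W': "\<And>t. t \<in> N \<Longrightarrow> (?W has_vector_derivative vector_derivative ?W (at t within N)) (at t within N)"
    using vector_derivative_works by blast
  show thesis by (rule that[OF V W' W])
qed

text \<open>Both metrics lead to the same equation for \<open>h(W, \<cdot>)\<close>, where \<open>W\<close> is the Lie derivative of the
  field and \<open>h\<close> the degenerate induced metric; they differ only in the equation for \<open>\<omega>(W)\<close>.\<close>

lemma screen_projection_cjac:
  assumes "cjac G N (\<lambda>t. F (y t)) (\<lambda>t. X (y t)) (\<lambda>t. fd F (y t) (V t))"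
  shows "cjac Gt N y (\<lambda>t. \<xi> (y t)) (\<lambda>t. V t - \<omega> (y t) (V t) *\<^sub>R \<xi> (y t))"
proof -
  obtain V' W' where V: "\<And>t. t \<in> N \<Longrightarrow> (V has_vector_derivative V' t) (at t within N)"
    and W: "\<And>t. t \<in> N \<Longrightarrow> ((\<lambda>t. V' t - fd \<xi> (y t) (V t)) has_vector_derivative W' t) (at t within N)"
    and E: "\<And>t. t \<in> N \<Longrightarrow> ((\<lambda>s. fd F (y s) (V' s - fd \<xi> (y s) (V s))) has_vector_derivative
      (0 - chris G (F (y t)) (X (y t)) (fd F (y t) (V' t - fd \<xi> (y t) (V t))) - K (y t) (V' t - fd \<xi> (y t) (V t)))) (at t within N)"
    using cjac_tangent_differentiable[OF assms] by blast
  define W0 where "W0 = (\<lambda>t. V' t - fd \<xi> (y t) (V t))"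
  define U where "U = (\<lambda>t. V t - \<omega> (y t) (V t) *\<^sub>R \<xi> (y t))"
  define W1 where "W1 = (\<lambda>t. W0 t - \<omega> (y t) (W0 t) *\<^sub>R \<xi> (y t))"
  have W: "(W0 has_vector_derivative W' t) (at t within N)" if "t \<in> N" for t
    using W[OF that] by (simp add: W0_def)
  have E: "((\<lambda>s. fd F (y s) (W0 s)) has_vector_derivative
      (0 - chris G (F (y t)) (X (y t)) (fd F (y t) (W0 t)) - K (y t) (W0 t))) (at t within N)" if "t \<in> N" for t
    using E[OF that] by (simp add: W0_def)
  have \<omega>V: "((\<lambda>s. \<omega> (y s) (V s)) has_vector_derivative \<omega> (y t) (W0 t)) (at t within N)" if "t \<in> N" for t
    using \<omega>_deriv[OF that V[OF that]] by (simp add: W0_def)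
  define U' where "U' t = V' t - (\<omega> (y t) (V t) *\<^sub>R fd \<xi> (y t) (\<xi> (y t)) + \<omega> (y t) (W0 t) *\<^sub>R \<xi> (y t))" for t
  have U: "(U has_vector_derivative U' t) (at t within N)" if "t \<in> N" for t
    unfolding U_def U'_def
    by (intro has_vector_derivative_diff has_vector_derivative_scaleR_real \<omega>V[OF that] \<xi>y_deriv[OF that] V[OF that])
  \<comment> \<open>\<open>W1\<close> is the Lie derivative of \<open>U\<close>: the factor
    \<omega>(V) has derivative \<omega>(W0), and the Lie derivative of \<xi> along its own flow
    vanishes.\<close>
  have W1: "W1 t = U' t - fd \<xi> (y t) (U t)" if "t \<in> N" for t
    by (simp add: W1_def U'_def U_def W0_def linear_diff[OF linear_d\<xi>[OF y_in[OF that]]] linear_cmul[OF linear_d\<xi>[OF y_in[OF that]]])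
  have "W1 differentiable (at t within N)" if "t \<in> N" for t
    unfolding W1_def
    by (rule differentiableI_vector has_vector_derivative_diff has_vector_derivative_scaleR_real \<omega>_deriv[OF that W[OF that]] \<xi>y_deriv[OF that] W[OF that])+
  then have D: "(W1 has_vector_derivative vector_derivative W1 (at t within N)) (at t within N)" (is "(_ has_vector_derivative ?D t) _")
    if "t \<in> N" for t using that vector_derivative_works by blast
  have "?D t = 0 - chris Gt (y t) (\<xi> (y t)) (W1 t) - B.K (y t) (W1 t)" if t: "t \<in> N" for t
  proof -
    note yt = y_in[OF t]
    \<comment> \<open>The defect of the rigged Jacobi equation, which is to vanish.\<close>
    define E' where "E' = ?D t + chris Gt (y t) (\<xi> (y t)) (W1 t) + B.K (y t) (W1 t)"
    \<comment> \<open>As \<omega>(W1) = 0, the rigged metric sees only the degenerate form on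
      \<open>W1\<close>, and that form ignores the multiple of \<open>\<xi>\<close> by which
      \<open>W1\<close> and \<open>W0\<close> differ.\<close>
    have h: "Gt (y s) (W1 s) u = G (F (y s)) (fd F (y s) (W0 s)) (fd F (y s) u)" if "s \<in> N" for s u
      using y_in[OF that] G_X_tangent[OF y_in[OF that], of u]
      by (simp add: W1_def Gt_eq linear_diff linear_cmul linear_dF linear_\<omega> \<omega>_\<xi> X_def
          bilinear_lsub[OF bilinear_G[OF F_in]] bilinear_lmul[OF bilinear_G[OF F_in]])
    have "Gt (y t) E' u = Gt (y t) 0 u" for u
    proof -
      have 1: "((\<lambda>s. Gt (y s) (W1 s) u) has_vector_derivative
         Gt (y t) E' u - Gt (y t) (W1 t) (fd \<xi> (y t) u)) (at t within N)"
        using B.metric_pairing[OF t, of W1 E' u] D[OF t] BK_self_adjoint[OF yt] by (simp add: E'_def)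
      have "((\<lambda>s. G (F (y s)) (fd F (y s) (W0 s)) (fd F (y s) u)) has_vector_derivative
          G (F (y t)) 0 (fd F (y t) u) - G (F (y t)) (fd F (y t) (W0 t)) (fd F (y t) (fd \<xi> (y t) u))) (at t within N)"
        by (rule metric_pairing[OF t E[OF t] K_self_adjoint_tangent[OF yt]])
      then have "((\<lambda>s. Gt (y s) (W1 s) u) has_vector_derivative
         0 - Gt (y t) (W1 t) (fd \<xi> (y t) u)) (at t within N)"
        by (intro has_vector_derivative_transform[OF t, of "\<lambda>s. Gt (y s) (W1 s) u" "\<lambda>s. G (F (y s)) (fd F (y s) (W0 s)) (fd F (y s) u)"])
           (simp_all add: h t bilinear_lzero[OF bilinear_G[OF F_in[OF yt]]])
      from vector_derivative_unique[OF 1 this N_perfect[OF t]] show ?thesis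
        by (simp add: bilinear_lzero[OF bilinear_Gt[OF yt]])
    qed
    from nondegenerate_eqI[OF bilinear_Gt[OF yt] nondegenerate_Gt[OF yt] this]
    show ?thesis unfolding E'_def by (simp add: algebra_simps eq_neg_iff_add_eq_0)
  qed
  then have "cjac Gt N y (\<lambda>t. \<xi> (y t)) U"
    using D by (subst B_cjac_iff[of U U' W1, OF U W1]) auto
  then show ?thesis by (simp add: U_def)
qed

text \<open>The derivative of \<open>W\<close> is known from the Jacobi equation and from
  torsion-freeness. Comparing the two gives L_\<xi> W = -2 B.K W, on which \<open>\<omega>\<close>
  vanishes because \<open>\<xi>\<close> has constant length.\<close>

lemma rigged_cjac_Lie:
  assumes J: "cjac Gt N y (\<lambda>t. \<xi> (y t)) V"
    and V: "\<And>t. t \<in> N \<Longrightarrow> (V has_vector_derivative V' t) (at t within N)"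
    and W_eq: "\<And>t. t \<in> N \<Longrightarrow> W t = V' t - fd \<xi> (y t) (V t)"
    and t: "t \<in> N"
  defines "W' \<equiv> 0 - chris Gt (y t) (\<xi> (y t)) (W t) - B.K (y t) (W t)"
  shows "(W has_vector_derivative W') (at t within N)" "\<omega> (y t) (W' - fd \<xi> (y t) (W t)) = 0"
proof -
  have "cjac Gt N y (\<lambda>t. \<xi> (y t)) V \<longleftrightarrow>
    (\<forall>t\<in>N. (W has_vector_derivative (0 - chris Gt (y t) (\<xi> (y t)) (W t) - B.K (y t) (W t))) (at t within N))"
    by (rule B_cjac_iff[where V' = V']) (use V W_eq in auto)
  then show W: "(W has_vector_derivative W') (at t within N)"
    using J t by (simp add: W'_def)
  have "(W has_vector_derivative
      W' - fd \<xi> (y t) (W t) + B.K (y t) (W t) - chris Gt (y t) (\<xi> (y t)) (W t)) (at t within N)"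
    using B.covariant_derivative_eq_Lie[OF t W] by simp
  note vector_derivative_unique[OF W this N_perfect[OF t]]
  then have "W' - fd \<xi> (y t) (W t) = - 2 *\<^sub>R B.K (y t) (W t)"
    unfolding W'_def by (simp add: algebra_simps scaleR_2)
  then show "\<omega> (y t) (W' - fd \<xi> (y t) (W t)) = 0"
    using \<omega>_BK[OF y_in[OF t], of "W t"] by (simp only: linear_cmul[OF linear_\<omega>[OF y_in[OF t]]]) simp
qed

text \<open>Two uses of \<open>\<omega>_deriv\<close>, with \<open>q\<close> the function
  \<omega>(W). Thus \<omega>(V) is affine along the curve, and it is 0 if \<open>V\<close> vanishes
  at two times.\<close>

lemma rigged_cjac_\<omega>:
  assumes J: "cjac Gt N y (\<lambda>t. \<xi> (y t)) V"
  obtains q where "\<And>t. t \<in> N \<Longrightarrow> ((\<lambda>s. \<omega> (y s) (V s)) has_vector_derivative q t) (at t within N)"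
    "\<And>t. t \<in> N \<Longrightarrow> (q has_vector_derivative 0) (at t within N)"
proof -
  obtain P where P: "\<And>t. t \<in> N \<Longrightarrow> (V has_vector_derivative P t - chris Gt (y t) (\<xi> (y t)) (V t)) (at t within N)"
    using J unfolding cjac_def by blast
  define V' where "V' = (\<lambda>t. P t - chris Gt (y t) (\<xi> (y t)) (V t))"
  have V: "(V has_vector_derivative V' t) (at t within N)" if "t \<in> N" for t
    using P[OF that] by (simp add: V'_def)
  define W where "W = (\<lambda>t. V' t - fd \<xi> (y t) (V t))"
  have W: "W t = V' t - fd \<xi> (y t) (V t)" for t by (simp add: W_def)
  have Lie: "(W has_vector_derivative 0 - chris Gt (y t) (\<xi> (y t)) (W t) - B.K (y t) (W t)) (at t within N)"
    "\<omega> (y t) (0 - chris Gt (y t) (\<xi> (y t)) (W t) - B.K (y t) (W t) - fd \<xi> (y t) (W t)) = 0" if "t \<in> N" for t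
    by (rule rigged_cjac_Lie[where V' = V', OF J]; use V W that in auto)+
  show thesis
  proof (rule that)
    fix t assume t: "t \<in> N"
    show "((\<lambda>s. \<omega> (y s) (V s)) has_vector_derivative \<omega> (y t) (W t)) (at t within N)"
      using \<omega>_deriv[OF t V[OF t]] by (simp add: W_def)
    show "((\<lambda>t. \<omega> (y t) (W t)) has_vector_derivative 0) (at t within N)"
      using \<omega>_deriv[OF t Lie(1)[OF t]] Lie(2)[OF t] by simp
  qed
qed

text \<open>The ambient covariant derivative \<open>D\<close> of \<open>W\<close> is dF (L_\<xi> W)
  + K W, and \<omega>(L_\<xi> W) = 0. Replacing \<open>D\<close> by K W also shows that the
  right-hand side of the equation for the correction f is differentiable, since K W contains no
  derivative of \<open>W\<close>.\<close>

lemma rigged_cjac_source: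
  assumes J: "cjac Gt N y (\<lambda>t. \<xi> (y t)) V"
    and V: "\<And>t. t \<in> N \<Longrightarrow> (V has_vector_derivative V' t) (at t within N)"
    and W_eq: "\<And>t. t \<in> N \<Longrightarrow> W t = V' t - fd \<xi> (y t) (V t)"
    and D: "\<And>t. t \<in> N \<Longrightarrow> ((\<lambda>s. fd F (y s) (W s)) has_vector_derivative
        D t - chris G (F (y t)) (X (y t)) (fd F (y t) (W t))) (at t within N)"
    and t: "t \<in> N"
  shows "G (F (y t)) (Z (F (y t))) (D t) = G (F (y t)) (Z (F (y t))) (K (y t) (W t))"
    and "(\<lambda>t. G (F (y t)) (Z (F (y t))) (D t)) differentiable (at t within N)"
proof -
  have W: "(W has_vector_derivative 0 - chris Gt (y t) (\<xi> (y t)) (W t) - B.K (y t) (W t)) (at t within N)"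
    and \<omega>W': "\<omega> (y t) (0 - chris Gt (y t) (\<xi> (y t)) (W t) - B.K (y t) (W t) - fd \<xi> (y t) (W t)) = 0" if "t \<in> N" for t
    by (rule rigged_cjac_Lie[where V' = V', OF J]; use V W_eq that in auto)+
  have *: "G (F (y t)) (Z (F (y t))) (D t) = G (F (y t)) (Z (F (y t))) (K (y t) (W t))" if t: "t \<in> N" for t
  proof -
    have "D t = fd F (y t) ((0 - chris Gt (y t) (\<xi> (y t)) (W t) - B.K (y t) (W t)) - fd \<xi> (y t) (W t)) + K (y t) (W t)"
      using vector_derivative_unique[OF D[OF t] covariant_derivative_eq_Lie[OF t W[OF t]] N_perfect[OF t]] by simp
    then show ?thesis
      using \<omega>W'[OF t]
      by (simp add: bilinear_radd[OF bilinear_G[OF F_in[OF y_in[OF t]]]] \<omega>_eq[OF y_in[OF t]])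
  qed
  show "G (F (y t)) (Z (F (y t))) (D t) = G (F (y t)) (Z (F (y t))) (K (y t) (W t))" by (rule *[OF t])
  have ZF: "((\<lambda>s. Z (F (y s))) has_vector_derivative fd Z (F (y t)) (X (y t))) (at t within N)"
    by (rule has_vector_derivative_compose_at[OF diff_onD[OF diff_on_Z] Fy_deriv[OF t]])
       (use F_in y_in t in auto)
  have "(\<lambda>s. G (F (y s)) (Z (F (y s))) (K (y s) (W s))) differentiable (at t within N)"
    by (rule differentiableI_vector[OF has_vector_derivative_family_apply2[where B = G and x = "\<lambda>s. F (y s)"
          and u = "\<lambda>s. Z (F (y s))" and v = "\<lambda>s. K (y s) (W s)" and N = N,
          OF open_S bilinear_G G_differentiable[OF F_in[OF y_in[OF t]]] Fy_image t Fy_deriv[OF t] ZF K_deriv[OF t W[OF t]]]])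
  then show "(\<lambda>t. G (F (y t)) (Z (F (y t))) (D t)) differentiable (at t within N)"
    by (rule differentiable_eq_on[OF t, rotated]) (simp add: *)
qed

text \<open>Adding \<open>f \<xi>\<close> to a Jacobi field of the rigged metric only changes the component of the ambient
  Jacobi equation along \<open>Z\<close>, by \<open>f''\<close>.\<close>

lemma rigged_cjac_lift:
  assumes V: "\<And>t. t \<in> N \<Longrightarrow> (V has_vector_derivative V' t) (at t within N)"
    and W_eq: "\<And>t. t \<in> N \<Longrightarrow> W t = V' t - fd \<xi> (y t) (V t)"
    and J: "cjac Gt N y (\<lambda>t. \<xi> (y t)) V"
    and \<omega>V: "\<And>t. t \<in> N \<Longrightarrow> \<omega> (y t) (V t) = 0"
    and D: "\<And>t. t \<in> N \<Longrightarrow> ((\<lambda>s. fd F (y s) (W s)) has_vector_derivative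
        D t - chris G (F (y t)) (X (y t)) (fd F (y t) (W t))) (at t within N)"
    and f: "\<And>t. t \<in> N \<Longrightarrow> (f has_vector_derivative f1 t) (at t within N)"
    and f1: "\<And>t. t \<in> N \<Longrightarrow> (f1 has_vector_derivative (- 2 * G (F (y t)) (Z (F (y t))) (D t))) (at t within N)"
  shows "cjac G N (\<lambda>t. F (y t)) (\<lambda>t. X (y t)) (\<lambda>t. fd F (y t) (V t + f t *\<^sub>R \<xi> (y t)))"
proof -
  define W' where "W' t = 0 - chris Gt (y t) (\<xi> (y t)) (W t) - B.K (y t) (W t)" for t
  have W: "(W has_vector_derivative W' t) (at t within N)" if "t \<in> N" for t
    unfolding W'_def by (rule rigged_cjac_Lie(1)[where V' = V', OF J]) (use V W_eq that in auto)
  \<comment> \<open>\<omega>(W) is the derivative of \<omega>(V), which is identically 0.\<close>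
  have \<omega>W: "\<omega> (y t) (W t) = 0" if "t \<in> N" for t
  proof -
    have "((\<lambda>s. 0::real) has_vector_derivative \<omega> (y t) (W t)) (at t within N)"
      using \<omega>_deriv[OF that V[OF that]] unfolding W_eq[OF that]
      by (rule has_vector_derivative_transform[OF that, rotated]) (simp add: \<omega>V)
    from vector_derivative_unique[OF this has_vector_derivative_const N_perfect[OF that]] show ?thesis .
  qed
  define V1 where "V1 = (\<lambda>t. V t + f t *\<^sub>R \<xi> (y t))"
  define V1' where "V1' t = V' t + (f t *\<^sub>R fd \<xi> (y t) (\<xi> (y t)) + f1 t *\<^sub>R \<xi> (y t))" for t
  define W1 where "W1 = (\<lambda>t. W t + f1 t *\<^sub>R \<xi> (y t))"
  have V1: "(V1 has_vector_derivative V1' t) (at t within N)" if "t \<in> N" for t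
    unfolding V1_def V1'_def
    by (intro has_vector_derivative_add has_vector_derivative_scaleR_real f[OF that] \<xi>y_deriv[OF that] V[OF that])
  have W1: "W1 t = V1' t - fd \<xi> (y t) (V1 t)" if "t \<in> N" for t
    by (simp add: W1_def V1_def V1'_def W_eq that linear_add[OF linear_d\<xi>[OF y_in[OF that]]] linear_cmul[OF linear_d\<xi>[OF y_in[OF that]]])
  have "((\<lambda>s. fd F (y s) (W1 s)) has_vector_derivative
      (0 - chris G (F (y t)) (X (y t)) (fd F (y t) (W1 t)) - K (y t) (W1 t))) (at t within N)" if t: "t \<in> N" for t
  proof -
    note yt = y_in[OF t]
    note Fyt = F_in[OF yt]
    note bil = bilinear_G[OF Fyt]
    note \<Gamma> = bilinear_chris[OF Fyt]
    \<comment> \<open>The left-hand side of the ambient equation for \<open>W\<close> before the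
      correction by \<open>f\<close>.\<close>
    define E where "E = D t + K (y t) (W t)"
    have DW: "((\<lambda>s. fd F (y s) (W s)) has_vector_derivative
        E - chris G (F (y t)) (X (y t)) (fd F (y t) (W t)) - K (y t) (W t)) (at t within N)"
      using D[OF t] by (simp add: E_def algebra_simps)
    have "G (F (y t)) E (fd F (y t) u) = 0" for u
    proof -
      have 1: "((\<lambda>s. G (F (y s)) (fd F (y s) (W s)) (fd F (y s) u)) has_vector_derivative
        G (F (y t)) E (fd F (y t) u) - G (F (y t)) (fd F (y t) (W t)) (fd F (y t) (fd \<xi> (y t) u))) (at t within N)"
        by (rule metric_pairing[OF t DW K_self_adjoint_tangent[OF yt]])
      have h: "Gt (y s) (W s) u = G (F (y s)) (fd F (y s) (W s)) (fd F (y s) u)" if "s \<in> N" for s u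
        using y_in[OF that] \<omega>W[OF that] by (simp add: Gt_eq)
      have "((\<lambda>s. Gt (y s) (W s) u) has_vector_derivative
         Gt (y t) 0 u - Gt (y t) (W t) (fd \<xi> (y t) u)) (at t within N)"
        using B.metric_pairing[OF t, of W 0 u] W[OF t] BK_self_adjoint[OF yt] by (simp add: W'_def)
      then have "((\<lambda>s. G (F (y s)) (fd F (y s) (W s)) (fd F (y s) u)) has_vector_derivative
        0 - G (F (y t)) (fd F (y t) (W t)) (fd F (y t) (fd \<xi> (y t) u))) (at t within N)"
        unfolding h[OF t, symmetric]
        by (intro has_vector_derivative_transform[OF t, of "\<lambda>s. G (F (y s)) (fd F (y s) (W s)) (fd F (y s) u)" "\<lambda>s. Gt (y s) (W s) u"])
           (simp_all add: h bilinear_lzero[OF bilinear_Gt[OF yt]])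
      from vector_derivative_unique[OF 1 this N_perfect[OF t]] show ?thesis by simp
    qed
    moreover have source: "G (F (y t)) (Z (F (y t))) (D t) = G (F (y t)) (Z (F (y t))) (K (y t) (W t))"
      by (rule rigged_cjac_source(1)[where V' = V', OF J]) (use V W_eq D t in auto)
    \<comment> \<open>The factor 2: both summands of \<open>E\<close> have the same pairing with
      \<open>Z\<close>.\<close>
    then have GE: "G (F (y t)) (Z (F (y t))) E = 2 * G (F (y t)) (Z (F (y t))) (D t)"
      using source by (simp add: E_def bilinear_radd[OF bil])
    \<comment> \<open>\<open>E\<close> is orthogonal to the tangent space, hence a multiple of
      \<open>X\<close>, with coefficient g(E, Z). The second derivative of \<open>f\<close> is
      chosen to cancel exactly this multiple.\<close>
    ultimately have "E - (2 * G (F (y t)) (Z (F (y t))) (D t)) *\<^sub>R X (y t) = 0"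
      by (intro orthogonal_eq_0[OF yt])
         (simp_all add: bilinear_lsub[OF bil] bilinear_lmul[OF bil] G_X_tangent[OF yt] G_X_Z[OF yt] G_sym[OF Fyt, of E "Z _"])
    then have E: "E = (2 * G (F (y t)) (Z (F (y t))) (D t)) *\<^sub>R X (y t)" by simp
    have geo: "fd X (y t) (\<xi> (y t)) = - chris G (F (y t)) (X (y t)) (X (y t))"
      using geodesic[OF yt] by (simp add: eq_neg_iff_add_eq_0)
    have "((\<lambda>s. fd F (y s) (W s) + f1 s *\<^sub>R X (y s)) has_vector_derivative
       (E - chris G (F (y t)) (X (y t)) (fd F (y t) (W t)) - K (y t) (W t))
       + (f1 t *\<^sub>R fd X (y t) (\<xi> (y t)) + (- 2 * G (F (y t)) (Z (F (y t))) (D t)) *\<^sub>R X (y t))) (at t within N)"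
      by (intro has_vector_derivative_add has_vector_derivative_scaleR_real DW Xy_deriv[OF t] f1[OF t])
    then have "((\<lambda>s. fd F (y s) (W1 s)) has_vector_derivative
       (E - chris G (F (y t)) (X (y t)) (fd F (y t) (W t)) - K (y t) (W t))
       + (f1 t *\<^sub>R fd X (y t) (\<xi> (y t)) + (- 2 * G (F (y t)) (Z (F (y t))) (D t)) *\<^sub>R X (y t))) (at t within N)"
      by (rule has_vector_derivative_transform[OF t, rotated])
         (simp add: W1_def X_def linear_add[OF linear_dF[OF y_in]] linear_cmul[OF linear_dF[OF y_in]])
    moreover have "(E - chris G (F (y t)) (X (y t)) (fd F (y t) (W t)) - K (y t) (W t))
       + (f1 t *\<^sub>R fd X (y t) (\<xi> (y t)) + (- 2 * G (F (y t)) (Z (F (y t))) (D t)) *\<^sub>R X (y t))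
       = 0 - chris G (F (y t)) (X (y t)) (fd F (y t) (W1 t)) - K (y t) (W1 t)"
      using K_\<xi>[OF yt]
      by (simp add: E geo W1_def linear_add[OF linear_dF[OF yt]] linear_cmul[OF linear_dF[OF yt]]
          linear_add[OF linear_K[OF yt]] linear_cmul[OF linear_K[OF yt]] bilinear_radd[OF \<Gamma>] bilinear_rmul[OF \<Gamma>] X_def[symmetric])
    ultimately show ?thesis by simp
  qed
  then have "cjac G N (\<lambda>t. F (y t)) (\<lambda>t. X (y t)) (\<lambda>t. fd F (y t) (V1 t))"
    by (subst cjac_iff[of V1 V1' W1, OF V1 W1]) auto
  then show ?thesis by (simp add: V1_def)
qed

text \<open>Describes the kernel of the screen projection: the Lie derivative of f \<xi> is f'
  \<xi>, on which \<open>K\<close> vanishes, so the Jacobi equation reduces to f'' = 0.\<close>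

lemma multiple_of_\<xi>_cjac:
  assumes "cjac G N (\<lambda>t. F (y t)) (\<lambda>t. X (y t)) (\<lambda>t. fd F (y t) (f t *\<^sub>R \<xi> (y t)))"
  obtains q where "\<And>t. t \<in> N \<Longrightarrow> (f has_vector_derivative q t) (at t within N)"
    "\<And>t. t \<in> N \<Longrightarrow> (q has_vector_derivative 0) (at t within N)"
proof -
  obtain V' W' where V: "\<And>t. t \<in> N \<Longrightarrow> ((\<lambda>t. f t *\<^sub>R \<xi> (y t)) has_vector_derivative V' t) (at t within N)"
    and W: "\<And>t. t \<in> N \<Longrightarrow> ((\<lambda>t. V' t - fd \<xi> (y t) (f t *\<^sub>R \<xi> (y t))) has_vector_derivative W' t) (at t within N)"
    and E: "\<And>t. t \<in> N \<Longrightarrow> ((\<lambda>s. fd F (y s) (V' s - fd \<xi> (y s) (f s *\<^sub>R \<xi> (y s)))) has_vector_derivative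
      (0 - chris G (F (y t)) (X (y t)) (fd F (y t) (V' t - fd \<xi> (y t) (f t *\<^sub>R \<xi> (y t)))) - K (y t) (V' t - fd \<xi> (y t) (f t *\<^sub>R \<xi> (y t))))) (at t within N)"
    using cjac_tangent_differentiable[OF assms] by blast
  define W0 where "W0 = (\<lambda>t. V' t - fd \<xi> (y t) (f t *\<^sub>R \<xi> (y t)))"
  have W: "(W0 has_vector_derivative W' t) (at t within N)" if "t \<in> N" for t
    using W[OF that] by (simp add: W0_def)
  have E: "((\<lambda>s. fd F (y s) (W0 s)) has_vector_derivative
      (0 - chris G (F (y t)) (X (y t)) (fd F (y t) (W0 t)) - K (y t) (W0 t))) (at t within N)" if "t \<in> N" for t
    using E[OF that] by (simp add: W0_def)
  have f: "(f has_vector_derivative \<omega> (y t) (W0 t)) (at t within N)" if "t \<in> N" for t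
  proof -
    have "((\<lambda>s. \<omega> (y s) (f s *\<^sub>R \<xi> (y s))) has_vector_derivative \<omega> (y t) (W0 t)) (at t within N)"
      using \<omega>_deriv[OF that V[OF that]] by (simp add: W0_def)
    then show ?thesis
      by (rule has_vector_derivative_transform[OF that, rotated]) (simp add: linear_cmul[OF linear_\<omega>[OF y_in]] \<omega>_\<xi> y_in)
  qed
  have W0: "W0 t = \<omega> (y t) (W0 t) *\<^sub>R \<xi> (y t)" if "t \<in> N" for t
  proof -
    have "((\<lambda>t. f t *\<^sub>R \<xi> (y t)) has_vector_derivative (f t *\<^sub>R fd \<xi> (y t) (\<xi> (y t)) + \<omega> (y t) (W0 t) *\<^sub>R \<xi> (y t))) (at t within N)"
      by (intro has_vector_derivative_scaleR_real \<xi>y_deriv[OF that] f[OF that])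
    from vector_derivative_unique[OF V[OF that] this N_perfect[OF that]]
    have "W0 t = f t *\<^sub>R fd \<xi> (y t) (\<xi> (y t)) + \<omega> (y t) (W0 t) *\<^sub>R \<xi> (y t) - f t *\<^sub>R fd \<xi> (y t) (\<xi> (y t))"
      by (subst W0_def) (simp add: linear_cmul[OF linear_d\<xi>[OF y_in[OF that]]])
    then show ?thesis by simp
  qed
  have "\<omega> (y t) (W' t - fd \<xi> (y t) (W0 t)) = 0" if t: "t \<in> N" for t
  proof -
    note yt = y_in[OF t]
    have "K (y t) (W0 t) = K (y t) (\<omega> (y t) (W0 t) *\<^sub>R \<xi> (y t))" using W0[OF t] by simp
    then have K: "K (y t) (W0 t) = 0" by (simp add: linear_cmul[OF linear_K[OF yt]] K_\<xi>[OF yt])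
    have "fd F (y t) (W' t - fd \<xi> (y t) (W0 t)) = 0"
      using vector_derivative_unique[OF E[OF t] covariant_derivative_eq_Lie[OF t W[OF t]] N_perfect[OF t]] K by simp
    then have "W' t - fd \<xi> (y t) (W0 t) = 0" by (rule dF_eq_0[OF yt])
    then show ?thesis by (simp add: linear_0[OF linear_\<omega>[OF yt]])
  qed
  then show thesis
    using f \<omega>_deriv[OF _ W] by (intro that[of "\<lambda>t. \<omega> (y t) (W0 t)"]) auto
qed

end

section \<open>Charts and tangent vectors\<close>

lemma metric_coords_subset:
  assumes "metric_coords S G" "open T" "T \<subseteq> S"
  shows "metric_coords T G"
proof -
  interpret metric_coords S G by fact
  show ?thesis
    by unfold_locales (use assms bilinear_G G_sym nondegenerate_G diff_on_subset[OF diff_on_G] in auto)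
qed

lemma at_within_Int_open: "t \<in> T \<Longrightarrow> open T \<Longrightarrow> at t within I \<inter> T = at t within I"
  by (rule at_within_nhd[of t T]) auto

locale manifold =
  fixes A :: "('a::{second_countable_topology, t2_space}, 'e::euclidean_space) chart set"
  assumes manifold: "smooth_manifold A"
begin

abbreviation \<tau> :: "('a, 'e) chart \<Rightarrow> ('a, 'e) chart \<Rightarrow> 'e \<Rightarrow> 'e" where
  "\<tau> c d \<equiv> snd d \<circ> chart_inv c"

lemma chart_homeomorphism: "c \<in> A \<Longrightarrow> homeomorphism (fst c) (snd c ` fst c) (snd c) (chart_inv c)"
  and open_chart: "c \<in> A \<Longrightarrow> open (fst c)"
  and open_chart_image: "c \<in> A \<Longrightarrow> open (snd c ` fst c)"
  using manifold by (auto simp: smooth_manifold_def)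

lemma chart_inv_chart [simp]: "c \<in> A \<Longrightarrow> p \<in> fst c \<Longrightarrow> chart_inv c (snd c p) = p"
  using chart_homeomorphism homeomorphism_apply1 by blast

lemma open_chart_Int:
  assumes "c \<in> A" "open W"
  shows "open (snd c ` (W \<inter> fst c))"
proof -
  have "openin (top_of_set (fst c)) (fst c \<inter> W)" using assms by (simp add: openin_open_Int)
  then have "openin (top_of_set (snd c ` fst c)) (snd c ` (fst c \<inter> W))"
    using chart_homeomorphism[OF assms(1)] homeomorphism_imp_open_map by blast
  then show ?thesis using open_chart_image[OF assms(1)] openin_open_eq by (metis Int_commute)
qed

lemma diff_on_\<tau>:
  assumes "c \<in> A" "d \<in> A"
  shows "diff_on k (snd c ` (fst c \<inter> fst d)) (\<tau> c d)"
  using manifold assms by (auto simp: smooth_manifold_def intro: smooth_on_imp_diff_on)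

lemma open_\<tau>_domain: "c \<in> A \<Longrightarrow> d \<in> A \<Longrightarrow> open (snd c ` (fst c \<inter> fst d))"
  using open_chart_Int[of c "fst d"] open_chart by (simp add: Int_commute)

lemma \<tau>_has_derivative:
  assumes "c \<in> A" "d \<in> A" "p \<in> fst c" "p \<in> fst d"
  shows "(\<tau> c d has_derivative fd (\<tau> c d) (snd c p)) (at (snd c p))"
  by (rule diff_onD[OF diff_on_\<tau>[of c d 1]]) (use assms in auto)

lemma linear_d\<tau>:
  assumes "c \<in> A" "d \<in> A" "p \<in> fst c" "p \<in> fst d"
  shows "linear (fd (\<tau> c d) (snd c p))"
  using \<tau>_has_derivative[OF assms] by (rule has_derivative_linear)

lemma d\<tau>_compose:
  assumes "c \<in> A" "d \<in> A" "e \<in> A" "p \<in> fst c" "p \<in> fst d" "p \<in> fst e"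
  shows "fd (\<tau> c e) (snd c p) u = fd (\<tau> d e) (snd d p) (fd (\<tau> c d) (snd c p) u)"
proof -
  have "(\<tau> d e \<circ> \<tau> c d has_derivative fd (\<tau> d e) (snd d p) \<circ> fd (\<tau> c d) (snd c p)) (at (snd c p))"
    using \<tau>_has_derivative assms by (intro diff_chain_at) simp_all
  moreover have "open (snd c ` ((fst d \<inter> fst e) \<inter> fst c))"
    using assms by (intro open_chart_Int open_Int open_chart)
  ultimately have "(\<tau> c e has_derivative fd (\<tau> d e) (snd d p) \<circ> fd (\<tau> c d) (snd c p)) (at (snd c p))"
    by (rule has_derivative_transform_within_open[where s = "snd c ` ((fst d \<inter> fst e) \<inter> fst c)"])
       (use assms in auto)
  then show ?thesis by (simp add: frechet_derivative_eq)
qed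

lemma d\<tau>_self:
  assumes "c \<in> A" "p \<in> fst c"
  shows "fd (\<tau> c c) (snd c p) u = u"
proof -
  have "(\<tau> c c has_derivative (\<lambda>u. u)) (at (snd c p))"
    by (rule has_derivative_transform_within_open[OF has_derivative_ident open_chart_image[OF assms(1)]])
       (use assms in auto)
  then show ?thesis by (simp add: frechet_derivative_eq)
qed

lemma charts_at_iff: "c \<in> charts_at A p \<longleftrightarrow> c \<in> A \<and> p \<in> fst c"
  by (simp add: charts_at_def)

lemma chart_at:
  assumes "p \<in> points A"
  shows "chart_at A p \<in> A" "p \<in> fst (chart_at A p)"
proof -
  have "\<exists>c. c \<in> charts_at A p" using assms by (auto simp: points_def charts_at_def)
  then have "chart_at A p \<in> charts_at A p" unfolding chart_at_def by (rule someI_ex)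
  then show "chart_at A p \<in> A" "p \<in> fst (chart_at A p)" by (simp_all add: charts_at_iff)
qed

lemma tangent_spaceD:
  "v \<in> tangent_space A p \<Longrightarrow> c \<in> A \<Longrightarrow> p \<in> fst c \<Longrightarrow> d \<in> A \<Longrightarrow> p \<in> fst d \<Longrightarrow>
    v d = fd (\<tau> c d) (snd c p) (v c)"
  using charts_at_iff[of c p] charts_at_iff[of d p] unfolding tangent_space_def mem_Collect_eq by blast

lemma tangent_vector_apply:
  "d \<in> A \<Longrightarrow> p \<in> fst d \<Longrightarrow> tangent_vector A c p u d = fd (\<tau> c d) (snd c p) u"
  by (simp add: tangent_vector_def charts_at_iff)

lemma tangent_vector_self: "c \<in> A \<Longrightarrow> p \<in> fst c \<Longrightarrow> tangent_vector A c p u c = u"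
  by (simp add: tangent_vector_apply d\<tau>_self)

lemma tangent_vector_in:
  assumes "c \<in> A" "p \<in> fst c"
  shows "tangent_vector A c p u \<in> tangent_space A p"
  unfolding tangent_space_def mem_Collect_eq
proof (intro conjI allI ballI impI)
  show "tangent_vector A c p u d = 0" if "d \<notin> charts_at A p" for d
    using that by (simp add: tangent_vector_def)
  show "tangent_vector A c p u e = fd (\<tau> d e) (snd d p) (tangent_vector A c p u d)"
    if "d \<in> charts_at A p" "e \<in> charts_at A p" for d e
    using that d\<tau>_compose[OF assms(1) _ _ assms(2), of d e] by (simp add: charts_at_iff tangent_vector_apply)
qed

lemma tangent_space_eqI:
  assumes "v \<in> tangent_space A p" "w \<in> tangent_space A p" "c \<in> A" "p \<in> fst c" "v c = w c"
  shows "v = w"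
proof
  fix d
  show "v d = w d"
  proof (cases "d \<in> charts_at A p")
    case True
    then show ?thesis
      using tangent_spaceD[OF assms(1,3,4), of d] tangent_spaceD[OF assms(2,3,4), of d] assms(5)
      by (simp add: charts_at_iff)
  next
    case False
    then have "v d = 0" "w d = 0" using assms(1,2) unfolding tangent_space_def by blast+
    then show ?thesis by simp
  qed
qed

lemma tangent_vector_eq:
  assumes "v \<in> tangent_space A p" "c \<in> A" "p \<in> fst c"
  shows "tangent_vector A c p (v c) = v"
  using tangent_space_eqI[OF tangent_vector_in[OF assms(2,3)] assms] tangent_vector_self[OF assms(2,3)] by simp

lemma tangent_space_outside: "v \<in> tangent_space A p \<Longrightarrow> c \<notin> charts_at A p \<Longrightarrow> v c = 0"
  unfolding tangent_space_def by blast

lemma subspace_tangent_space: "subspace (tangent_space A p)"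
proof (rule subspaceI)
  have lin: "linear (fd (\<tau> c d) (snd c p))" if "c \<in> charts_at A p" "d \<in> charts_at A p" for c d
    using that by (auto simp: charts_at_iff intro: linear_d\<tau>)
  note outside = tangent_space_outside
  have inside: "v d = fd (\<tau> c d) (snd c p) (v c)"
    if "v \<in> tangent_space A p" "c \<in> charts_at A p" "d \<in> charts_at A p" for v c d
    using that by (simp add: charts_at_iff tangent_spaceD)
  show "0 \<in> tangent_space A p"
    unfolding tangent_space_def using lin by (auto simp only: mem_Collect_eq zero_fun_apply linear_0)
  show "u + v \<in> tangent_space A p" if "u \<in> tangent_space A p" "v \<in> tangent_space A p" for u v
    unfolding tangent_space_def mem_Collect_eq plus_fun_apply
  proof (intro conjI allI ballI impI)
    show "u c + v c = 0" if "c \<notin> charts_at A p" for c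
      using outside[OF \<open>u \<in> _\<close> that] outside[OF \<open>v \<in> _\<close> that] by simp
    show "u d + v d = fd (\<tau> c d) (snd c p) (u c + v c)" if "c \<in> charts_at A p" "d \<in> charts_at A p" for c d
      using inside[OF \<open>u \<in> _\<close> that] inside[OF \<open>v \<in> _\<close> that] linear_add[OF lin[OF that]] by simp
  qed
  show "r *\<^sub>R u \<in> tangent_space A p" if "u \<in> tangent_space A p" for r u
    unfolding tangent_space_def mem_Collect_eq scaleR_fun_def
  proof (intro conjI allI ballI impI)
    show "r *\<^sub>R u c = 0" if "c \<notin> charts_at A p" for c
      using outside[OF \<open>u \<in> _\<close> that] by simp
    show "r *\<^sub>R u d = fd (\<tau> c d) (snd c p) (r *\<^sub>R u c)" if "c \<in> charts_at A p" "d \<in> charts_at A p" for c d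
      using inside[OF \<open>u \<in> _\<close> that] linear_cmul[OF lin[OF that]] by simp
  qed
qed

end

lemma scaleR_fun_apply: "(r *\<^sub>R f) x = r *\<^sub>R f x"
  by (simp add: scaleR_fun_def)

lemma christoffel_eq: "christoffel A g c = chris (metric_in_chart A g c)"
  by (intro ext) (simp only: christoffel_def chris_def)

lemma curvature_eq:
  "c \<in> charts_at A p \<Longrightarrow>
    curvature A g p u v w c = curv (chris (metric_in_chart A g c)) (snd c p) (u c) (v c) (w c)"
  by (simp only: curvature_def curv_def christoffel_eq Let_def if_True)

text \<open>A neighbourhood of each point is asked for rather than the whole image of a chart: the
  rigged metric is computed with an auxiliary chart of the ambient manifold, which need not cover a
  whole chart of the hypersurface.\<close>

locale metric_manifold = manifold A for A :: "('a::{second_countable_topology, t2_space}, 'e::euclidean_space) chart set" +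
  fixes g :: "('a, 'e) form2"
  assumes local_metric_coords: "\<And>c p. c \<in> A \<Longrightarrow> p \<in> fst c \<Longrightarrow>
    \<exists>S. snd c p \<in> S \<and> metric_coords S (metric_in_chart A g c)"
begin

lemma metric_in_chart_eq:
  "c \<in> A \<Longrightarrow> p \<in> fst c \<Longrightarrow> u \<in> tangent_space A p \<Longrightarrow> v \<in> tangent_space A p \<Longrightarrow>
    metric_in_chart A g c (snd c p) (u c) (v c) = g p u v"
  by (simp add: metric_in_chart_def tangent_vector_eq)

lemma change_of_charts:
  assumes c: "c \<in> A" "p \<in> fst c" and d: "d \<in> A" "p \<in> fst d"
  obtains S T where "snd c p \<in> S" "S \<subseteq> snd c ` (fst c \<inter> fst d)"
    "metric_coord_change S T (metric_in_chart A g c) (metric_in_chart A g d) (\<tau> c d)"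
proof -
  obtain S0 where S0: "snd c p \<in> S0" "metric_coords S0 (metric_in_chart A g c)"
    using local_metric_coords[OF c] by (elim exE conjE) (rule that)
  obtain T where T: "snd d p \<in> T" "metric_coords T (metric_in_chart A g d)"
    using local_metric_coords[OF d] by (elim exE conjE) (rule that)
  let ?D = "snd c ` (fst c \<inter> fst d)"
  \<comment> \<open>Shrunk so that the change of charts maps \<open>S\<close> into
    \<open>T\<close>.\<close>
  define S where "S = S0 \<inter> (?D \<inter> \<tau> c d -` T)"
  have "continuous_on ?D (\<tau> c d)"
  proof (intro continuous_at_imp_continuous_on ballI)
    show "isCont (\<tau> c d) x" if "x \<in> ?D" for x
      by (rule has_derivative_continuous[OF diff_onD[OF diff_on_\<tau>[OF c(1) d(1), of 1] _ that]]) simp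
  qed
  then have "open (?D \<inter> \<tau> c d -` T)"
    using open_\<tau>_domain[OF c(1) d(1)] metric_coords.open_S[OF T(2)] continuous_open_preimage by blast
  then have "open S" unfolding S_def using metric_coords.open_S[OF S0(2)] by blast
  then have mS: "metric_coords S (metric_in_chart A g c)"
    using metric_coords_subset[OF S0(2)] by (simp add: S_def)
  interpret S: metric_coords S "metric_in_chart A g c" by (rule mS)
  interpret T: metric_coords T "metric_in_chart A g d" by (rule T(2))
  have "metric_coord_change S T (metric_in_chart A g c) (metric_in_chart A g d) (\<tau> c d)"
  proof unfold_locales
    show "\<tau> c d ` S \<subseteq> T" by (auto simp: S_def)
    show "diff_on 4 S (\<tau> c d)"
      by (rule diff_on_subset[OF diff_on_\<tau>[OF c(1) d(1)]]) (auto simp: S_def)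
    fix x assume "x \<in> S"
    then obtain q where q: "q \<in> fst c" "q \<in> fst d" "x = snd c q" by (auto simp: S_def)
    show "inj (fd (\<tau> c d) x)"
      by (rule inj_on_inverseI[where g = "fd (\<tau> d c) (snd d q)"])
         (use d\<tau>_compose[OF c(1) d(1) c(1) q(1,2,1)] d\<tau>_self[OF c(1) q(1)] q(3) in simp)
    fix u v
    have tv: "tangent_vector A d q (fd (\<tau> c d) (snd c q) u) = tangent_vector A c q u" for u
      by (rule tangent_space_eqI[OF tangent_vector_in tangent_vector_in c(1) q(1)])
         (use c d q d\<tau>_compose[OF c(1) d(1) c(1) q(1,2,1)] in \<open>auto simp: tangent_vector_apply\<close>)
    show "metric_in_chart A g c x u v = metric_in_chart A g d (\<tau> c d x) (fd (\<tau> c d) x u) (fd (\<tau> c d) x v)"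
      using c d q by (simp add: metric_in_chart_def tv)
  qed
  moreover have "snd c p \<in> S" using S0 T c d by (auto simp: S_def)
  ultimately show thesis by (intro that) (auto simp: S_def)
qed

end

section \<open>Jacobi fields in charts\<close>

locale manifold_curve = manifold A for A :: "('a::{second_countable_topology, t2_space}, 'e::euclidean_space) chart set" +
  fixes I :: "real set" and \<gamma> :: "real \<Rightarrow> 'a"
  assumes I_perfect: "\<And>t. t \<in> I \<Longrightarrow> at t within I \<noteq> bot"
    and continuous_\<gamma>: "continuous_on I \<gamma>"
    and \<gamma>_image: "\<gamma> ` I \<subseteq> points A"
    and \<gamma>_deriv: "\<And>t c. t \<in> I \<Longrightarrow> c \<in> A \<Longrightarrow> \<gamma> t \<in> fst c \<Longrightarrow>
      ((snd c \<circ> \<gamma>) has_vector_derivative velocity A I \<gamma> t c) (at t within I)"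
begin

lemma preimage_relatively_open:
  assumes "open W"
  obtains T where "open T" "{s \<in> I. \<gamma> s \<in> W} = I \<inter> T"
proof -
  have "\<exists>T. open T \<and> T \<inter> I = \<gamma> -` W \<inter> I"
    using iffD1[OF continuous_on_open_invariant continuous_\<gamma>] assms by metis
  then obtain T where "open T" "T \<inter> I = \<gamma> -` W \<inter> I" by (elim exE conjE) (rule that)
  then show thesis by (intro that[of T]) auto
qed

text \<open>Lets a curve be restricted to the times spent in a chart without changing any
  derivative, including the one-sided ones at the ends.\<close>

lemma at_within_preimage:
  assumes "open W" "t \<in> I" "\<gamma> t \<in> W"
  shows "at t within {s \<in> I. \<gamma> s \<in> W} = at t within I"
proof -
  obtain T where "open T" and T: "{s \<in> I. \<gamma> s \<in> W} = I \<inter> T" using preimage_relatively_open[OF assms(1)] .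
  then have "t \<in> T" using assms by auto
  with \<open>open T\<close> show ?thesis unfolding T by (simp add: at_within_Int_open)
qed

end

locale metric_manifold_curve = metric_manifold A g + manifold_curve A I \<gamma>
  for A :: "('a::{second_countable_topology, t2_space}, 'e::euclidean_space) chart set" and g I \<gamma>
begin

abbreviation \<Gamma> :: "('a, 'e) chart \<Rightarrow> 'e \<Rightarrow> 'e \<Rightarrow> 'e \<Rightarrow> 'e" where
  "\<Gamma> c \<equiv> chris (metric_in_chart A g c)"

lemma cov_deriv_along_eqI:
  assumes "t \<in> I" "c \<in> A" "\<gamma> t \<in> fst c"
    and "((\<lambda>s. X s c) has_vector_derivative X') (at t within I)"
  shows "cov_deriv_along A g I \<gamma> X t c = X' + \<Gamma> c (snd c (\<gamma> t)) (velocity A I \<gamma> t c) (X t c)"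
  using assms vector_derivative_within[OF I_perfect[OF assms(1)] assms(4)]
  by (simp add: cov_deriv_along_def charts_at_iff christoffel_eq)

lemma cov_deriv_along_has_vector_derivative:
  assumes "t \<in> I" "c \<in> A" "\<gamma> t \<in> fst c" "(\<lambda>s. X s c) differentiable (at t within I)"
  shows "((\<lambda>s. X s c) has_vector_derivative
    cov_deriv_along A g I \<gamma> X t c - \<Gamma> c (snd c (\<gamma> t)) (velocity A I \<gamma> t c) (X t c)) (at t within I)"
  using assms by (simp add: cov_deriv_along_def charts_at_iff christoffel_eq vector_derivative_works)

text \<open>\<open>jacobi_field\<close> demands that the covariant derivative be a field of tangent
  vectors again. Its components in two charts are compared at the times when the curve lies in both
  of them, by \<open>covariant_derivative_transform\<close>.\<close>

lemma cov_deriv_along_tangent: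
  assumes X: "\<And>s. s \<in> I \<Longrightarrow> X s \<in> tangent_space A (\<gamma> s)"
    and dX: "\<And>c. c \<in> A \<Longrightarrow> \<gamma> t \<in> fst c \<Longrightarrow> (\<lambda>s. X s c) differentiable (at t within I)"
    and t: "t \<in> I"
  shows "cov_deriv_along A g I \<gamma> X t \<in> tangent_space A (\<gamma> t)"
  unfolding tangent_space_def mem_Collect_eq charts_at_iff
proof (intro conjI allI ballI impI)
  show "cov_deriv_along A g I \<gamma> X t c = 0" if "\<not> (c \<in> A \<and> \<gamma> t \<in> fst c)" for c
    using that by (auto simp: cov_deriv_along_def charts_at_iff)
  fix c d assume "c \<in> charts_at A (\<gamma> t)" "d \<in> charts_at A (\<gamma> t)"
  then have c: "c \<in> A" "\<gamma> t \<in> fst c" and d: "d \<in> A" "\<gamma> t \<in> fst d" by (auto simp: charts_at_iff)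
  obtain S T where S: "snd c (\<gamma> t) \<in> S" "S \<subseteq> snd c ` (fst c \<inter> fst d)"
    and ch: "metric_coord_change S T (metric_in_chart A g c) (metric_in_chart A g d) (\<tau> c d)"
    using change_of_charts[OF c d] .
  interpret metric_coord_change S T "metric_in_chart A g c" "metric_in_chart A g d" "\<tau> c d" by (rule ch)
  define W where "W = fst c \<inter> snd c -` S"
  have "open W" unfolding W_def
    using chart_homeomorphism[OF c(1)] open_chart[OF c(1)] S.open_S
    by (auto simp: homeomorphism_def intro: continuous_open_preimage)
  define N where "N = {s \<in> I. \<gamma> s \<in> W}"
  have tN: "t \<in> N" using t c S by (auto simp: N_def W_def)
  have at: "at t within N = at t within I"
    unfolding N_def by (rule at_within_preimage) (use \<open>open W\<close> tN N_def in auto)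
  have xN: "(\<lambda>s. snd c (\<gamma> s)) ` N \<subseteq> S" by (auto simp: N_def W_def)
  have Nd: "\<gamma> s \<in> fst c" "\<gamma> s \<in> fst d" "s \<in> I" if "s \<in> N" for s
  proof -
    show "\<gamma> s \<in> fst c" "s \<in> I" using that by (auto simp: N_def W_def)
    have "snd c (\<gamma> s) \<in> snd c ` (fst c \<inter> fst d)" using that S(2) by (auto simp: N_def W_def)
    then obtain q where "q \<in> fst c" "q \<in> fst d" "snd c (\<gamma> s) = snd c q" by auto
    then show "\<gamma> s \<in> fst d" using \<open>\<gamma> s \<in> fst c\<close> chart_inv_chart[OF c(1)] by metis
  qed
  let ?v = "velocity A I \<gamma> t"
  have v: "((\<lambda>s. snd c (\<gamma> s)) has_vector_derivative ?v c) (at t within N)"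
    using \<gamma>_deriv[OF t c] by (simp add: at o_def)
  \<comment> \<open>The velocity transforms as a tangent vector, by the chain rule and uniqueness of
    derivatives within \<open>I\<close>.\<close>
  have vd: "?v d = fd (\<tau> c d) (snd c (\<gamma> t)) (?v c)"
  proof -
    have "((\<lambda>s. \<tau> c d (snd c (\<gamma> s))) has_vector_derivative fd (\<tau> c d) (snd c (\<gamma> t)) (?v c)) (at t within N)"
      by (rule has_vector_derivative_compose_at[OF \<tau>_has_derivative[OF c(1) d(1) c(2) d(2)] v])
    then have "((snd d \<circ> \<gamma>) has_vector_derivative fd (\<tau> c d) (snd c (\<gamma> t)) (?v c)) (at t within N)"
      by (rule has_vector_derivative_transform[OF tN, rotated]) (use Nd c in auto)
    then show ?thesis using vector_derivative_unique[OF \<gamma>_deriv[OF t d] _ I_perfect[OF t]] by (simp add: at)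
  qed
  obtain X' where X': "((\<lambda>s. X s c) has_vector_derivative X') (at t within I)"
    using dX[OF c] vector_derivative_works by blast
  have Xd: "X s d = fd (\<tau> c d) (snd c (\<gamma> s)) (X s c)" if "s \<in> N" for s
    using tangent_spaceD[OF X[OF Nd(3)[OF that]] c(1) Nd(1)[OF that] d(1) Nd(2)[OF that]] .
  have "((\<lambda>s. fd (\<tau> c d) (snd c (\<gamma> s)) (X s c)) has_vector_derivative
      fd (\<lambda>y. fd (\<tau> c d) y (X t c)) (snd c (\<gamma> t)) (?v c) + fd (\<tau> c d) (snd c (\<gamma> t)) X') (at t within N)"
    by (rule pushforward_has_vector_derivative[where x = "\<lambda>s. snd c (\<gamma> s)"]) (use xN tN v X' at in auto)
  then have "((\<lambda>s. X s d) has_vector_derivative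
      fd (\<lambda>y. fd (\<tau> c d) y (X t c)) (snd c (\<gamma> t)) (?v c) + fd (\<tau> c d) (snd c (\<gamma> t)) X') (at t within I)"
    unfolding at[symmetric] by (rule has_vector_derivative_transform[OF tN, rotated]) (simp add: Xd)
  note d' = cov_deriv_along_eqI[where X = X, OF t d this]
  have "fd (\<tau> c d) (snd c (\<gamma> t)) (cov_deriv_along A g I \<gamma> X t c) = cov_deriv_along A g I \<gamma> X t d"
    unfolding d' cov_deriv_along_eqI[where X = X, OF t c X'] vd Xd[OF tN]
    using covariant_derivative_transform[OF S(1), of X' "?v c" "X t c"] c by simp
  then show "cov_deriv_along A g I \<gamma> X t d = fd (\<tau> c d) (snd c (\<gamma> t)) (cov_deriv_along A g I \<gamma> X t c)" ..
qed

definition chart_jacobi :: "('a, 'e) chart \<Rightarrow> real set \<Rightarrow> (real \<Rightarrow> ('a, 'e) tvec) \<Rightarrow> bool" where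
  "chart_jacobi c N J \<longleftrightarrow>
     cjac (metric_in_chart A g c) N (\<lambda>t. snd c (\<gamma> t)) (\<lambda>t. velocity A I \<gamma> t c) (\<lambda>t. J t c)"

lemma jacobi_field_imp_chart_jacobi:
  assumes J: "jacobi_field A g I \<gamma> J" and c: "c \<in> A" and N: "N \<subseteq> I" "\<gamma> ` N \<subseteq> fst c"
  shows "chart_jacobi c N J"
  unfolding chart_jacobi_def cjac_def
proof (intro exI ballI conjI)
  let ?D = "cov_deriv_along A g I \<gamma>"
  fix t assume "t \<in> N"
  then have t: "t \<in> I" "\<gamma> t \<in> fst c" using N by auto
  have ca: "c \<in> charts_at A (\<gamma> t)" using c t by (simp add: charts_at_iff)
  have d1: "(\<lambda>s. J s c) differentiable (at t within I)" and d2: "(\<lambda>s. ?D J s c) differentiable (at t within I)"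
    using J ca t unfolding jacobi_field_def differentiable_field_along_def by blast+
  show "((\<lambda>t. J t c) has_vector_derivative
       ?D J t c - \<Gamma> c (snd c (\<gamma> t)) (velocity A I \<gamma> t c) (J t c)) (at t within N)"
    by (rule has_vector_derivative_within_subset[OF cov_deriv_along_has_vector_derivative[where X = J, OF t(1) c t(2) d1] N(1)])
  show "((\<lambda>t. ?D J t c) has_vector_derivative
       ?D (?D J) t c - \<Gamma> c (snd c (\<gamma> t)) (velocity A I \<gamma> t c) (?D J t c)) (at t within N)"
    by (rule has_vector_derivative_within_subset[OF cov_deriv_along_has_vector_derivative[where X = "?D J", OF t(1) c t(2) d2] N(1)])
  have "(?D (?D J) t + curvature A g (\<gamma> t) (J t) (velocity A I \<gamma> t) (velocity A I \<gamma> t)) c = 0"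
    using J t by (simp add: jacobi_field_def)
  then show "?D (?D J) t c + curv (\<Gamma> c) (snd c (\<gamma> t)) (J t c) (velocity A I \<gamma> t c) (velocity A I \<gamma> t c) = 0"
    by (simp add: curvature_eq[OF ca])
qed

text \<open>Being a Jacobi field is a local property: the coordinate equation on a relative
  neighbourhood forces its \<open>P\<close> to be the component of the covariant derivative, and
  derivatives within \<open>I\<close> do not notice the restriction.\<close>

lemma jacobi_fieldI:
  assumes J0: "\<And>t. t \<notin> I \<Longrightarrow> J t = 0"
    and JT: "\<And>t. t \<in> I \<Longrightarrow> J t \<in> tangent_space A (\<gamma> t)"
    and local: "\<And>t c. t \<in> I \<Longrightarrow> c \<in> A \<Longrightarrow> \<gamma> t \<in> fst c \<Longrightarrow>
      \<exists>T. open T \<and> t \<in> T \<and> \<gamma> ` (I \<inter> T) \<subseteq> fst c \<and> chart_jacobi c (I \<inter> T) J"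
  shows "jacobi_field A g I \<gamma> J"
proof -
  let ?D = "cov_deriv_along A g I \<gamma>"
  have *: "(\<lambda>s. J s c) differentiable (at t within I) \<and> (\<lambda>s. ?D J s c) differentiable (at t within I) \<and>
     ?D (?D J) t c + curv (\<Gamma> c) (snd c (\<gamma> t)) (J t c) (velocity A I \<gamma> t c) (velocity A I \<gamma> t c) = 0"
    if t: "t \<in> I" and c: "c \<in> A" "\<gamma> t \<in> fst c" for t c
  proof -
    obtain T where T: "open T" "t \<in> T" "\<gamma> ` (I \<inter> T) \<subseteq> fst c" and J: "chart_jacobi c (I \<inter> T) J"
      using local[OF t c] by blast
    obtain P Q where PQ: "\<And>t. t \<in> I \<inter> T \<Longrightarrow> ((\<lambda>t. J t c) has_vector_derivative
          P t - \<Gamma> c (snd c (\<gamma> t)) (velocity A I \<gamma> t c) (J t c)) (at t within I \<inter> T)"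
      "\<And>t. t \<in> I \<inter> T \<Longrightarrow> (P has_vector_derivative Q t - \<Gamma> c (snd c (\<gamma> t)) (velocity A I \<gamma> t c) (P t)) (at t within I \<inter> T)"
      "\<And>t. t \<in> I \<inter> T \<Longrightarrow> Q t + curv (\<Gamma> c) (snd c (\<gamma> t)) (J t c) (velocity A I \<gamma> t c) (velocity A I \<gamma> t c) = 0"
      using J unfolding chart_jacobi_def cjac_def by blast
    have at: "at s within I \<inter> T = at s within I" if "s \<in> T" for s using that T(1) by (simp add: at_within_Int_open)
    have dJ: "((\<lambda>t. J t c) has_vector_derivative
          P s - \<Gamma> c (snd c (\<gamma> s)) (velocity A I \<gamma> s c) (J s c)) (at s within I)" if "s \<in> I \<inter> T" for s
      using PQ(1)[OF that] at that by simp
    have P: "?D J s c = P s" if "s \<in> I \<inter> T" for s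
      using cov_deriv_along_eqI[where X = J, OF _ c(1) _ dJ[OF that]] T(3) that by auto
    have tT: "t \<in> I \<inter> T" using t T by simp
    have "((\<lambda>s. ?D J s c) has_vector_derivative Q t - \<Gamma> c (snd c (\<gamma> t)) (velocity A I \<gamma> t c) (P t)) (at t within I \<inter> T)"
      by (rule has_vector_derivative_transform[OF tT _ PQ(2)[OF tT]]) (simp add: P)
    then have dP: "((\<lambda>s. ?D J s c) has_vector_derivative Q t - \<Gamma> c (snd c (\<gamma> t)) (velocity A I \<gamma> t c) (P t)) (at t within I)"
      using at T(2) by simp
    have "?D (?D J) t c = Q t"
      using cov_deriv_along_eqI[where X = "?D J", OF t c dP] P[OF tT] by simp
    with dJ[OF tT] dP PQ(3)[OF tT] show ?thesis by (auto intro: differentiableI_vector)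
  qed
  have DT: "?D J t \<in> tangent_space A (\<gamma> t)" if "t \<in> I" for t
    by (rule cov_deriv_along_tangent) (use JT * that in auto)
  have "?D (?D J) t + curvature A g (\<gamma> t) (J t) (velocity A I \<gamma> t) (velocity A I \<gamma> t) = 0" if t: "t \<in> I" for t
  proof
    fix c
    show "(?D (?D J) t + curvature A g (\<gamma> t) (J t) (velocity A I \<gamma> t) (velocity A I \<gamma> t)) c = 0 c"
    proof (cases "c \<in> charts_at A (\<gamma> t)")
      case True
      then show ?thesis using *[OF t, of c] by (simp add: curvature_eq charts_at_iff)
    next
      case False
      then show ?thesis by (simp add: cov_deriv_along_def curvature_def)
    qed
  qed
  moreover have "?D J t = 0" if "t \<notin> I" for t
    using that by (simp add: cov_deriv_along_def zero_fun_def)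
  ultimately show ?thesis
    using * J0 JT DT by (auto simp: jacobi_field_def differentiable_field_along_def charts_at_iff)
qed

end

section \<open>The rigged hypersurface in charts\<close>

lemma lorentzian_signature_nondegenerate:
  fixes b :: "'v::real_vector \<Rightarrow> 'v \<Rightarrow> real"
  assumes L: "lorentzian_signature T b"
    and add: "\<And>u v w. u \<in> T \<Longrightarrow> v \<in> T \<Longrightarrow> w \<in> T \<Longrightarrow> b (u + v) w = b u w + b v w"
    and scale: "\<And>r u v. u \<in> T \<Longrightarrow> v \<in> T \<Longrightarrow> b (r *\<^sub>R u) v = r * b u v"
    and v: "v \<in> T" "\<And>w. w \<in> T \<Longrightarrow> b v w = 0"
  shows "v = 0"
proof -
  obtain e E where *: "e \<notin> E \<and> independent (insert e E) \<and> span (insert e E) = T \<and>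
        b e e = -1 \<and> (\<forall>x\<in>E. b x x = 1) \<and>
        (\<forall>x\<in>insert e E. \<forall>y\<in>insert e E. x \<noteq> y \<longrightarrow> b x y = 0)"
    using L unfolding lorentzian_signature_def by (elim exE) (rule that)
  then have T: "span (insert e E) = T" and e: "b e e = -1" and E: "\<And>x. x \<in> E \<Longrightarrow> b x x = 1" by simp_all
  from * have "\<forall>x\<in>insert e E. \<forall>y\<in>insert e E. x \<noteq> y \<longrightarrow> b x y = 0" by (elim conjE)
  note orth = this[rule_format]
  have sub: "subspace T" unfolding T[symmetric] by (rule subspace_span)
  have S: "x \<in> T" if "x \<in> insert e E" for x unfolding T[symmetric] by (rule span_base[OF that])
  have "v \<in> span (insert e E)" using v(1) T by simp
  then obtain t r where t: "finite t" "t \<subseteq> insert e E" "v = (\<Sum>a\<in>t. r a *\<^sub>R a)"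
    unfolding span_explicit mem_Collect_eq by (elim exE conjE) (rule that)
  have sum: "b (\<Sum>a\<in>s. r a *\<^sub>R a) y = (\<Sum>a\<in>s. r a * b a y)" if "finite s" "s \<subseteq> insert e E" "y \<in> T" for s y
    using that(1,2)
  proof (induction s rule: finite_induct)
    case empty
    have "b (0 *\<^sub>R y) y = 0" using scale[of y y 0] that(3) by simp
    then show ?case by simp
  next
    case (insert a s)
    have "(\<Sum>a\<in>s. r a *\<^sub>R a) \<in> T"
      using insert.prems by (intro subspace_sum[OF sub] subspace_scale[OF sub] S) auto
    moreover have "a \<in> T" using insert.prems by (intro S) simp
    moreover from this have "r a *\<^sub>R a \<in> T" by (rule subspace_scale[OF sub])
    ultimately show ?case using insert add scale that(3) by simp
  qed
  \<comment> \<open>Pairing with the basis vector \<open>y\<close> isolates its coefficient up to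
    the sign of \<open>b y y\<close>.\<close>
  have "r y = 0" if y: "y \<in> t" for y
  proof -
    have "0 = (\<Sum>a\<in>t. r a * b a y)" using sum[OF t(1,2), of y] v(2)[of y] t(2,3) y S by auto
    also have "\<dots> = (\<Sum>a\<in>t. if a = y then r y * b y y else 0)"
    proof (rule sum.cong)
      fix a assume "a \<in> t"
      then show "r a * b a y = (if a = y then r y * b y y else 0)"
        using orth[of a y] t(2) y by (cases "a = y") auto
    qed simp
    also have "\<dots> = r y * b y y" using t(1) y by simp
    finally show ?thesis using e E t(2) y by (metis insert_iff mult_eq_0_iff neg_equal_0_iff_equal subsetD zero_neq_one)
  qed
  then show ?thesis using t(3) by simp
qed

context manifold
begin

lemma
  assumes "c \<in> A" "p \<in> fst c"
  shows tangent_vector_add: "tangent_vector A c p (u + v) = tangent_vector A c p u + tangent_vector A c p v"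
    and tangent_vector_scaleR: "tangent_vector A c p (r *\<^sub>R u) = r *\<^sub>R tangent_vector A c p u"
proof -
  note sub = subspace_tangent_space[of p] and tv = tangent_vector_in[OF assms]
  show "tangent_vector A c p (u + v) = tangent_vector A c p u + tangent_vector A c p v"
    by (rule tangent_space_eqI[OF tv subspace_add[OF sub tv tv] assms]) (simp add: tangent_vector_self[OF assms])
  show "tangent_vector A c p (r *\<^sub>R u) = r *\<^sub>R tangent_vector A c p u"
    by (rule tangent_space_eqI[OF tv subspace_scale[OF sub tv] assms])
       (simp add: tangent_vector_self[OF assms] scaleR_fun_apply)
qed

end

lemma lorentzian_metric_coords:
  fixes A :: "('a::{second_countable_topology, t2_space}, 'e::euclidean_space) chart set"
  assumes L: "lorentzian_manifold A g" and c: "c \<in> A"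
  shows "metric_coords (snd c ` fst c) (metric_in_chart A g c)"
proof -
  interpret manifold A using L by unfold_locales (simp add: lorentzian_manifold_def)
  have T: "smooth_symmetric_tensor A g" using L by (simp add: lorentzian_manifold_def)
  have gsym: "g p u v = g p v u"
    and gadd: "w \<in> tangent_space A p \<Longrightarrow> g p (u + v) w = g p u w + g p v w"
    and gscale: "g p (r *\<^sub>R u) v = r * g p u v"
    if "p \<in> points A" "u \<in> tangent_space A p" "v \<in> tangent_space A p" for p u v w r
    using T that unfolding smooth_symmetric_tensor_def by blast+
  show ?thesis
  proof unfold_locales
    show "open (snd c ` fst c)" by (rule open_chart_image[OF c])
    show "diff_on 3 (snd c ` fst c) (\<lambda>x. metric_in_chart A g c x u v)" for u v
      using T c by (auto simp: smooth_symmetric_tensor_def intro: smooth_on_imp_diff_on)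
    fix x assume "x \<in> snd c ` fst c"
    then obtain p where p: "p \<in> fst c" "x = snd c p" by auto
    then have pA: "p \<in> points A" using c by (auto simp: points_def)
    note tv = tangent_vector_in[OF c p(1)]
    have m: "metric_in_chart A g c x u v = g p (tangent_vector A c p u) (tangent_vector A c p v)" for u v
      using c p by (simp add: metric_in_chart_def)
    show sym: "metric_in_chart A g c x u v = metric_in_chart A g c x v u" for u v
      unfolding m by (rule gsym[OF pA tv tv])
    have lin: "linear (\<lambda>u. metric_in_chart A g c x u v)" for v
      by (rule linearI) (simp_all add: m tangent_vector_add[OF c p(1)] tangent_vector_scaleR[OF c p(1)]
          gadd[OF pA tv tv tv] gscale[OF pA tv tv])
    then have "linear (metric_in_chart A g c x v)" for v
      using sym by (metis (no_types, lifting) linear_iff)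
    with lin show "bilinear (metric_in_chart A g c x)" by (simp add: bilinear_def)
    show "nondegenerate (metric_in_chart A g c x)"
      unfolding nondegenerate_def
    proof (intro allI impI)
      fix u assume u: "\<forall>v. metric_in_chart A g c x u v = 0"
      have "tangent_vector A c p u = 0"
      proof (rule lorentzian_signature_nondegenerate[OF _ _ _ tv])
        show "lorentzian_signature (tangent_space A p) (g p)"
          using L pA by (simp add: lorentzian_manifold_def)
        show "g p (tangent_vector A c p u) w = 0" if "w \<in> tangent_space A p" for w
          using u[rule_format, of "w c"] tangent_vector_eq[OF that c p(1)] by (simp add: m)
      qed (use gadd[OF pA] gscale[OF pA] in auto)
      then show "u = 0" using tangent_vector_self[OF c p(1), of u] by simp
    qed
  qed
qed

section \<open>The hypersurface, its rigging and the rigged field in pairs of charts\<close>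

locale rigged_null_hypersurface =
  fixes A :: "('a::{second_countable_topology, t2_space}, 'e::euclidean_space) chart set"
    and g :: "('a, 'e) form2"
    and B :: "('b::{second_countable_topology, t2_space}, 'f::euclidean_space) chart set"
    and i :: "'b \<Rightarrow> 'a" and U :: "'a set" and \<zeta> :: "'a \<Rightarrow> ('a, 'e) tvec" and \<xi> :: "'b \<Rightarrow> ('b, 'f) tvec"
  assumes lorentzian: "lorentzian_manifold A g"
    and null_hypersurface: "null_hypersurface A g B i"
    and closed_rigging: "closed_rigging A g B i U \<zeta>"
    and rigged_vector_field: "rigged_vector_field A g B i \<zeta> \<xi>"
    and ambient_geodesic_field: "ambient_geodesic_field A g B i \<xi>"
begin

abbreviation gt :: "('b, 'f) form2" where "gt \<equiv> rigged_metric A g B i \<zeta>"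
abbreviation \<omega> :: "('b, 'f) form1" where "\<omega> \<equiv> rigged_form A g B i \<zeta>"
abbreviation di :: "'b \<Rightarrow> ('b, 'f) tvec \<Rightarrow> ('a, 'e) tvec" where "di \<equiv> differential B A i"

definition F :: "('a, 'e) chart \<Rightarrow> ('b, 'f) chart \<Rightarrow> 'f \<Rightarrow> 'e" where
  "F c d = snd c \<circ> i \<circ> chart_inv d"

definition dom :: "('a, 'e) chart \<Rightarrow> ('b, 'f) chart \<Rightarrow> 'f set" where
  "dom c d = snd d ` (fst d \<inter> i -` fst c)"

definition \<xi>c :: "('b, 'f) chart \<Rightarrow> 'f \<Rightarrow> 'f" where
  "\<xi>c d x = \<xi> (chart_inv d x) d"

definition Z :: "('a, 'e) chart \<Rightarrow> 'e \<Rightarrow> 'e" where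
  "Z c x = \<zeta> (chart_inv c x) c"

lemma hypersurface: "hypersurface A B i"
  using null_hypersurface by (simp add: null_hypersurface_def)

lemma smooth_A: "smooth_manifold A" and smooth_B: "smooth_manifold B"
  and smooth_i: "smooth_map B A i" and dims: "DIM('e) = DIM('f) + 1"
  using lorentzian hypersurface by (simp_all add: lorentzian_manifold_def hypersurface_def)

sublocale A: metric_manifold A g
proof unfold_locales
  show "smooth_manifold A" by (rule smooth_A)
  show "\<exists>S. snd c p \<in> S \<and> metric_coords S (metric_in_chart A g c)" if "c \<in> A" "p \<in> fst c" for c p
    using lorentzian_metric_coords[OF lorentzian that(1)] that(2) by (intro exI[of _ "snd c ` fst c"]) simp
qed

sublocale B: manifold B by unfold_locales (rule smooth_B)

lemma points_B: "d \<in> B \<Longrightarrow> p \<in> fst d \<Longrightarrow> p \<in> points B"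
  by (auto simp: points_def)

lemma i_in: "p \<in> points B \<Longrightarrow> i p \<in> points A" "p \<in> points B \<Longrightarrow> i p \<in> U"
  using smooth_i closed_rigging by (auto simp: smooth_map_def closed_rigging_def rigging_def)

lemma open_U: "open U" and \<zeta>_in: "q \<in> U \<Longrightarrow> \<zeta> q \<in> tangent_space A q"
  using closed_rigging by (auto simp: closed_rigging_def rigging_def smooth_vector_field_def)

lemma \<xi>_in: "p \<in> points B \<Longrightarrow> \<xi> p \<in> tangent_space B p"
  using rigged_vector_field by (simp add: rigged_vector_field_def smooth_vector_field_def)

lemma open_preimage:
  assumes "c \<in> A" "d \<in> B"
  shows "open (fst d \<inter> i -` fst c)"
proof -
  have "continuous_on (points B) i" using smooth_i by (simp add: smooth_map_def)
  then have "continuous_on (fst d) i" by (rule continuous_on_subset) (use points_B[OF assms(2)] in blast)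
  then show ?thesis
    by (rule continuous_open_preimage[OF _ B.open_chart[OF assms(2)] A.open_chart[OF assms(1)]])
qed

lemma open_dom: "c \<in> A \<Longrightarrow> d \<in> B \<Longrightarrow> open (dom c d)"
  using B.open_chart_Int[of d "fst d \<inter> i -` fst c"] open_preimage[of c d] by (simp add: dom_def Int_ac)

lemma domE:
  assumes "x \<in> dom c d" "d \<in> B"
  obtains p where "p \<in> fst d" "i p \<in> fst c" "x = snd d p" "chart_inv d x = p" "p \<in> points B"
  using assms points_B by (auto simp: dom_def)

lemma domI: "p \<in> fst d \<Longrightarrow> i p \<in> fst c \<Longrightarrow> snd d p \<in> dom c d"
  by (auto simp: dom_def)

lemma F_apply: "d \<in> B \<Longrightarrow> p \<in> fst d \<Longrightarrow> F c d (snd d p) = snd c (i p)"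
  by (simp add: F_def)

lemma diff_on_F: "c \<in> A \<Longrightarrow> d \<in> B \<Longrightarrow> diff_on k (dom c d) (F c d)"
  using smooth_i by (auto simp: smooth_map_def dom_def F_def intro: smooth_on_imp_diff_on)

lemma F_has_derivative:
  assumes "c \<in> A" "d \<in> B" "p \<in> fst d" "i p \<in> fst c"
  shows "(F c d has_derivative fd (F c d) (snd d p)) (at (snd d p))"
  by (rule diff_onD[OF diff_on_F[OF assms(1,2), of 1]]) (use assms domI in auto)

lemma dF_change_target:
  assumes "c \<in> A" "c' \<in> A" "d \<in> B" "p \<in> fst d" "i p \<in> fst c" "i p \<in> fst c'"
  shows "fd (F c' d) (snd d p) u = fd (A.\<tau> c c') (snd c (i p)) (fd (F c d) (snd d p) u)"
proof -
  have "(A.\<tau> c c' \<circ> F c d has_derivative fd (A.\<tau> c c') (snd c (i p)) \<circ> fd (F c d) (snd d p)) (at (snd d p))"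
    by (rule diff_chain_at[OF F_has_derivative])
       (use assms A.\<tau>_has_derivative[of c c' "i p"] F_apply[of d p c] in auto)
  then have "(F c' d has_derivative fd (A.\<tau> c c') (snd c (i p)) \<circ> fd (F c d) (snd d p)) (at (snd d p))"
  proof (rule has_derivative_transform_within_open[OF _ open_dom[OF assms(1,3)]])
    show "snd d p \<in> dom c d" using assms by (simp add: domI)
    show "(A.\<tau> c c' \<circ> F c d) y = F c' d y" if "y \<in> dom c d" for y
      by (rule domE[OF that assms(3)]) (simp add: F_def assms(1))
  qed
  then show ?thesis by (simp add: frechet_derivative_eq)
qed

lemma dF_change_source:
  assumes "c \<in> A" "d \<in> B" "d' \<in> B" "p \<in> fst d" "p \<in> fst d'" "i p \<in> fst c"
  shows "fd (F c d) (snd d p) u = fd (F c d') (snd d' p) (fd (B.\<tau> d d') (snd d p) u)"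
proof -
  have "(F c d' \<circ> B.\<tau> d d' has_derivative fd (F c d') (snd d' p) \<circ> fd (B.\<tau> d d') (snd d p)) (at (snd d p))"
    by (rule diff_chain_at[OF B.\<tau>_has_derivative]) (use assms F_has_derivative[of c d' p] in auto)
  then have "(F c d has_derivative fd (F c d') (snd d' p) \<circ> fd (B.\<tau> d d') (snd d p)) (at (snd d p))"
    by (rule has_derivative_transform_within_open[OF _ B.open_\<tau>_domain[OF assms(2,3)]])
       (use assms in \<open>auto simp: F_def\<close>)
  then show ?thesis by (simp add: frechet_derivative_eq)
qed

text \<open>\<open>differential\<close> is defined with a chosen chart of the source; the chain rule
  makes every other chart available.\<close>

lemma di_apply:
  assumes c: "c \<in> A" "i p \<in> fst c" and d: "d \<in> B" "p \<in> fst d" and v: "v \<in> tangent_space B p"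
  shows "di p v c = fd (F c d) (snd d p) (v d)"
proof -
  let ?d = "chart_at B p"
  have d0: "?d \<in> B" "p \<in> fst ?d" using B.chart_at[OF points_B[OF d]] by auto
  have "di p v c = fd (F c ?d) (snd ?d p) (v ?d)"
    using c by (simp add: differential_def A.charts_at_iff Let_def F_def)
  also have "v ?d = fd (B.\<tau> d ?d) (snd d p) (v d)" by (rule B.tangent_spaceD[OF v d d0])
  also have "fd (F c ?d) (snd ?d p) (fd (B.\<tau> d ?d) (snd d p) (v d)) = fd (F c d) (snd d p) (v d)"
    using dF_change_source[OF c(1) d(1) d0(1) d(2) d0(2) c(2)] by simp
  finally show ?thesis .
qed

lemma di_outside: "c \<notin> charts_at A (i p) \<Longrightarrow> di p v c = 0"
  by (simp add: differential_def)

lemma di_in: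
  assumes p: "p \<in> points B" and v: "v \<in> tangent_space B p"
  shows "di p v \<in> tangent_space A (i p)"
  unfolding tangent_space_def mem_Collect_eq
proof (intro conjI allI ballI impI)
  let ?d = "chart_at B p"
  note d = B.chart_at[OF p]
  show "di p v c = 0" if "c \<notin> charts_at A (i p)" for c using that by (rule di_outside)
  fix c c' assume "c \<in> charts_at A (i p)" "c' \<in> charts_at A (i p)"
  then have c: "c \<in> A" "i p \<in> fst c" and c': "c' \<in> A" "i p \<in> fst c'" by (simp_all add: A.charts_at_iff)
  show "di p v c' = fd (A.\<tau> c c') (snd c (i p)) (di p v c)"
    using di_apply[OF c d v] di_apply[OF c' d v] dF_change_target[OF c(1) c'(1) d c(2) c'(2)] by simp
qed

lemma di_eqI:
  assumes "p \<in> points B" "v \<in> tangent_space B p" "w \<in> tangent_space A (i p)"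
    and "c \<in> A" "i p \<in> fst c" "d \<in> B" "p \<in> fst d" "w c = fd (F c d) (snd d p) (v d)"
  shows "di p v = w"
  using A.tangent_space_eqI[OF di_in[OF assms(1,2)] assms(3-5)] di_apply[OF assms(4-7,2)] assms(8) by simp

lemma linear_dF:
  assumes "c \<in> A" "d \<in> B" "p \<in> fst d" "i p \<in> fst c"
  shows "linear (fd (F c d) (snd d p))"
  using F_has_derivative[OF assms] by (rule has_derivative_linear)

lemma di_combination:
  assumes p: "p \<in> points B" and u: "u \<in> tangent_space B p" and v: "v \<in> tangent_space B p"
  shows "di p (a *\<^sub>R u + b *\<^sub>R v) = a *\<^sub>R di p u + b *\<^sub>R di p v"
proof -
  note c = A.chart_at[OF i_in(1)[OF p]] and d = B.chart_at[OF p]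
  note sA = A.subspace_tangent_space[of "i p"] and sB = B.subspace_tangent_space[of p]
  show ?thesis
    by (rule di_eqI[OF p _ _ c d])
       (auto intro!: subspace_add[OF sA] subspace_scale[OF sA] subspace_add[OF sB] subspace_scale[OF sB] di_in p u v
        simp: scaleR_fun_apply di_apply[OF c d u] di_apply[OF c d v] linear_add[OF linear_dF[OF c(1) d c(2)]] linear_cmul[OF linear_dF[OF c(1) d c(2)]])
qed

lemma di_inj: "p \<in> points B \<Longrightarrow> inj_on (di p) (tangent_space B p)"
  using hypersurface by (simp add: hypersurface_def)

text \<open>The chart is cut down to \<open>U\<close>, the set on which the rigging is smooth; the
  image of the hypersurface lies in it.\<close>

lemma flow_coords:
  assumes c: "c \<in> A" and d: "d \<in> B"
  shows "flow_coords (snd c ` (U \<inter> fst c)) (metric_in_chart A g c) (dom c d) (F c d) (\<xi>c d)"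
proof -
  interpret metric_coords "snd c ` (U \<inter> fst c)" "metric_in_chart A g c"
    by (rule metric_coords_subset[OF lorentzian_metric_coords[OF lorentzian c] A.open_chart_Int[OF c open_U]]) auto
  have "smooth_on (snd d ` (points B \<inter> fst d)) (\<xi>c d)"
    using rigged_vector_field d by (simp add: rigged_vector_field_def smooth_vector_field_def \<xi>c_def[abs_def])
  then have \<xi>: "diff_on 3 (snd d ` (points B \<inter> fst d)) (\<xi>c d)" by (rule smooth_on_imp_diff_on)
  show ?thesis
  proof unfold_locales
    show "open (dom c d)" by (rule open_dom[OF c d])
    show "diff_on 4 (dom c d) (F c d)" by (rule diff_on_F[OF c d])
    show "diff_on 3 (dom c d) (\<xi>c d)"
      by (rule diff_on_subset[OF \<xi>]) (use points_B[OF d] in \<open>auto simp: dom_def\<close>)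
    show "F c d ` dom c d \<subseteq> snd c ` (U \<inter> fst c)"
      using d points_B[OF d] i_in by (auto simp: dom_def F_def)
  qed
qed

lemma X_apply:
  assumes "c \<in> A" "d \<in> B" "p \<in> fst d" "i p \<in> fst c"
  shows "flow_coords.X (F c d) (\<xi>c d) (snd d p) = di p (\<xi> p) c"
  using di_apply[OF assms(1,4,2,3) \<xi>_in[OF points_B[OF assms(2,3)]]] assms
  by (simp add: flow_coords.X_def[OF flow_coords[OF assms(1,2)]] \<xi>c_def)

text \<open>\<open>cov_deriv_map\<close> uses a chosen chart of the hypersurface. The derivative of
  X along \<xi> is moved to the chart \<open>d\<close> by the chain rule and the transformation law
  of \<xi>.\<close>

lemma geodesic_coords:
  assumes c: "c \<in> A" and d: "d \<in> B" and p: "p \<in> fst d" "i p \<in> fst c"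
  shows "fd (flow_coords.X (F c d) (\<xi>c d)) (snd d p) (\<xi>c d (snd d p))
     + chris (metric_in_chart A g c) (F c d (snd d p)) (flow_coords.X (F c d) (\<xi>c d) (snd d p))
         (flow_coords.X (F c d) (\<xi>c d) (snd d p)) = 0"
proof -
  let ?d = "chart_at B p" and ?Y = "\<lambda>q. di q (\<xi> q)"
  note pB = points_B[OF d p(1)]
  note d0 = B.chart_at[OF pB]
  note X = X_apply[OF c d p]
  interpret D: flow_coords "snd c ` (U \<inter> fst c)" "metric_in_chart A g c" "dom c ?d" "F c ?d" "\<xi>c ?d"
    by (rule flow_coords[OF c d0(1)])
  have 0: "cov_deriv_map A g B i ?Y p (\<xi> p) = 0"
    using ambient_geodesic_field pB by (simp add: ambient_geodesic_field_def)
  have Y: "?Y (chart_inv ?d y) c = D.X y" if "y \<in> dom c ?d" for y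
    by (rule domE[OF that d0(1)]) (simp add: X_apply[OF c d0(1)])
  have "fd (\<lambda>y. ?Y (chart_inv ?d y) c) (snd ?d p) = fd D.X (snd ?d p)"
    by (rule frechet_derivative_cong_open[OF D.open_\<Omega>]) (use Y domI d0 p in auto)
  moreover have "cov_deriv_map A g B i ?Y p (\<xi> p) c = fd (\<lambda>y. ?Y (chart_inv ?d y) c) (snd ?d p) (\<xi> p ?d)
      + chris (metric_in_chart A g c) (snd c (i p)) (?Y p c) (?Y p c)"
    using c p by (simp add: cov_deriv_map_def A.charts_at_iff Let_def christoffel_eq)
  ultimately have 1: "fd D.X (snd ?d p) (\<xi> p ?d) + chris (metric_in_chart A g c) (snd c (i p)) (?Y p c) (?Y p c) = 0"
    using 0 by simp
  have "(D.X \<circ> B.\<tau> d ?d has_derivative fd D.X (snd ?d p) \<circ> fd (B.\<tau> d ?d) (snd d p)) (at (snd d p))"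
  proof (rule diff_chain_at[OF B.\<tau>_has_derivative[OF d d0(1) p(1) d0(2)]])
    show "(D.X has_derivative fd D.X (snd ?d p)) (at (B.\<tau> d ?d (snd d p)))"
      using D.X_differentiable[of "snd ?d p"] domI[of p ?d c] d0 p d by (simp add: frechet_derivative_works)
  qed
  then have "(flow_coords.X (F c d) (\<xi>c d) has_derivative fd D.X (snd ?d p) \<circ> fd (B.\<tau> d ?d) (snd d p)) (at (snd d p))"
  proof (rule has_derivative_transform_within_open)
    let ?S = "dom c d \<inter> snd d ` (fst d \<inter> fst ?d)"
    show "open ?S" using open_dom[OF c d] B.open_\<tau>_domain[OF d d0(1)] by blast
    show "snd d p \<in> ?S" using p d0 domI[of p d c] by auto
    fix y assume "y \<in> ?S"
    then obtain q where q: "q \<in> fst d" "y = snd d q" "q \<in> fst ?d" and y: "y \<in> dom c d" by auto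
    have q': "i q \<in> fst c"
    proof (rule domE[OF y d])
      fix p' assume "i p' \<in> fst c" "chart_inv d y = p'"
      then show ?thesis using q d by simp
    qed
    show "(D.X \<circ> B.\<tau> d ?d) y = flow_coords.X (F c d) (\<xi>c d) y"
      using X_apply[OF c d q(1) q'] X_apply[OF c d0(1) q(3) q'] q d by simp
  qed
  then have "fd (flow_coords.X (F c d) (\<xi>c d)) (snd d p) (\<xi> p d) = fd D.X (snd ?d p) (\<xi> p ?d)"
    using B.tangent_spaceD[OF \<xi>_in[OF pB] d p(1) d0] by (simp add: frechet_derivative_eq)
  then show ?thesis using 1 X d p by (simp add: \<xi>c_def F_apply)
qed

definition \<omega>c :: "('b, 'f) chart \<Rightarrow> 'f \<Rightarrow> 'f \<Rightarrow> real" where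
  "\<omega>c d = form1_in_chart B \<omega> d"

lemma \<omega>c_apply: "d \<in> B \<Longrightarrow> p \<in> fst d \<Longrightarrow> v \<in> tangent_space B p \<Longrightarrow> \<omega>c d (snd d p) (v d) = \<omega> p v"
  by (simp add: \<omega>c_def form1_in_chart_def B.tangent_vector_eq)

lemma di_tangent_vector:
  assumes "c \<in> A" "d \<in> B" "p \<in> fst d" "i p \<in> fst c"
  shows "di p (tangent_vector B d p u) c = fd (F c d) (snd d p) u"
  using di_apply[OF assms(1,4,2,3) B.tangent_vector_in[OF assms(2,3)]] B.tangent_vector_self[OF assms(2,3)] by simp

lemma g_coords:
  assumes "c \<in> A" "q \<in> fst c" "u \<in> tangent_space A q" "v \<in> tangent_space A q"
  shows "g q u v = metric_in_chart A g c (snd c q) (u c) (v c)"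
  using A.metric_in_chart_eq[OF assms] by simp

lemma \<omega>c_eq:
  assumes c: "c \<in> A" and d: "d \<in> B" and p: "p \<in> fst d" "i p \<in> fst c"
  shows "\<omega>c d (snd d p) v = metric_in_chart A g c (F c d (snd d p)) (Z c (F c d (snd d p))) (fd (F c d) (snd d p) v)"
proof -
  note pB = points_B[OF d p(1)]
  have "\<omega>c d (snd d p) v = g (i p) (\<zeta> (i p)) (di p (tangent_vector B d p v))"
    using d p by (simp add: \<omega>c_def form1_in_chart_def rigged_form_def rigging_form_def)
  also have "\<dots> = metric_in_chart A g c (snd c (i p)) (\<zeta> (i p) c) (di p (tangent_vector B d p v) c)"
    by (rule g_coords[OF c p(2) \<zeta>_in[OF i_in(2)[OF pB]] di_in[OF pB B.tangent_vector_in[OF d p(1)]]])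
  finally show ?thesis
    using c d p by (simp add: F_apply Z_def di_tangent_vector)
qed

lemma gt_coords:
  assumes c: "c \<in> A" and d: "d \<in> B" and p: "p \<in> fst d" "i p \<in> fst c"
  shows "metric_in_chart B gt d (snd d p) u v = metric_in_chart A g c (F c d (snd d p)) (fd (F c d) (snd d p) u) (fd (F c d) (snd d p) v)
     + \<omega>c d (snd d p) u * \<omega>c d (snd d p) v"
proof -
  note pB = points_B[OF d p(1)]
  note tv = di_in[OF pB B.tangent_vector_in[OF d p(1)]]
  show ?thesis
    using d p g_coords[OF c p(2) tv tv, of u v]
    by (simp add: metric_in_chart_def[of B] rigged_metric_def pullback_metric_def \<omega>c_def form1_in_chart_def
        di_tangent_vector[OF c d p] F_apply)
qed

text \<open>\<open>d\<omega> = i\<^sup>*d\<alpha>\<close>, evaluated in the chart of \<open>A\<close> used by the exterior derivative.\<close>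

lemma \<omega>c_closed:
  assumes d: "d \<in> B" and p: "p \<in> fst d"
  shows "fd (\<lambda>z. \<omega>c d z v) (snd d p) u = fd (\<lambda>z. \<omega>c d z u) (snd d p) v"
proof -
  note pB = points_B[OF d p]
  let ?c = "chart_at A (i p)"
  note c = A.chart_at[OF i_in(1)[OF pB]]
  let ?S = "snd ?c ` (U \<inter> fst ?c)" and ?\<Omega> = "dom ?c d" and ?y = "snd d p"
  let ?F = "F ?c d" and ?G = "metric_in_chart A g ?c"
  define \<alpha> where "\<alpha> = form1_in_chart A (rigging_form g \<zeta>) ?c"
  interpret flow_coords ?S ?G ?\<Omega> ?F "\<xi>c d" by (rule flow_coords[OF c(1) d])
  have y: "?y \<in> ?\<Omega>" using p c by (simp add: domI)
  have \<alpha>: "\<alpha> x v = ?G x (Z ?c x) v" if x: "x \<in> ?S" for x v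
  proof -
    obtain q where q: "q \<in> U" "q \<in> fst ?c" "x = snd ?c q" using x by auto
    show ?thesis
      using c q A.tangent_vector_eq[OF \<zeta>_in[OF q(1)] c(1) q(2)]
      by (simp add: \<alpha>_def form1_in_chart_def rigging_form_def metric_in_chart_def Z_def)
  qed
  have lin\<alpha>: "linear (\<alpha> x)" if "x \<in> ?S" for x
    using bilinear_linear2[OF bilinear_G[OF that], of "Z ?c x"] \<alpha>[OF that] by (simp add: linear_iff)
  have dZ: "diff_on 3 ?S (Z ?c)"
    using closed_rigging c(1) unfolding closed_rigging_def rigging_def smooth_vector_field_def Z_def[abs_def]
    by (auto intro: smooth_on_imp_diff_on)
  have d\<alpha>: "(\<lambda>x. \<alpha> x v) differentiable at x" if "x \<in> ?S" for x v
  proof -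
    have "diff_on 3 ?S (\<lambda>x. ?G x (Z ?c x) v)"
      by (rule diff_on_apply2[OF open_S bilinear_G diff_on_G dZ diff_on_const])
    then have "diff_on 3 ?S (\<lambda>x. \<alpha> x v)" by (subst diff_on_cong[OF open_S \<alpha>])
    from diff_onD[OF this _ that] show ?thesis by (auto simp: differentiable_def)
  qed
  have Fy: "?F ?y \<in> ?S" by (rule F_in[OF y])
  have D: "fd (\<lambda>z. \<omega>c d z v) ?y u = fd (\<lambda>x. \<alpha> x (fd ?F ?y v)) (?F ?y) (fd ?F ?y u) + \<alpha> (?F ?y) (fd (\<lambda>z. fd ?F z v) ?y u)" for u v
  proof -
    have "((\<lambda>z. \<alpha> (?F z) (fd ?F z v)) has_derivative (\<lambda>h. fd (\<lambda>x. \<alpha> x (fd ?F ?y v)) (?F ?y) (fd ?F ?y h)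
        + \<alpha> (?F ?y) (fd (\<lambda>z. fd ?F z v) ?y h))) (at ?y within ?\<Omega>)"
      by (rule has_derivative_family_apply[OF open_S lin\<alpha> d\<alpha>[OF Fy] F_image y
            has_derivative_within_\<Omega>[OF F_differentiable[OF y] y] has_derivative_within_\<Omega>[OF dF_differentiable[OF y] y]])
    then have "((\<lambda>z. \<omega>c d z v) has_derivative (\<lambda>h. fd (\<lambda>x. \<alpha> x (fd ?F ?y v)) (?F ?y) (fd ?F ?y h)
        + \<alpha> (?F ?y) (fd (\<lambda>z. fd ?F z v) ?y h))) (at ?y within ?\<Omega>)"
    proof (rule has_derivative_transform[OF y, rotated])
      fix z assume z: "z \<in> ?\<Omega>"
      show "\<omega>c d z v = \<alpha> (?F z) (fd ?F z v)"
        unfolding \<alpha>[OF F_in[OF z]] by (rule domE[OF z d]) (simp add: \<omega>c_eq[OF c(1) d])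
    qed
    then show ?thesis unfolding at_within_open[OF y open_\<Omega>] by (simp add: frechet_derivative_eq)
  qed
  have closed: "fd (\<lambda>x. \<alpha> x b) (?F ?y) a = fd (\<lambda>x. \<alpha> x a) (?F ?y) b" for a b
  proof -
    have "exterior_derivative A (rigging_form g \<zeta>) (i p) (tangent_vector A ?c (i p) a) (tangent_vector A ?c (i p) b) = 0"
      using closed_rigging i_in(2)[OF pB] A.tangent_vector_in[OF c] by (simp add: closed_rigging_def)
    then show ?thesis
      by (simp add: exterior_derivative_def Let_def A.tangent_vector_self[OF c] \<alpha>_def F_apply[OF d p])
  qed
  \<comment> \<open>Both terms of \<open>D\<close> are symmetric in \<open>u\<close> and
    \<open>v\<close>: the first since the rigging form is closed, the second as a second derivative
    of \<open>F\<close>.\<close>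
  show ?thesis unfolding D closed[of "fd ?F ?y v"] ddF_sym[OF y, of v] ..
qed

lemma rigged_coords:
  assumes c: "c \<in> A" and d: "d \<in> B"
    and y: "y ` N \<subseteq> dom c d" "\<And>t. t \<in> N \<Longrightarrow> (y has_vector_derivative \<xi>c d (y t)) (at t within N)"
    and N: "\<And>t. t \<in> N \<Longrightarrow> at t within N \<noteq> bot"
  shows "rigged_coords (snd c ` (U \<inter> fst c)) (metric_in_chart A g c) (dom c d) (F c d) (\<xi>c d) N y (Z c) (\<omega>c d)
     (metric_in_chart B gt d)"
proof -
  let ?G = "metric_in_chart A g c" and ?F = "F c d"
  interpret flow_coords "snd c ` (U \<inter> fst c)" ?G "dom c d" ?F "\<xi>c d" by (rule flow_coords[OF c d])
  show ?thesis
  proof unfold_locales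
    show "y ` N \<subseteq> dom c d" by (rule y)
    show "(y has_vector_derivative \<xi>c d (y t)) (at t within N)" if "t \<in> N" for t using y(2) that .
    show "at t within N \<noteq> bot" if "t \<in> N" for t using N that .
    show "DIM('e) = DIM('f) + 1" by (rule dims)
    show "diff_on 3 (snd c ` (U \<inter> fst c)) (Z c)"
      using closed_rigging c(1) unfolding closed_rigging_def rigging_def smooth_vector_field_def Z_def[abs_def]
      by (auto intro: smooth_on_imp_diff_on)
    fix x assume x: "x \<in> dom c d"
    obtain p where p: "p \<in> fst d" "i p \<in> fst c" and xp: "x = snd d p" and pB: "p \<in> points B"
      using domE[OF x d] by metis
    note tvB = B.tangent_vector_in[OF d p(1)]
    note diB = di_tangent_vector[OF c d p]
    show "fd X x (\<xi>c d x) + chris ?G (?F x) (X x) (X x) = 0"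
      unfolding xp by (rule geodesic_coords[OF c d p])
    show "\<omega>c d x v = ?G (?F x) (Z c (?F x)) (fd ?F x v)" for v
      unfolding xp by (rule \<omega>c_eq[OF c d p])
    show "metric_in_chart B gt d x u v = ?G (?F x) (fd ?F x u) (fd ?F x v) + \<omega>c d x u * \<omega>c d x v" for u v
      unfolding xp by (rule gt_coords[OF c d p])
    show "inj (fd ?F x)"
    proof (rule injI)
      fix u v assume "fd ?F x u = fd ?F x v"
      then have "di p (tangent_vector B d p u) = di p (tangent_vector B d p v)"
        by (intro A.tangent_space_eqI[OF di_in[OF pB tvB] di_in[OF pB tvB] c p(2)]) (simp add: diB xp)
      then have "tangent_vector B d p u = tangent_vector B d p v"
        using di_inj[OF pB] tvB by (auto dest: inj_onD)
      then show "u = v" using B.tangent_vector_self[OF d p(1)] by metis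
    qed
    show "Z c (?F x) \<notin> range (fd ?F x)"
    proof
      assume "Z c (?F x) \<in> range (fd ?F x)"
      then obtain v where v: "Z c (?F x) = fd ?F x v" by auto
      have "di p (tangent_vector B d p v) = \<zeta> (i p)"
        by (rule A.tangent_space_eqI[OF di_in[OF pB tvB] \<zeta>_in[OF i_in(2)[OF pB]] c p(2)])
           (use v c d p in \<open>simp add: diB xp F_apply Z_def\<close>)
      moreover have "\<zeta> (i p) \<notin> hypersurface_tangent A B i p"
        using closed_rigging pB by (simp add: closed_rigging_def rigging_def)
      ultimately show False using imageI[OF tvB, of "di p" v] by (simp add: hypersurface_tangent_def)
    qed
    show "\<exists>n. n \<noteq> 0 \<and> (\<forall>w. ?G (?F x) (fd ?F x n) (fd ?F x w) = 0)"
    proof -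
      obtain n where n: "n \<in> tangent_space B p" "n \<noteq> 0" "\<And>w. w \<in> tangent_space B p \<Longrightarrow> pullback_metric A g B i p n w = 0"
        using null_hypersurface pB unfolding null_hypersurface_def by blast
      have "n d \<noteq> 0"
        using B.tangent_space_eqI[OF n(1) subspace_0[OF B.subspace_tangent_space] d p(1)] n(2) by auto
      moreover have "?G (?F x) (fd ?F x (n d)) (fd ?F x w) = 0" for w
        using n(3)[OF tvB, of w] g_coords[OF c p(2) di_in[OF pB n(1)] di_in[OF pB tvB, of w]]
          di_apply[OF c p(2) d p(1) n(1)]
        by (simp add: pullback_metric_def diB xp F_apply[OF d p(1)])
      ultimately show ?thesis by blast
    qed
    show "metric_in_chart B gt d x (\<xi>c d x) w = \<omega>c d x w" for w
    proof -
      have "gt p (\<xi> p) (tangent_vector B d p w) = \<omega> p (tangent_vector B d p w)"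
        using rigged_vector_field pB tvB by (simp add: rigged_vector_field_def)
      then show ?thesis
        using d p B.tangent_vector_eq[OF \<xi>_in[OF pB] d p(1)]
        by (simp add: xp metric_in_chart_def \<omega>c_def form1_in_chart_def \<xi>c_def)
    qed
    show "fd (\<lambda>z. \<omega>c d z v) x u = fd (\<lambda>z. \<omega>c d z u) x v" for u v
      unfolding xp by (rule \<omega>c_closed[OF d p(1)])
  qed
qed

text \<open>With the empty parameter set \<open>N\<close> the conditions on the curve are void.\<close>

lemma rigged_coords_point:
  assumes "c \<in> A" "d \<in> B"
  shows "rigged_coords (snd c ` (U \<inter> fst c)) (metric_in_chart A g c) (dom c d) (F c d) (\<xi>c d) {} y (Z c) (\<omega>c d)
     (metric_in_chart B gt d)"
  by (rule rigged_coords[OF assms]) auto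

text \<open>Around \<open>p\<close> the rigged metric is computed with a chart of the ambient
  manifold at \<open>i p\<close>; non-degeneracy and differentiability come from
  \<open>rigged_coords\<close>.\<close>

sublocale Bt: metric_manifold B gt
proof unfold_locales
  fix d p assume d: "d \<in> B" and p: "p \<in> fst d"
  let ?c = "chart_at A (i p)"
  note c = A.chart_at[OF i_in(1)[OF points_B[OF d p]]]
  interpret R: rigged_coords "snd ?c ` (U \<inter> fst ?c)" "metric_in_chart A g ?c" "dom ?c d" "F ?c d" "\<xi>c d" "{}" undefined
    "Z ?c" "\<omega>c d" "metric_in_chart B gt d"
    by (rule rigged_coords_point[OF c(1) d])
  show "\<exists>S. snd d p \<in> S \<and> metric_coords S (metric_in_chart B gt d)"
    using R.B.metric_coords_axioms domI[OF p c(2)] by blast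
qed

end

section \<open>Jacobi fields of the two metrics\<close>

lemma cjac_cong:
  assumes "\<And>t. t \<in> N \<Longrightarrow> x t = y t" "\<And>t. t \<in> N \<Longrightarrow> x' t = y' t" "\<And>t. t \<in> N \<Longrightarrow> J t = V t"
  shows "cjac G N x x' J \<longleftrightarrow> cjac G N y y' V"
proof -
  have "(J has_vector_derivative D) (at t within N) \<longleftrightarrow> (V has_vector_derivative D) (at t within N)" if "t \<in> N" for t D
    using has_vector_derivative_transform[OF that, of J V] has_vector_derivative_transform[OF that, of V J] assms(3) by auto
  then show ?thesis unfolding cjac_def using assms by simp
qed

section \<open>Linear combinations of Jacobi fields\<close>

lemma (in metric_coords) curv_linear:
  assumes x: "x \<in> S"
  shows "linear (\<lambda>u. curv (chris G) x u v w)"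
proof -
  note \<Gamma> = bilinear_chris[OF x]
  have 1: "linear (\<lambda>u. fd (\<lambda>y. chris G y v w) x u)"
    by (rule linear_frechet_derivative[OF chris_differentiable[OF x]])
  have 2: "linear (\<lambda>u. fd (\<lambda>y. chris G y u w) x v)"
    by (rule frechet_derivative_linear_family[OF open_S x bilinear_linear1[OF bilinear_chris] chris_differentiable[OF x]])
  show ?thesis
    unfolding curv_def
    by (rule linearI)
       (simp_all add: linear_add[OF 1] linear_add[OF 2] linear_cmul[OF 1] linear_cmul[OF 2]
         bilinear_ladd[OF \<Gamma>] bilinear_lmul[OF \<Gamma>] bilinear_radd[OF \<Gamma>] bilinear_rmul[OF \<Gamma>] algebra_simps)
qed

lemma (in metric_coords) cjac_combination:
  assumes J1: "cjac G N x x' J1" and J2: "cjac G N x x' J2" and x: "x ` N \<subseteq> S"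
  shows "cjac G N x x' (\<lambda>t. a *\<^sub>R J1 t + b *\<^sub>R J2 t)"
proof -
  obtain P1 Q1 where 1: "\<forall>t\<in>N. (J1 has_vector_derivative P1 t - chris G (x t) (x' t) (J1 t)) (at t within N) \<and>
     (P1 has_vector_derivative Q1 t - chris G (x t) (x' t) (P1 t)) (at t within N) \<and>
     Q1 t + curv (chris G) (x t) (J1 t) (x' t) (x' t) = 0"
    using J1 unfolding cjac_def by (elim exE) (rule that)
  obtain P2 Q2 where 2: "\<forall>t\<in>N. (J2 has_vector_derivative P2 t - chris G (x t) (x' t) (J2 t)) (at t within N) \<and>
     (P2 has_vector_derivative Q2 t - chris G (x t) (x' t) (P2 t)) (at t within N) \<and>
     Q2 t + curv (chris G) (x t) (J2 t) (x' t) (x' t) = 0"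
    using J2 unfolding cjac_def by (elim exE) (rule that)
  have scale: "((\<lambda>t. r *\<^sub>R f t) has_vector_derivative r *\<^sub>R f') (at t within N)"
    if "(f has_vector_derivative f') (at t within N)" for r :: real and f :: "real \<Rightarrow> 'e" and f' t
    using has_vector_derivative_scaleR_real[OF has_vector_derivative_const that, of r] by simp
  show ?thesis
    unfolding cjac_def
  proof (rule exI[of _ "\<lambda>t. a *\<^sub>R P1 t + b *\<^sub>R P2 t"], rule exI[of _ "\<lambda>t. a *\<^sub>R Q1 t + b *\<^sub>R Q2 t"], intro ballI conjI)
    fix t assume t: "t \<in> N"
    then have xt: "x t \<in> S" using x by auto
    note \<Gamma> = bilinear_chris[OF xt] and R = curv_linear[OF xt]
    show "((\<lambda>t. a *\<^sub>R J1 t + b *\<^sub>R J2 t) has_vector_derivative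
       a *\<^sub>R P1 t + b *\<^sub>R P2 t - chris G (x t) (x' t) (a *\<^sub>R J1 t + b *\<^sub>R J2 t)) (at t within N)"
      by (rule has_vector_derivative_eq_rhs[OF has_vector_derivative_add[OF scale[of J1 "P1 t - chris G (x t) (x' t) (J1 t)" t a]
             scale[of J2 "P2 t - chris G (x t) (x' t) (J2 t)" t b]]])
         (use 1 2 t in \<open>simp_all add: bilinear_radd[OF \<Gamma>] bilinear_rmul[OF \<Gamma>] algebra_simps\<close>)
    show "((\<lambda>t. a *\<^sub>R P1 t + b *\<^sub>R P2 t) has_vector_derivative
       a *\<^sub>R Q1 t + b *\<^sub>R Q2 t - chris G (x t) (x' t) (a *\<^sub>R P1 t + b *\<^sub>R P2 t)) (at t within N)"
      by (rule has_vector_derivative_eq_rhs[OF has_vector_derivative_add[OF scale[of P1 "Q1 t - chris G (x t) (x' t) (P1 t)" t a]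
             scale[of P2 "Q2 t - chris G (x t) (x' t) (P2 t)" t b]]])
         (use 1 2 t in \<open>simp_all add: bilinear_radd[OF \<Gamma>] bilinear_rmul[OF \<Gamma>] algebra_simps\<close>)
    have "Q1 t = - curv (chris G) (x t) (J1 t) (x' t) (x' t)" "Q2 t = - curv (chris G) (x t) (J2 t) (x' t) (x' t)"
      using 1 2 t by (simp_all add: eq_neg_iff_add_eq_0)
    then show "a *\<^sub>R Q1 t + b *\<^sub>R Q2 t + curv (chris G) (x t) (a *\<^sub>R J1 t + b *\<^sub>R J2 t) (x' t) (x' t) = 0"
      by (simp add: linear_add[OF R] linear_cmul[OF R])
  qed
qed

context metric_manifold_curve
begin

lemma jacobi_fieldD:
  assumes "jacobi_field A g I \<gamma> J"
  shows "t \<notin> I \<Longrightarrow> J t = 0" "t \<in> I \<Longrightarrow> J t \<in> tangent_space A (\<gamma> t)"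
  using assms by (simp_all add: jacobi_field_def differentiable_field_along_def)

lemma chart_neighbourhood:
  assumes t: "t \<in> I" and c: "c \<in> A" "\<gamma> t \<in> fst c"
  obtains S T where "metric_coords S (metric_in_chart A g c)" "open T" "t \<in> T"
    "\<gamma> ` (I \<inter> T) \<subseteq> fst c" "(\<lambda>s. snd c (\<gamma> s)) ` (I \<inter> T) \<subseteq> S"
proof -
  have "\<exists>S. snd c (\<gamma> t) \<in> S \<and> metric_coords S (metric_in_chart A g c)" by (rule local_metric_coords[OF c])
  then obtain S where S: "snd c (\<gamma> t) \<in> S" "metric_coords S (metric_in_chart A g c)"
    by (elim exE conjE) (rule that)
  have "open (fst c \<inter> snd c -` S)"
    using chart_homeomorphism[OF c(1)] open_chart[OF c(1)] metric_coords.open_S[OF S(2)]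
    by (auto simp: homeomorphism_def intro: continuous_open_preimage)
  from preimage_relatively_open[OF this]
  obtain T where T: "open T" "{s \<in> I. \<gamma> s \<in> fst c \<inter> snd c -` S} = I \<inter> T" .
  have "\<gamma> ` (I \<inter> T) \<subseteq> fst c" "(\<lambda>s. snd c (\<gamma> s)) ` (I \<inter> T) \<subseteq> S" using T(2)[symmetric] by auto
  moreover have "t \<in> T" using T(2) t c S(1) by auto
  ultimately show thesis using that S(2) T(1) by blast
qed

lemma jacobi_field_0: "jacobi_field A g I \<gamma> 0"
proof (rule jacobi_fieldI)
  show "0 t \<in> tangent_space A (\<gamma> t)" for t using subspace_0[OF subspace_tangent_space] by simp
  fix t c assume t: "t \<in> I" and c: "c \<in> A" "\<gamma> t \<in> fst c"
  obtain S T where S: "metric_coords S (metric_in_chart A g c)" and T: "open T" "t \<in> T"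
    "\<gamma> ` (I \<inter> T) \<subseteq> fst c" "(\<lambda>s. snd c (\<gamma> s)) ` (I \<inter> T) \<subseteq> S"
    using chart_neighbourhood[OF t c] .
  interpret metric_coords S "metric_in_chart A g c" by (rule S)
  have "chart_jacobi c (I \<inter> T) 0"
    unfolding chart_jacobi_def cjac_def
  proof (rule exI[of _ "\<lambda>_. 0"], rule exI[of _ "\<lambda>_. 0"], rule ballI)
    fix s assume "s \<in> I \<inter> T"
    then have "snd c (\<gamma> s) \<in> S" using T(4) by auto
    then show "((\<lambda>t. 0 t c) has_vector_derivative 0 - \<Gamma> c (snd c (\<gamma> s)) (velocity A I \<gamma> s c) (0 s c)) (at s within I \<inter> T) \<and>
      ((\<lambda>_. 0) has_vector_derivative 0 - \<Gamma> c (snd c (\<gamma> s)) (velocity A I \<gamma> s c) 0) (at s within I \<inter> T) \<and>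
      0 + curv (\<Gamma> c) (snd c (\<gamma> s)) (0 s c) (velocity A I \<gamma> s c) (velocity A I \<gamma> s c) = 0"
      by (simp add: bilinear_rzero[OF bilinear_chris] linear_0[OF curv_linear])
  qed
  then show "\<exists>T. open T \<and> t \<in> T \<and> \<gamma> ` (I \<inter> T) \<subseteq> fst c \<and> chart_jacobi c (I \<inter> T) 0"
    using T by blast
qed simp

lemma jacobi_field_combination:
  assumes J1: "jacobi_field A g I \<gamma> J1" and J2: "jacobi_field A g I \<gamma> J2"
  shows "jacobi_field A g I \<gamma> (a *\<^sub>R J1 + b *\<^sub>R J2)"
proof (rule jacobi_fieldI)
  note D = jacobi_fieldD[OF J1] jacobi_fieldD[OF J2]
  show "(a *\<^sub>R J1 + b *\<^sub>R J2) t = 0" if "t \<notin> I" for t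
    using D(1,3)[OF that] by (simp add: scaleR_fun_apply)
  show "(a *\<^sub>R J1 + b *\<^sub>R J2) t \<in> tangent_space A (\<gamma> t)" if "t \<in> I" for t
    using subspace_add[OF subspace_tangent_space subspace_scale[OF subspace_tangent_space D(2)[OF that]]
        subspace_scale[OF subspace_tangent_space D(4)[OF that]]] by (simp add: scaleR_fun_apply)
  fix t c assume t: "t \<in> I" and c: "c \<in> A" "\<gamma> t \<in> fst c"
  obtain S T where S: "metric_coords S (metric_in_chart A g c)" and T: "open T" "t \<in> T"
    and N: "\<gamma> ` (I \<inter> T) \<subseteq> fst c" "(\<lambda>s. snd c (\<gamma> s)) ` (I \<inter> T) \<subseteq> S"
    using chart_neighbourhood[OF t c] .
  interpret metric_coords S "metric_in_chart A g c" by (rule S)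
  have "chart_jacobi c (I \<inter> T) (a *\<^sub>R J1 + b *\<^sub>R J2)"
    using cjac_combination[OF jacobi_field_imp_chart_jacobi[OF J1 c(1) Int_lower1 N(1), unfolded chart_jacobi_def]
        jacobi_field_imp_chart_jacobi[OF J2 c(1) Int_lower1 N(1), unfolded chart_jacobi_def] N(2), of a b]
    by (simp add: chart_jacobi_def scaleR_fun_apply)
  then show "\<exists>T. open T \<and> t \<in> T \<and> \<gamma> ` (I \<inter> T) \<subseteq> fst c \<and> chart_jacobi c (I \<inter> T) (a *\<^sub>R J1 + b *\<^sub>R J2)"
    using T N(1) by blast
qed

end

section \<open>Boundary value problems on an interval\<close>

lemma second_derivative_zero_imp_zero:
  fixes q :: "real \<Rightarrow> real"
  assumes a: "a > 0" and q: "q 0 = 0" "q a = 0"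
    and local: "\<And>t. t \<in> {0..a} \<Longrightarrow> \<exists>T r. open T \<and> t \<in> T \<and>
      (\<forall>s\<in>{0..a} \<inter> T. (q has_vector_derivative r s) (at s within {0..a} \<inter> T) \<and>
         (r has_vector_derivative 0) (at s within {0..a} \<inter> T))"
    and t: "t \<in> {0..a}"
  shows "q t = 0"
proof -
  let ?I = "{0..a}"
  define R where "R s = vector_derivative q (at s within ?I)" for s
  have perfect: "at s within ?I \<noteq> bot" if "s \<in> ?I" for s
    using a that by (simp add: trivial_limit_within)
  \<comment> \<open>The derivatives \<open>r\<close> found chart by chart agree with the derivative
    \<open>R\<close> within the whole interval, so they glue; hence \<open>q\<close> is affine on
    all of it.\<close>
  have R: "(q has_vector_derivative R s) (at s within ?I) \<and> (R has_vector_derivative 0) (at s within ?I)" if s: "s \<in> ?I" for s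
  proof -
    obtain T r where T: "open T" "s \<in> T" and r: "\<forall>s\<in>?I \<inter> T. (q has_vector_derivative r s) (at s within ?I \<inter> T) \<and>
         (r has_vector_derivative 0) (at s within ?I \<inter> T)"
      using local[OF s] by (elim exE conjE) (rule that)
    have at: "at u within ?I \<inter> T = at u within ?I" if "u \<in> T" for u
      by (rule at_within_Int_open[OF that T(1)])
    have qr: "(q has_vector_derivative r u) (at u within ?I)" if "u \<in> ?I \<inter> T" for u
      using bspec[OF r that] at[OF IntD2[OF that]] by simp
    have rR: "R u = r u" if "u \<in> ?I \<inter> T" for u
      unfolding R_def using vector_derivative_within[OF perfect qr] that by auto
    have sT: "s \<in> ?I \<inter> T" using s T by simp
    have "(R has_vector_derivative 0) (at s within ?I \<inter> T)"
      by (rule has_vector_derivative_transform[OF sT rR]) (use r sT in auto)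
    then show ?thesis using at[OF T(2)] qr[OF sT] rR[OF sT] by simp
  qed
  obtain k where k: "\<And>s. s \<in> ?I \<Longrightarrow> R s = k"
    using has_vector_derivative_zero_constant[of ?I R] R by auto
  have "((\<lambda>s. q s - k * s) has_vector_derivative 0) (at s within ?I)" if "s \<in> ?I" for s
  proof -
    have "(q has_vector_derivative k) (at s within ?I)" using R[OF that] k[OF that] by simp
    then show ?thesis by (auto intro!: derivative_eq_intros simp: has_real_derivative_iff_has_vector_derivative[symmetric])
  qed
  then obtain m where m: "\<And>s. s \<in> ?I \<Longrightarrow> q s - k * s = m"
    using has_vector_derivative_zero_constant[of ?I "\<lambda>s. q s - k * s"] by auto
  have "m = 0" using m[of 0] a q by simp
  moreover have "k = 0" using m[of a] a q \<open>m = 0\<close> by simp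
  ultimately show ?thesis using m[OF t] by simp
qed

lemma dirichlet_problem:
  fixes \<kappa> :: "real \<Rightarrow> real"
  assumes a: "a > 0" and \<kappa>: "continuous_on {0..a} \<kappa>"
  obtains f f1 where "\<And>t. t \<in> {0..a} \<Longrightarrow> (f has_vector_derivative f1 t) (at t within {0..a})"
    "\<And>t. t \<in> {0..a} \<Longrightarrow> (f1 has_vector_derivative \<kappa> t) (at t within {0..a})"
    "f 0 = 0" "f a = 0"
proof -
  define h1 where "h1 t = integral {0..t} \<kappa>" for t
  define h where "h t = integral {0..t} h1" for t
  have h1: "(h1 has_vector_derivative \<kappa> t) (at t within {0..a})" if "t \<in> {0..a}" for t
    unfolding h1_def[abs_def] by (rule integral_has_vector_derivative[OF \<kappa> that])
  then have "continuous_on {0..a} h1"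
    by (meson continuous_on_eq_continuous_within has_vector_derivative_continuous)
  then have h: "(h has_vector_derivative h1 t) (at t within {0..a})" if "t \<in> {0..a}" for t
    unfolding h_def[abs_def] by (rule integral_has_vector_derivative[OF _ that])
  show thesis
  \<comment> \<open>The linear term has second derivative 0 and is chosen to cancel the value of
    \<open>h\<close> at \<open>a\<close>.\<close>
  proof (rule that[of "\<lambda>t. h t - (h a / a) * t" "\<lambda>t. h1 t - h a / a"])
    fix t assume "t \<in> {0..a}"
    note t = this
    have "((\<lambda>t. (h a / a) * t) has_vector_derivative h a / a) (at t within {0..a})"
      by (rule has_vector_derivative_eq_rhs[OF has_vector_derivative_mult_right[OF has_vector_derivative_id]]) simp
    from has_vector_derivative_diff[OF h[OF t] this]
    show "((\<lambda>t. h t - (h a / a) * t) has_vector_derivative h1 t - h a / a) (at t within {0..a})" .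
    show "((\<lambda>t. h1 t - h a / a) has_vector_derivative \<kappa> t) (at t within {0..a})"
      using has_vector_derivative_diff[OF h1[OF t] has_vector_derivative_const] by simp
  qed (use a in \<open>auto simp: h_def\<close>)
qed

text \<open>Meant for the screen projection, which is linear only on tangent fields. On
  \<open>S\<close> it agrees with the globally linear map obtained by extending its values on a
  basis of \<open>S\<close>.\<close>

lemma dim_image_eq_on:
  fixes f :: "'v::real_vector \<Rightarrow> 'w::real_vector"
  assumes S: "subspace S" and inj: "inj_on f S"
    and lin: "\<And>a b x y. x \<in> S \<Longrightarrow> y \<in> S \<Longrightarrow> f (a *\<^sub>R x + b *\<^sub>R y) = a *\<^sub>R f x + b *\<^sub>R f y"
  shows "dim (f ` S) = dim S"
proof -
  obtain b where b: "b \<subseteq> S" "independent b" "S \<subseteq> span b" by (rule basis_exists)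
  have sb: "span b = S" using b S by (simp add: span_minimal subset_antisym)
  define h where "h = construct b f"
  have h: "linear h" "\<And>x. x \<in> b \<Longrightarrow> h x = f x"
    unfolding h_def using b(2) by (simp_all add: linear_construct construct_basis)
  have hf: "h x = f x" if "x \<in> S" for x
  proof -
    have "x \<in> span b" using that sb by simp
    then have "x \<in> S \<and> h x = f x"
    proof (induction rule: span_induct_alt)
      case base
      have "f (0 *\<^sub>R 0 + 0 *\<^sub>R 0) = 0" using lin[of 0 0 0 0] subspace_0[OF S] by simp
      then show ?case using subspace_0[OF S] linear_0[OF h(1)] by simp
    next
      case (step c x y)
      then have "x \<in> S" "y \<in> S" using b by auto
      then show ?case
        using lin[of x y c 1] h(2)[OF step(1)] step subspace_add[OF S subspace_scale[OF S]]
        by (simp add: linear_add[OF h(1)] linear_cmul[OF h(1)])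
    qed
    then show ?thesis by simp
  qed
  have injh: "inj_on h (span b)" unfolding sb using inj hf by (simp add: inj_on_def)
  have "span (h ` b) = f ` S"
    using linear_span_image[OF h(1), of b] hf by (simp add: sb)
  then have "span (h ` b) = span (f ` S)" by (metis span_span)
  then have "dim (f ` S) = card (h ` b)"
    by (rule dim_eq_card[OF _ linear_independent_injective_image[OF h(1) b(2) injh]])
  also have "\<dots> = card b" by (rule card_image[OF inj_on_subset[OF injh span_superset]])
  also have "\<dots> = dim S"
    by (rule dim_eq_card[OF _ b(2), symmetric]) (use sb S in \<open>simp add: span_eq_iff[THEN iffD2]\<close>)
  finally show ?thesis .
qed

section \<open>Pointwise algebra of the rigged metric\<close>

context rigged_null_hypersurface
begin

lemma
  assumes p: "p \<in> points B"
  shows \<omega>_combination: "u \<in> tangent_space B p \<Longrightarrow> v \<in> tangent_space B p \<Longrightarrow>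
      \<omega> p (a *\<^sub>R u + b *\<^sub>R v) = a * \<omega> p u + b * \<omega> p v"
    and \<omega>_\<xi>: "\<omega> p (\<xi> p) = 1"
    and gt_combination: "u \<in> tangent_space B p \<Longrightarrow> v \<in> tangent_space B p \<Longrightarrow> w \<in> tangent_space B p \<Longrightarrow>
      gt p (a *\<^sub>R u + b *\<^sub>R v) w = a * gt p u w + b * gt p v w"
    and gt_sym: "u \<in> tangent_space B p \<Longrightarrow> v \<in> tangent_space B p \<Longrightarrow> gt p u v = gt p v u"
    and gt_nondegenerate: "u \<in> tangent_space B p \<Longrightarrow> (\<And>v. v \<in> tangent_space B p \<Longrightarrow> gt p u v = 0) \<Longrightarrow> u = 0"
    and gt_\<xi>: "w \<in> tangent_space B p \<Longrightarrow> gt p (\<xi> p) w = \<omega> p w"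
proof -
  let ?c = "chart_at A (i p)" and ?d = "chart_at B p"
  note c = A.chart_at[OF i_in(1)[OF p]] and d = B.chart_at[OF p]
  note sub = B.subspace_tangent_space[of p]
  interpret R: rigged_coords "snd ?c ` (U \<inter> fst ?c)" "metric_in_chart A g ?c" "dom ?c ?d" "F ?c ?d" "\<xi>c ?d" "{}" undefined
    "Z ?c" "\<omega>c ?d" "metric_in_chart B gt ?d"
    by (rule rigged_coords_point[OF c(1) d(1)])
  have y: "snd ?d p \<in> dom ?c ?d" by (rule domI[OF d(2) c(2)])
  have T: "a *\<^sub>R u + b *\<^sub>R v \<in> tangent_space B p" if "u \<in> tangent_space B p" "v \<in> tangent_space B p" for a b u v
    using that by (intro subspace_add[OF sub] subspace_scale[OF sub])
  have gt: "gt p u v = metric_in_chart B gt ?d (snd ?d p) (u ?d) (v ?d)"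
    if "u \<in> tangent_space B p" "v \<in> tangent_space B p" for u v
    using Bt.metric_in_chart_eq[OF d that] by simp
  note bil = R.bilinear_Gt[OF y]
  show "\<omega> p (a *\<^sub>R u + b *\<^sub>R v) = a * \<omega> p u + b * \<omega> p v" if "u \<in> tangent_space B p" "v \<in> tangent_space B p"
    using \<omega>c_apply[OF d T[OF that], of a b] \<omega>c_apply[OF d that(1)] \<omega>c_apply[OF d that(2)]
    by (simp add: scaleR_fun_apply linear_add[OF R.linear_\<omega>[OF y]] linear_cmul[OF R.linear_\<omega>[OF y]])
  show "\<omega> p (\<xi> p) = 1"
    using R.\<omega>_\<xi>[OF y] \<omega>c_apply[OF d \<xi>_in[OF p]] d by (simp add: \<xi>c_def)
  show "gt p (a *\<^sub>R u + b *\<^sub>R v) w = a * gt p u w + b * gt p v w"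
    if "u \<in> tangent_space B p" "v \<in> tangent_space B p" "w \<in> tangent_space B p"
    unfolding gt[OF T[OF that(1,2)] that(3)] gt[OF that(1,3)] gt[OF that(2,3)]
    by (simp add: scaleR_fun_apply bilinear_ladd[OF bil] bilinear_lmul[OF bil])
  show "gt p u v = gt p v u" if "u \<in> tangent_space B p" "v \<in> tangent_space B p"
    unfolding gt[OF that] gt[OF that(2,1)] by (rule R.Gt_sym[OF y])
  show "u = 0" if u: "u \<in> tangent_space B p" and 0: "\<And>v. v \<in> tangent_space B p \<Longrightarrow> gt p u v = 0"
  proof -
    have "metric_in_chart B gt ?d (snd ?d p) (u ?d) w = 0" for w
      using 0[OF B.tangent_vector_in[OF d, of w]] gt[OF u B.tangent_vector_in[OF d, of w]] B.tangent_vector_self[OF d, of w] by simp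
    then have "u ?d = 0" using R.nondegenerate_Gt[OF y] unfolding nondegenerate_def by blast
    then show ?thesis using B.tangent_space_eqI[OF u subspace_0[OF sub] d] by simp
  qed
  show "gt p (\<xi> p) w = \<omega> p w" if "w \<in> tangent_space B p"
    using rigged_vector_field p that by (simp add: rigged_vector_field_def)
qed

lemma screen_eq: "screen A g B i \<zeta> p = {v \<in> tangent_space B p. \<omega> p v = 0}"
  by (simp add: screen_def rigged_form_def rigging_form_def)

text \<open>For the rigged metric, \<open>\<xi>\<close> is a unit normal of the screen.\<close>

lemma orthogonal_projection_screen:
  assumes p: "p \<in> points B" and v: "v \<in> tangent_space B p"
  shows "orthogonal_projection (gt p) (screen A g B i \<zeta> p) v = v - \<omega> p v *\<^sub>R \<xi> p"
  unfolding orthogonal_projection_def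
proof (rule the_equality)
  note sub = B.subspace_tangent_space[of p] and \<xi> = \<xi>_in[OF p]
  let ?s = "v - \<omega> p v *\<^sub>R \<xi> p"
  have comb: "w - r *\<^sub>R \<xi> p \<in> tangent_space B p" "\<omega> p (w - r *\<^sub>R \<xi> p) = \<omega> p w - r"
    if w: "w \<in> tangent_space B p" for w r
    using subspace_diff[OF sub w subspace_scale[OF sub \<xi>]] \<omega>_combination[OF p w \<xi>, of 1 "- r"] \<omega>_\<xi>[OF p] by simp_all
  show "?s \<in> screen A g B i \<zeta> p \<and> (\<forall>u\<in>screen A g B i \<zeta> p. gt p (v - ?s) u = 0)"
  proof (intro conjI ballI)
    show "?s \<in> screen A g B i \<zeta> p" using comb[OF v] by (simp add: screen_eq)
    show "gt p (v - ?s) u = 0" if "u \<in> screen A g B i \<zeta> p" for u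
      using gt_combination[OF p \<xi> \<xi>, of u "\<omega> p v" 0] gt_\<xi>[OF p, of u] that by (simp add: screen_eq)
  qed
  fix s assume s: "s \<in> screen A g B i \<zeta> p \<and> (\<forall>u\<in>screen A g B i \<zeta> p. gt p (v - s) u = 0)"
  then have sT: "s \<in> tangent_space B p" and \<omega>s: "\<omega> p s = 0" by (simp_all add: screen_eq)
  let ?e = "v - s"
  have eT: "?e \<in> tangent_space B p" by (rule subspace_diff[OF sub v sT])
  have \<omega>e: "\<omega> p ?e = \<omega> p v" using \<omega>_combination[OF p v sT, of 1 "-1"] \<omega>s by simp
  \<comment> \<open>Every \<open>w\<close> is the sum of a screen vector and a multiple of
    \<open>\<xi>\<close>. The vector on the left is orthogonal to both parts, so non-degeneracy
    makes it 0.\<close>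
  have "?e - \<omega> p ?e *\<^sub>R \<xi> p = 0"
  proof (rule gt_nondegenerate[OF p comb(1)[OF eT]])
    fix w assume w: "w \<in> tangent_space B p"
    have 1: "gt p (?e - r *\<^sub>R \<xi> p) w = gt p ?e w - r * \<omega> p w" for r
      using gt_combination[OF p eT \<xi> w, of 1 "- r"] gt_\<xi>[OF p w] by simp
    have "w - \<omega> p w *\<^sub>R \<xi> p \<in> screen A g B i \<zeta> p" using comb[OF w] by (simp add: screen_eq)
    then have "gt p ?e (w - \<omega> p w *\<^sub>R \<xi> p) = 0" using s by blast
    then have "gt p (w - \<omega> p w *\<^sub>R \<xi> p) ?e = 0" using gt_sym[OF p eT comb(1)[OF w]] by simp
    then have "gt p w ?e - \<omega> p w * \<omega> p ?e = 0"
      using gt_combination[OF p w \<xi> eT, of 1 "- \<omega> p w"] gt_\<xi>[OF p eT] by simp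
    then show "gt p (?e - \<omega> p ?e *\<^sub>R \<xi> p) w = 0"
      using 1[of "\<omega> p ?e"] gt_sym[OF p eT w] by (simp add: mult.commute)
  qed
  then show "s = ?s" using \<omega>e by (simp add: algebra_simps)
qed

lemma di_0: "p \<in> points B \<Longrightarrow> di p 0 = 0"
  using di_combination[of p 0 0 0 0] subspace_0[OF B.subspace_tangent_space] by simp

end

section \<open>Jacobi fields along an integral curve of \<xi>\<close>

locale rigged_null_curve = rigged_null_hypersurface A g B i U \<zeta> \<xi>
  for A :: "('a::{second_countable_topology, t2_space}, 'e::euclidean_space) chart set"
    and g :: "('a, 'e) form2"
    and B :: "('b::{second_countable_topology, t2_space}, 'f::euclidean_space) chart set"
    and i U \<zeta> \<xi> +
  fixes I :: "real set" and \<gamma> :: "real \<Rightarrow> 'b"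
  assumes integral_curve: "integral_curve B \<xi> I \<gamma>"
begin

lemma I_perfect:
  assumes "t \<in> I"
  shows "at t within I \<noteq> bot"
proof -
  have I: "is_interval I" "interior I \<noteq> {}" using integral_curve by (simp_all add: integral_curve_def)
  then have "I \<noteq> {x}" for x by auto
  then have "t islimpt I" using I assms by (intro connected_imp_perfect is_interval_connected)
  then show ?thesis by (simp add: trivial_limit_within)
qed

lemma \<gamma>_in: "t \<in> I \<Longrightarrow> \<gamma> t \<in> points B"
  using integral_curve by (auto simp: integral_curve_def)

lemma \<gamma>_deriv:
  assumes "t \<in> I" "d \<in> B" "\<gamma> t \<in> fst d"
  shows "((snd d \<circ> \<gamma>) has_vector_derivative \<xi> (\<gamma> t) d) (at t within I)"
  using integral_curve assms unfolding integral_curve_def by (simp add: B.charts_at_iff)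

lemma velocity_B:
  assumes "t \<in> I" "d \<in> B" "\<gamma> t \<in> fst d"
  shows "velocity B I \<gamma> t d = \<xi> (\<gamma> t) d"
  using vector_derivative_within[OF I_perfect[OF assms(1)] \<gamma>_deriv[OF assms]] assms
  by (simp add: velocity_def B.charts_at_iff)

sublocale Bc: metric_manifold_curve B gt I \<gamma>
proof unfold_locales
  show "at t within I \<noteq> bot" if "t \<in> I" for t by (rule I_perfect[OF that])
  show "continuous_on I \<gamma>" "\<gamma> ` I \<subseteq> points B" using integral_curve by (simp_all add: integral_curve_def)
  show "((snd d \<circ> \<gamma>) has_vector_derivative velocity B I \<gamma> t d) (at t within I)"
    if "t \<in> I" "d \<in> B" "\<gamma> t \<in> fst d" for t d
    using \<gamma>_deriv[OF that] velocity_B[OF that] by simp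
qed

text \<open>The times at which both charts apply. The set is relatively open in \<open>I\<close>, so
  derivatives within it are derivatives within \<open>I\<close>.\<close>

definition N :: "('a, 'e) chart \<Rightarrow> ('b, 'f) chart \<Rightarrow> real set" where
  "N c d = {s \<in> I. \<gamma> s \<in> fst d \<inter> i -` fst c}"

lemma N_iff: "t \<in> N c d \<longleftrightarrow> t \<in> I \<and> \<gamma> t \<in> fst d \<and> i (\<gamma> t) \<in> fst c"
  by (simp add: N_def)

lemma N_D: "t \<in> N c d \<Longrightarrow> t \<in> I" "t \<in> N c d \<Longrightarrow> \<gamma> t \<in> fst d" "t \<in> N c d \<Longrightarrow> i (\<gamma> t) \<in> fst c"
  by (simp_all add: N_def)

lemma N_open:
  assumes "c \<in> A" "d \<in> B"
  obtains T where "open T" "N c d = I \<inter> T"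
  unfolding N_def by (rule Bc.preimage_relatively_open[OF open_preimage[OF assms]])

lemma at_within_N: "c \<in> A \<Longrightarrow> d \<in> B \<Longrightarrow> t \<in> N c d \<Longrightarrow> at t within N c d = at t within I"
  unfolding N_def by (rule Bc.at_within_preimage[OF open_preimage]) auto

lemma \<gamma>_deriv_N:
  assumes "c \<in> A" "d \<in> B" "t \<in> N c d"
  shows "((\<lambda>s. snd d (\<gamma> s)) has_vector_derivative \<xi>c d (snd d (\<gamma> t))) (at t within N c d)"
  using \<gamma>_deriv[of t d] at_within_N[OF assms] assms by (simp add: N_iff o_def \<xi>c_def)

lemma i\<gamma>_deriv:
  assumes t: "t \<in> I" and c: "c \<in> A" "i (\<gamma> t) \<in> fst c"
  shows "((snd c \<circ> (i \<circ> \<gamma>)) has_vector_derivative di (\<gamma> t) (\<xi> (\<gamma> t)) c) (at t within I)"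
proof -
  let ?d = "chart_at B (\<gamma> t)"
  note d = B.chart_at[OF \<gamma>_in[OF t]]
  have tN: "t \<in> N c ?d" using t c d by (simp add: N_iff)
  have "((\<lambda>s. F c ?d (snd ?d (\<gamma> s))) has_vector_derivative fd (F c ?d) (snd ?d (\<gamma> t)) (\<xi>c ?d (snd ?d (\<gamma> t)))) (at t within N c ?d)"
    by (rule has_vector_derivative_compose_at[OF F_has_derivative[OF c(1) d c(2)] \<gamma>_deriv_N[OF c(1) d(1) tN]])
  then have "((snd c \<circ> (i \<circ> \<gamma>)) has_vector_derivative fd (F c ?d) (snd ?d (\<gamma> t)) (\<xi>c ?d (snd ?d (\<gamma> t)))) (at t within N c ?d)"
    by (rule has_vector_derivative_transform[OF tN, rotated]) (simp add: F_apply[OF d(1) N_D(2)])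
  then show ?thesis
    using at_within_N[OF c(1) d(1) tN] di_apply[OF c d \<xi>_in[OF \<gamma>_in[OF t]]] d by (simp add: \<xi>c_def)
qed

lemma velocity_A:
  assumes "t \<in> I" "c \<in> A" "i (\<gamma> t) \<in> fst c"
  shows "velocity A I (i \<circ> \<gamma>) t c = di (\<gamma> t) (\<xi> (\<gamma> t)) c"
  using vector_derivative_within[OF I_perfect[OF assms(1)] i\<gamma>_deriv[OF assms]] assms
  by (simp add: velocity_def A.charts_at_iff)

sublocale Ac: metric_manifold_curve A g I "i \<circ> \<gamma>"
proof unfold_locales
  show "at t within I \<noteq> bot" if "t \<in> I" for t by (rule I_perfect[OF that])
  show "continuous_on I (i \<circ> \<gamma>)"
    by (rule continuous_on_compose[OF Bc.continuous_\<gamma>])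
       (use smooth_i continuous_on_subset Bc.\<gamma>_image in \<open>unfold smooth_map_def, blast\<close>)
  show "(i \<circ> \<gamma>) ` I \<subseteq> points A" using i_in \<gamma>_in by auto
  show "((snd c \<circ> (i \<circ> \<gamma>)) has_vector_derivative velocity A I (i \<circ> \<gamma>) t c) (at t within I)"
    if "t \<in> I" "c \<in> A" "(i \<circ> \<gamma>) t \<in> fst c" for t c
    using i\<gamma>_deriv[OF that(1,2)] velocity_A[OF that(1,2)] that(3) by simp
qed

lemma rigged_curve_coords:
  assumes c: "c \<in> A" and d: "d \<in> B"
  shows "rigged_coords (snd c ` (U \<inter> fst c)) (metric_in_chart A g c) (dom c d) (F c d) (\<xi>c d) (N c d)
     (\<lambda>s. snd d (\<gamma> s)) (Z c) (\<omega>c d) (metric_in_chart B gt d)"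
proof (rule rigged_coords[OF c d])
  show "(\<lambda>s. snd d (\<gamma> s)) ` N c d \<subseteq> dom c d" using domI[OF N_D(2,3)] by blast
  show "((\<lambda>s. snd d (\<gamma> s)) has_vector_derivative \<xi>c d (snd d (\<gamma> t))) (at t within N c d)" if "t \<in> N c d" for t
    by (rule \<gamma>_deriv_N[OF c d that])
  show "at t within N c d \<noteq> bot" if "t \<in> N c d" for t
    using at_within_N[OF c d that] I_perfect[OF N_D(1)[OF that]] by simp
qed

abbreviation Xc :: "('a, 'e) chart \<Rightarrow> ('b, 'f) chart \<Rightarrow> 'f \<Rightarrow> 'e" where
  "Xc c d \<equiv> flow_coords.X (F c d) (\<xi>c d)"

lemma chart_jacobi_A:
  assumes c: "c \<in> A" and d: "d \<in> B"
  shows "Ac.chart_jacobi c (N c d) J \<longleftrightarrow> cjac (metric_in_chart A g c) (N c d)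
    (\<lambda>t. F c d (snd d (\<gamma> t))) (\<lambda>t. Xc c d (snd d (\<gamma> t))) (\<lambda>t. J t c)"
  unfolding Ac.chart_jacobi_def
proof (rule cjac_cong)
  fix t assume t: "t \<in> N c d"
  show "snd c ((i \<circ> \<gamma>) t) = F c d (snd d (\<gamma> t))" using F_apply[OF d N_D(2)[OF t]] by simp
  show "velocity A I (i \<circ> \<gamma>) t c = Xc c d (snd d (\<gamma> t))"
    using velocity_A[OF N_D(1)[OF t] c N_D(3)[OF t]] X_apply[OF c d N_D(2,3)[OF t]] by simp
qed simp

lemma chart_jacobi_tangent:
  assumes c: "c \<in> A" and d: "d \<in> B"
    and V: "\<And>t. t \<in> N c d \<Longrightarrow> V t \<in> tangent_space B (\<gamma> t)" "\<And>t. t \<in> N c d \<Longrightarrow> J t = di (\<gamma> t) (V t)"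
  shows "Ac.chart_jacobi c (N c d) J \<longleftrightarrow> cjac (metric_in_chart A g c) (N c d)
    (\<lambda>t. F c d (snd d (\<gamma> t))) (\<lambda>t. Xc c d (snd d (\<gamma> t))) (\<lambda>t. fd (F c d) (snd d (\<gamma> t)) (V t d))"
  unfolding chart_jacobi_A[OF c d]
  by (rule cjac_cong) (use V di_apply[OF c N_D(3) d N_D(2)] in auto)

lemma chart_jacobi_B:
  assumes c: "c \<in> A" and d: "d \<in> B"
  shows "Bc.chart_jacobi d (N c d) V \<longleftrightarrow> cjac (metric_in_chart B gt d) (N c d)
    (\<lambda>t. snd d (\<gamma> t)) (\<lambda>t. \<xi>c d (snd d (\<gamma> t))) (\<lambda>t. V t d)"
  unfolding Bc.chart_jacobi_def
proof (rule cjac_cong)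
  fix t assume t: "t \<in> N c d"
  show "velocity B I \<gamma> t d = \<xi>c d (snd d (\<gamma> t))"
    using velocity_B[OF N_D(1)[OF t] d N_D(2)[OF t]] d N_D(2)[OF t] by (simp add: \<xi>c_def)
qed simp_all

lemma jacobi_field_imp_A:
  assumes "jacobi_field A g I (i \<circ> \<gamma>) J" "c \<in> A" "d \<in> B"
  shows "Ac.chart_jacobi c (N c d) J"
  by (rule Ac.jacobi_field_imp_chart_jacobi[OF assms(1,2)]) (auto simp: N_iff)

lemma jacobi_field_imp_B:
  assumes "jacobi_field B gt I \<gamma> V" "c \<in> A" "d \<in> B"
  shows "Bc.chart_jacobi d (N c d) V"
  by (rule Bc.jacobi_field_imp_chart_jacobi[OF assms(1,3)]) (auto simp: N_iff)

abbreviation proj :: "(real \<Rightarrow> ('a, 'e) tvec) \<Rightarrow> real \<Rightarrow> ('b, 'f) tvec" where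
  "proj \<equiv> screen_projection A g B i \<zeta> I \<gamma>"

lemma proj_eq:
  assumes "t \<in> I" "v \<in> tangent_space B (\<gamma> t)" "J t = di (\<gamma> t) v"
  shows "proj J t = v - \<omega> (\<gamma> t) v *\<^sub>R \<xi> (\<gamma> t)"
  using orthogonal_projection_screen[OF \<gamma>_in[OF assms(1)] assms(2)]
    inv_into_f_f[OF di_inj[OF \<gamma>_in[OF assms(1)]] assms(2)] assms
  by (simp add: screen_projection_def)

lemma tangent_field:
  assumes "\<forall>t\<in>I. J t \<in> hypersurface_tangent A B i (\<gamma> t)"
  obtains V where "\<And>t. t \<in> I \<Longrightarrow> V t \<in> tangent_space B (\<gamma> t)" "\<And>t. t \<in> I \<Longrightarrow> J t = di (\<gamma> t) (V t)"
proof -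
  have "\<forall>t\<in>I. \<exists>v. v \<in> tangent_space B (\<gamma> t) \<and> J t = di (\<gamma> t) v"
    using assms unfolding hypersurface_tangent_def by blast
  from bchoice[OF this] obtain V where "\<forall>t\<in>I. V t \<in> tangent_space B (\<gamma> t) \<and> J t = di (\<gamma> t) (V t)" ..
  then show thesis by (intro that[of V]) simp_all
qed

text \<open>The equation is checked in a given chart \<open>d\<close> of the hypersurface near a
  given time. An auxiliary chart of the ambient manifold at the image point is enough, as the
  property is local.\<close>

lemma proj_jacobi:
  assumes J: "jacobi_field A g I (i \<circ> \<gamma>) J" and "\<forall>t\<in>I. J t \<in> hypersurface_tangent A B i (\<gamma> t)"
  shows "jacobi_field B gt I \<gamma> (proj J)"
proof -
  obtain V where V: "\<And>t. t \<in> I \<Longrightarrow> V t \<in> tangent_space B (\<gamma> t)" "\<And>t. t \<in> I \<Longrightarrow> J t = di (\<gamma> t) (V t)"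
    using tangent_field[OF assms(2)] by blast
  note sub = B.subspace_tangent_space
  have proj: "proj J t = V t - \<omega> (\<gamma> t) (V t) *\<^sub>R \<xi> (\<gamma> t)" if "t \<in> I" for t
    by (rule proj_eq[where J = J, OF that V(1)[OF that] V(2)[OF that]])
  show ?thesis
  proof (rule Bc.jacobi_fieldI)
    show "proj J t = 0" if "t \<notin> I" for t using that by (simp add: screen_projection_def)
    show "proj J t \<in> tangent_space B (\<gamma> t)" if "t \<in> I" for t
      unfolding proj[OF that]
      by (intro subspace_diff[OF sub] subspace_scale[OF sub] V(1)[OF that] \<xi>_in[OF \<gamma>_in[OF that]])
    fix t d assume t: "t \<in> I" and d: "d \<in> B" "\<gamma> t \<in> fst d"
    let ?c = "chart_at A (i (\<gamma> t))"
    note c = A.chart_at[OF i_in(1)[OF \<gamma>_in[OF t]]]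
    interpret R: rigged_coords "snd ?c ` (U \<inter> fst ?c)" "metric_in_chart A g ?c" "dom ?c d" "F ?c d" "\<xi>c d" "N ?c d"
      "\<lambda>s. snd d (\<gamma> s)" "Z ?c" "\<omega>c d" "metric_in_chart B gt d"
      by (rule rigged_curve_coords[OF c(1) d(1)])
    obtain T where T: "open T" "N ?c d = I \<inter> T" using N_open[OF c(1) d(1)] .
    have "t \<in> N ?c d" using t d c by (simp add: N_iff)
    then have "t \<in> T" using T by simp
    have "cjac (metric_in_chart A g ?c) (N ?c d) (\<lambda>t. F ?c d (snd d (\<gamma> t))) (\<lambda>t. R.X (snd d (\<gamma> t)))
       (\<lambda>t. fd (F ?c d) (snd d (\<gamma> t)) (V t d))"
      using jacobi_field_imp_A[OF J c(1) d(1)] chart_jacobi_tangent[OF c(1) d(1) V(1)[OF N_D(1)] V(2)[OF N_D(1)]] by simp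
    from R.screen_projection_cjac[OF this]
    have "cjac (metric_in_chart B gt d) (N ?c d) (\<lambda>t. snd d (\<gamma> t)) (\<lambda>t. \<xi>c d (snd d (\<gamma> t))) (\<lambda>t. proj J t d)"
    proof (rule cjac_cong[THEN iffD1, rotated -1])
      fix s assume s: "s \<in> N ?c d"
      note sI = N_D(1)[OF s] and sd = N_D(2)[OF s]
      show "V s d - \<omega>c d (snd d (\<gamma> s)) (V s d) *\<^sub>R \<xi>c d (snd d (\<gamma> s)) = proj J s d"
        using \<omega>c_apply[OF d(1) sd V(1)[OF sI]] d(1) sd by (simp add: proj[OF sI] scaleR_fun_apply \<xi>c_def)
    qed simp_all
    then have "Bc.chart_jacobi d (N ?c d) (proj J)" by (simp add: chart_jacobi_B[OF c(1) d(1)])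
    moreover have "\<gamma> ` N ?c d \<subseteq> fst d" by (auto simp: N_iff)
    ultimately show "\<exists>T. open T \<and> t \<in> T \<and> \<gamma> ` (I \<inter> T) \<subseteq> fst d \<and> Bc.chart_jacobi d (I \<inter> T) (proj J)"
      using T \<open>t \<in> T\<close> by (intro exI[of _ T]) simp
  qed
qed

lemma a_pos: "I = {0..a} \<Longrightarrow> a > 0"
  using integral_curve by (auto simp: integral_curve_def)

text \<open>The component g(J, \<xi>) is affine along the curve, hence 0 if it vanishes at both
  ends, and the orthogonal complement of \<xi> is the tangent space of the hypersurface.\<close>

lemma vanishing_imp_tangent:
  assumes I: "I = {0..a}" and J: "jacobi_field A g I (i \<circ> \<gamma>) J" "J 0 = 0" "J a = 0"
  shows "\<forall>t\<in>I. J t \<in> hypersurface_tangent A B i (\<gamma> t)"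
proof
  fix t0 assume t0: "t0 \<in> I"
  note JT = Ac.jacobi_fieldD(2)[OF J(1), unfolded comp_apply]
  define q where "q t = g (i (\<gamma> t)) (J t) (di (\<gamma> t) (\<xi> (\<gamma> t)))" for t
  have coords: "q s = metric_in_chart A g c (F c d (snd d (\<gamma> s))) (J s c) (Xc c d (snd d (\<gamma> s)))"
    if "s \<in> N c d" "c \<in> A" "d \<in> B" for s c d
  proof -
    note s = N_D[OF that(1)]
    show ?thesis
      unfolding q_def g_coords[OF that(2) s(3) JT[OF s(1)] di_in[OF \<gamma>_in[OF s(1)] \<xi>_in[OF \<gamma>_in[OF s(1)]]]]
        F_apply[OF that(3) s(2)] X_apply[OF that(2,3) s(2,3)] ..
  qed
  have local: "\<exists>T r. open T \<and> t \<in> T \<and> (\<forall>s\<in>{0..a} \<inter> T. (q has_vector_derivative r s) (at s within {0..a} \<inter> T) \<and>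
         (r has_vector_derivative 0) (at s within {0..a} \<inter> T))" if "t \<in> {0..a}" for t
  proof -
    have t: "t \<in> I" using that I by simp
    let ?c = "chart_at A (i (\<gamma> t))" and ?d = "chart_at B (\<gamma> t)"
    note c = A.chart_at[OF i_in(1)[OF \<gamma>_in[OF t]]] and d = B.chart_at[OF \<gamma>_in[OF t]]
    interpret R: rigged_coords "snd ?c ` (U \<inter> fst ?c)" "metric_in_chart A g ?c" "dom ?c ?d" "F ?c ?d" "\<xi>c ?d" "N ?c ?d"
      "\<lambda>s. snd ?d (\<gamma> s)" "Z ?c" "\<omega>c ?d" "metric_in_chart B gt ?d"
      by (rule rigged_curve_coords[OF c(1) d(1)])
    obtain T where T: "open T" "N ?c ?d = I \<inter> T" using N_open[OF c(1) d(1)] .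
    have "t \<in> N ?c ?d" using t d c by (simp add: N_iff)
    then have tT: "t \<in> T" using T by simp
    have X': "((\<lambda>t. R.X (snd ?d (\<gamma> t))) has_vector_derivative
        - chris (metric_in_chart A g ?c) (F ?c ?d (snd ?d (\<gamma> t))) (R.X (snd ?d (\<gamma> t))) (R.X (snd ?d (\<gamma> t)))) (at t within N ?c ?d)"
      if "t \<in> N ?c ?d" for t
      using R.Xy_deriv[OF that] R.geodesic[OF R.y_in[OF that]] by (simp add: eq_neg_iff_add_eq_0[symmetric])
    obtain r where r: "\<And>s. s \<in> N ?c ?d \<Longrightarrow> ((\<lambda>s. metric_in_chart A g ?c (F ?c ?d (snd ?d (\<gamma> s))) (J s ?c) (R.X (snd ?d (\<gamma> s)))) has_vector_derivative r s) (at s within N ?c ?d)"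
      "\<And>s. s \<in> N ?c ?d \<Longrightarrow> (r has_vector_derivative 0) (at s within N ?c ?d)"
      using R.cjac_velocity_component[OF jacobi_field_imp_A[OF J(1) c(1) d(1), unfolded chart_jacobi_A[OF c(1) d(1)]]
          R.Fy_image R.Fy_deriv X'] by blast
    have "(q has_vector_derivative r s) (at s within N ?c ?d)" if "s \<in> N ?c ?d" for s
      by (rule has_vector_derivative_transform[OF that _ r(1)[OF that]]) (rule coords[OF _ c(1) d(1)])
    then show ?thesis
      using T tT r(2) I by (intro exI[of _ T] exI[of _ r]) simp
  qed
  have J0: "g (i p) 0 v = 0" if p: "p \<in> points B" "v \<in> tangent_space A (i p)" for p v
  proof -
    note c = A.chart_at[OF i_in(1)[OF p(1)]]
    interpret metric_coords "snd (chart_at A (i p)) ` fst (chart_at A (i p))" "metric_in_chart A g (chart_at A (i p))"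
      by (rule lorentzian_metric_coords[OF lorentzian c(1)])
    show ?thesis
      using g_coords[OF c subspace_0[OF A.subspace_tangent_space] p(2)] c(2)
      by (simp add: bilinear_lzero[OF bilinear_G])
  qed
  have "a > 0" by (rule a_pos[OF I])
  then have "q 0 = 0" "q a = 0"
    using J0 \<gamma>_in[of 0] \<gamma>_in[of a] di_in \<xi>_in I by (simp_all add: q_def J)
  then have q0: "q t0 = 0"
    using second_derivative_zero_imp_zero[OF \<open>a > 0\<close> _ _ local] t0 I by simp
  let ?c = "chart_at A (i (\<gamma> t0))" and ?d = "chart_at B (\<gamma> t0)"
  note p = \<gamma>_in[OF t0]
  note c = A.chart_at[OF i_in(1)[OF p]] and d = B.chart_at[OF p]
  interpret R: rigged_coords "snd ?c ` (U \<inter> fst ?c)" "metric_in_chart A g ?c" "dom ?c ?d" "F ?c ?d" "\<xi>c ?d" "N ?c ?d"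
    "\<lambda>s. snd ?d (\<gamma> s)" "Z ?c" "\<omega>c ?d" "metric_in_chart B gt ?d"
    by (rule rigged_curve_coords[OF c(1) d(1)])
  have tN: "t0 \<in> N ?c ?d" using t0 d c by (simp add: N_iff)
  have "J t0 ?c \<in> range (fd (F ?c ?d) (snd ?d (\<gamma> t0)))"
    by (rule R.G_X_eq_0_imp_tangent[OF R.y_in[OF tN]]) (use q0 coords[OF tN c(1) d(1)] in simp)
  then obtain v where v: "J t0 ?c = fd (F ?c ?d) (snd ?d (\<gamma> t0)) v" by auto
  have "di (\<gamma> t0) (tangent_vector B ?d (\<gamma> t0) v) = J t0"
    by (rule di_eqI[OF p B.tangent_vector_in[OF d] JT[OF t0] c d]) (simp add: v B.tangent_vector_self[OF d])
  then show "J t0 \<in> hypersurface_tangent A B i (\<gamma> t0)"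
    unfolding hypersurface_tangent_def using imageI[OF B.tangent_vector_in[OF d], of "di (\<gamma> t0)" v] by simp
qed

text \<open>A tangent field with zero projection is a multiple of \<xi>, and by the Jacobi equation
  its factor \<open>q\<close> is affine; two zeros make it vanish.\<close>

lemma proj_0_imp_0:
  assumes I: "I = {0..a}" and J: "jacobi_field A g I (i \<circ> \<gamma>) J" "J 0 = 0" "J a = 0" and 0: "proj J = 0"
  shows "J = 0"
proof -
  obtain V where V: "\<And>t. t \<in> I \<Longrightarrow> V t \<in> tangent_space B (\<gamma> t)" "\<And>t. t \<in> I \<Longrightarrow> J t = di (\<gamma> t) (V t)"
    using tangent_field[OF vanishing_imp_tangent[OF I J]] by blast
  define q where "q t = \<omega> (\<gamma> t) (V t)" for t
  have Vq: "V t = q t *\<^sub>R \<xi> (\<gamma> t)" if "t \<in> I" for t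
    using proj_eq[where J = J, OF that V(1)[OF that] V(2)[OF that]] 0 by (simp add: q_def)
  have local: "\<exists>T r. open T \<and> t \<in> T \<and> (\<forall>s\<in>{0..a} \<inter> T. (q has_vector_derivative r s) (at s within {0..a} \<inter> T) \<and>
         (r has_vector_derivative 0) (at s within {0..a} \<inter> T))" if "t \<in> {0..a}" for t
  proof -
    have t: "t \<in> I" using that I by simp
    let ?c = "chart_at A (i (\<gamma> t))" and ?d = "chart_at B (\<gamma> t)"
    note c = A.chart_at[OF i_in(1)[OF \<gamma>_in[OF t]]] and d = B.chart_at[OF \<gamma>_in[OF t]]
    interpret R: rigged_coords "snd ?c ` (U \<inter> fst ?c)" "metric_in_chart A g ?c" "dom ?c ?d" "F ?c ?d" "\<xi>c ?d" "N ?c ?d"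
      "\<lambda>s. snd ?d (\<gamma> s)" "Z ?c" "\<omega>c ?d" "metric_in_chart B gt ?d"
      by (rule rigged_curve_coords[OF c(1) d(1)])
    obtain T where T: "open T" "N ?c ?d = I \<inter> T" using N_open[OF c(1) d(1)] .
    have "t \<in> N ?c ?d" using t d c by (simp add: N_iff)
    then have tT: "t \<in> T" using T by simp
    have "cjac (metric_in_chart A g ?c) (N ?c ?d) (\<lambda>t. F ?c ?d (snd ?d (\<gamma> t))) (\<lambda>t. R.X (snd ?d (\<gamma> t)))
       (\<lambda>t. fd (F ?c ?d) (snd ?d (\<gamma> t)) (V t ?d))"
      using jacobi_field_imp_A[OF J(1) c(1) d(1)] chart_jacobi_tangent[OF c(1) d(1) V(1)[OF N_D(1)] V(2)[OF N_D(1)]] by simp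
    then have "cjac (metric_in_chart A g ?c) (N ?c ?d) (\<lambda>t. F ?c ?d (snd ?d (\<gamma> t))) (\<lambda>t. R.X (snd ?d (\<gamma> t)))
       (\<lambda>t. fd (F ?c ?d) (snd ?d (\<gamma> t)) (q t *\<^sub>R \<xi>c ?d (snd ?d (\<gamma> t))))"
    proof (rule cjac_cong[THEN iffD1, rotated -1])
      fix s assume s: "s \<in> N ?c ?d"
      have "V s ?d = q s *\<^sub>R \<xi>c ?d (snd ?d (\<gamma> s))"
        using d(1) N_D(2)[OF s] by (simp add: Vq[OF N_D(1)[OF s]] scaleR_fun_apply \<xi>c_def)
      then show "fd (F ?c ?d) (snd ?d (\<gamma> s)) (V s ?d) = fd (F ?c ?d) (snd ?d (\<gamma> s)) (q s *\<^sub>R \<xi>c ?d (snd ?d (\<gamma> s)))"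
        by simp
    qed simp_all
    from R.multiple_of_\<xi>_cjac[OF this] obtain r where
      "\<And>t. t \<in> N ?c ?d \<Longrightarrow> (q has_vector_derivative r t) (at t within N ?c ?d)"
      "\<And>t. t \<in> N ?c ?d \<Longrightarrow> (r has_vector_derivative 0) (at t within N ?c ?d)" by blast
    then show ?thesis
      using T tT I by (intro exI[of _ T] exI[of _ r]) simp
  qed
  have "a > 0" by (rule a_pos[OF I])
  have Vend: "V t = 0" if t: "t \<in> I" and "J t = 0" for t
  proof (rule inj_onD[OF di_inj[OF \<gamma>_in[OF t]] _ V(1)[OF t] subspace_0[OF B.subspace_tangent_space]])
    show "di (\<gamma> t) (V t) = di (\<gamma> t) 0" using V(2)[OF t] that di_0[OF \<gamma>_in[OF t]] by simp
  qed
  have "q t = 0" if t: "t \<in> I" "J t = 0" for t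
    using \<omega>_combination[OF \<gamma>_in[OF t(1)] \<xi>_in[OF \<gamma>_in[OF t(1)]] \<xi>_in[OF \<gamma>_in[OF t(1)]], of 0 0] Vend[OF t] by (simp add: q_def)
  then have "q 0 = 0" "q a = 0" using J \<open>a > 0\<close> I by simp_all
  then have q0: "q t = 0" if "t \<in> I" for t
    using second_derivative_zero_imp_zero[OF \<open>a > 0\<close> _ _ local] that I by simp
  show ?thesis
  proof
    fix t
    show "J t = 0 t"
    proof (cases "t \<in> I")
      case True
      then show ?thesis using V(2)[OF True] Vq[OF True] q0[OF True] di_0[OF \<gamma>_in[OF True]] by simp
    next
      case False
      then show ?thesis using Ac.jacobi_fieldD(1)[OF J(1)] by simp
    qed
  qed
qed

end

section \<open>The Lie derivative of a field along the curve\<close>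

context rigged_null_hypersurface
begin

text \<open>The transformation law of the components of \<xi>, differentiated in the direction
  \<open>v\<close>.\<close>

lemma d\<xi>_change_chart:
  assumes d: "d \<in> B" "p \<in> fst d" and d': "d' \<in> B" "p \<in> fst d'"
  shows "fd (\<xi>c d') (snd d' p) (fd (B.\<tau> d d') (snd d p) v)
    = fd (\<lambda>z. fd (B.\<tau> d d') z (\<xi>c d (snd d p))) (snd d p) v + fd (B.\<tau> d d') (snd d p) (fd (\<xi>c d) (snd d p) v)"
proof -
  let ?S = "snd d ` (fst d \<inter> fst d')" and ?\<phi> = "B.\<tau> d d'" and ?x = "snd d p"
  note oS = B.open_\<tau>_domain[OF d(1) d'(1)]
  have x: "?x \<in> ?S" using d d' by auto
  let ?c = "chart_at A (i p)"
  note c = A.chart_at[OF i_in(1)[OF points_B[OF d]]]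
  have \<xi>diff: "\<xi>c e differentiable at (snd e p)" if "e \<in> B" "p \<in> fst e" for e
    using flow_coords.\<xi>_differentiable[OF flow_coords[OF c(1) that(1)]] domI[OF that(2) c(2)] by blast
  have \<phi>2: "diff_on 2 ?S ?\<phi>" by (rule B.diff_on_\<tau>[OF d(1) d'(1)])
  have lin: "linear (fd ?\<phi> z)" if "z \<in> ?S" for z
    using diff_onD[OF \<phi>2 _ that] by (auto intro: has_derivative_linear)
  have d\<phi>: "(\<lambda>z. fd ?\<phi> z b) differentiable at ?x" for b
  proof -
    have "diff_on 1 ?S (\<lambda>z. fd ?\<phi> z b)" using \<phi>2 by (simp add: numeral_2_eq_2)
    from diff_onD[OF this _ x] show ?thesis unfolding differentiable_def by auto
  qed
  have "((\<lambda>z. fd ?\<phi> z (\<xi>c d z)) has_derivative (\<lambda>h. fd (\<lambda>z. fd ?\<phi> z (\<xi>c d ?x)) ?x h + fd ?\<phi> ?x (fd (\<xi>c d) ?x h))) (at ?x within ?S)"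
    by (rule has_derivative_family_apply[where x = "\<lambda>z. z" and x' = "\<lambda>h. h", OF oS lin d\<phi> _ x])
       (use \<xi>diff[OF d] at_within_open[OF x oS] in \<open>simp_all add: frechet_derivative_works\<close>)
  then have "((\<lambda>z. \<xi>c d' (?\<phi> z)) has_derivative (\<lambda>h. fd (\<lambda>z. fd ?\<phi> z (\<xi>c d ?x)) ?x h + fd ?\<phi> ?x (fd (\<xi>c d) ?x h))) (at ?x within ?S)"
  proof (rule has_derivative_transform[OF x, rotated])
    fix z assume "z \<in> ?S"
    then obtain q where q: "q \<in> fst d" "q \<in> fst d'" "z = snd d q" by auto
    show "\<xi>c d' (?\<phi> z) = fd ?\<phi> z (\<xi>c d z)"
      using B.tangent_spaceD[OF \<xi>_in[OF points_B[OF d(1) q(1)]] d(1) q(1) d'(1) q(2)] q d d' by (simp add: \<xi>c_def)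
  qed
  moreover have "((\<lambda>z. \<xi>c d' (?\<phi> z)) has_derivative (\<lambda>h. fd (\<xi>c d') (snd d' p) (fd ?\<phi> ?x h))) (at ?x within ?S)"
  proof (rule has_derivative_compose_at[where f = "\<xi>c d'" and x = "?\<phi>" and x' = "fd ?\<phi> ?x"])
    show "(\<xi>c d' has_derivative fd (\<xi>c d') (snd d' p)) (at (?\<phi> ?x))"
      using \<xi>diff[OF d'] d by (simp add: frechet_derivative_works)
    show "(?\<phi> has_derivative fd ?\<phi> ?x) (at ?x within ?S)"
      using B.\<tau>_has_derivative[OF d(1) d'(1) d(2) d'(2)] has_derivative_at_withinI by blast
  qed
  ultimately show ?thesis
    unfolding at_within_open[OF x oS] by (metis (no_types, lifting) frechet_derivative_eq)
qed

end

context rigged_null_curve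
begin

text \<open>Recorded as a field on the whole of \<open>I\<close> in all charts at once, because the
  Dirichlet problem in the lift needs a right-hand side that does not refer to a chart.\<close>

definition Lie :: "(real \<Rightarrow> ('b, 'f) tvec) \<Rightarrow> real \<Rightarrow> ('b, 'f) tvec" where
  "Lie V t = (\<lambda>d. if t \<in> I \<and> d \<in> charts_at B (\<gamma> t)
     then vector_derivative (\<lambda>s. V s d) (at t within I) - fd (\<xi>c d) (snd d (\<gamma> t)) (V t d) else 0)"

text \<open>Both the derivative of the components of \<open>V\<close> and d\<xi>(V) change by a
  second derivative of the coordinate change; by its symmetry the two contributions cancel in the
  difference.\<close>

lemma Lie_in:
  assumes VT: "\<And>s. s \<in> I \<Longrightarrow> V s \<in> tangent_space B (\<gamma> s)"
    and dV: "\<And>d. d \<in> B \<Longrightarrow> \<gamma> t \<in> fst d \<Longrightarrow> (\<lambda>s. V s d) differentiable (at t within I)"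
    and t: "t \<in> I"
  shows "Lie V t \<in> tangent_space B (\<gamma> t)"
  unfolding tangent_space_def mem_Collect_eq
proof (intro conjI allI ballI impI)
  show "Lie V t d = 0" if "d \<notin> charts_at B (\<gamma> t)" for d using that by (simp add: Lie_def)
  fix d d' assume "d \<in> charts_at B (\<gamma> t)" "d' \<in> charts_at B (\<gamma> t)"
  then have d: "d \<in> B" "\<gamma> t \<in> fst d" and d': "d' \<in> B" "\<gamma> t \<in> fst d'" by (simp_all add: B.charts_at_iff)
  let ?S = "snd d ` (fst d \<inter> fst d')" and ?\<phi> = "B.\<tau> d d'" and ?x = "snd d (\<gamma> t)"
  note oS = B.open_\<tau>_domain[OF d(1) d'(1)]
  have x: "?x \<in> ?S" using d d' by auto
  have \<phi>3: "diff_on 3 ?S ?\<phi>" by (rule B.diff_on_\<tau>[OF d(1) d'(1)])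
  let ?M = "{s \<in> I. \<gamma> s \<in> fst d \<inter> fst d'}"
  have tM: "t \<in> ?M" using t d d' by simp
  have at: "at t within ?M = at t within I"
    by (rule Bc.at_within_preimage[OF open_Int[OF B.open_chart[OF d(1)] B.open_chart[OF d'(1)]] t]) (use d d' in simp)
  define V' where "V' = vector_derivative (\<lambda>s. V s d) (at t within I)"
  have V': "((\<lambda>s. V s d) has_vector_derivative V') (at t within ?M)"
    unfolding at V'_def using dV[OF d] by (simp only: vector_derivative_works)
  have "((\<lambda>s. fd ?\<phi> (snd d (\<gamma> s)) (V s d)) has_vector_derivative
      fd (\<lambda>z. fd ?\<phi> z (V t d)) ?x (\<xi>c d ?x) + fd ?\<phi> ?x V') (at t within ?M)"
  proof (rule has_vector_derivative_family_apply[where x = "\<lambda>s. snd d (\<gamma> s)", OF oS _ _ _ tM _ V'])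
    show "linear (fd ?\<phi> z)" if "z \<in> ?S" for z
      using diff_onD[OF \<phi>3 _ that] by (auto intro: has_derivative_linear)
    show "(\<lambda>z. fd ?\<phi> z b) differentiable at ?x" for b
    proof -
      have "diff_on 2 ?S (\<lambda>z. fd ?\<phi> z b)" using \<phi>3 by (simp add: eval_nat_numeral)
      from diff_onD[OF this _ x] show ?thesis unfolding differentiable_def by auto
    qed
    show "(\<lambda>s. snd d (\<gamma> s)) ` ?M \<subseteq> ?S" by blast
    show "((\<lambda>s. snd d (\<gamma> s)) has_vector_derivative \<xi>c d ?x) (at t within ?M)"
      unfolding at using \<gamma>_deriv[OF t d] d by (simp add: o_def \<xi>c_def)
  qed
  then have "((\<lambda>s. V s d') has_vector_derivative fd (\<lambda>z. fd ?\<phi> z (V t d)) ?x (\<xi>c d ?x) + fd ?\<phi> ?x V') (at t within ?M)"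
  proof (rule has_vector_derivative_transform[OF tM, rotated])
    show "V s d' = fd ?\<phi> (snd d (\<gamma> s)) (V s d)" if "s \<in> ?M" for s
      by (rule B.tangent_spaceD[OF VT]) (use that d d' in auto)
  qed
  then have "vector_derivative (\<lambda>s. V s d') (at t within I) = fd (\<lambda>z. fd ?\<phi> z (V t d)) ?x (\<xi>c d ?x) + fd ?\<phi> ?x V'"
    unfolding at by (rule vector_derivative_within[OF I_perfect[OF t]])
  then have "Lie V t d' = fd (\<lambda>z. fd ?\<phi> z (V t d)) ?x (\<xi>c d ?x) + fd ?\<phi> ?x V' - fd (\<xi>c d') (snd d' (\<gamma> t)) (V t d')"
    using t d' by (simp add: Lie_def B.charts_at_iff)
  also have "V t d' = fd ?\<phi> ?x (V t d)" by (rule B.tangent_spaceD[OF VT[OF t] d d'])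
  also have "fd (\<xi>c d') (snd d' (\<gamma> t)) (fd ?\<phi> ?x (V t d))
      = fd (\<lambda>z. fd ?\<phi> z (\<xi>c d ?x)) ?x (V t d) + fd ?\<phi> ?x (fd (\<xi>c d) ?x (V t d))"
    by (rule d\<xi>_change_chart[OF d d'])
  also have "fd (\<lambda>z. fd ?\<phi> z (\<xi>c d ?x)) ?x (V t d) = fd (\<lambda>z. fd ?\<phi> z (V t d)) ?x (\<xi>c d ?x)"
    by (rule symmetric_second_derivative[OF oS x \<phi>3])
  also have "fd (\<lambda>z. fd ?\<phi> z (V t d)) ?x (\<xi>c d ?x) + fd ?\<phi> ?x V'
      - (fd (\<lambda>z. fd ?\<phi> z (V t d)) ?x (\<xi>c d ?x) + fd ?\<phi> ?x (fd (\<xi>c d) ?x (V t d)))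
      = fd ?\<phi> ?x (Lie V t d)"
    using t d by (simp add: Lie_def B.charts_at_iff V'_def linear_diff[OF B.linear_d\<tau>[OF d(1) d'(1) d(2) d'(2)]])
  finally show "Lie V t d' = fd ?\<phi> ?x (Lie V t d)" .
qed

text \<open>The function f is found once on the whole interval, so its second derivative
  \<open>\<kappa>\<close> is set up without charts. Charts return only to show that
  \<open>\<kappa>\<close> is continuous and that the corrected field satisfies the Jacobi
  equation.\<close>

lemma jacobi_lift:
  assumes I: "I = {0..a}" and V: "jacobi_field B gt I \<gamma> V" "V 0 = 0" "V a = 0"
  obtains J where "jacobi_field A g I (i \<circ> \<gamma>) J" "\<forall>t\<in>I. J t \<in> hypersurface_tangent A B i (\<gamma> t)"
    "J 0 = 0" "J a = 0" "proj J = V"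
proof -
  have a: "a > 0" by (rule a_pos[OF I])
  note VT = Bc.jacobi_fieldD(2)[OF V(1)]
  note subB = B.subspace_tangent_space
  have dV: "(\<lambda>s. V s d) differentiable (at t within I)" if "t \<in> I" "d \<in> B" "\<gamma> t \<in> fst d" for t d
    using V(1) that unfolding jacobi_field_def differentiable_field_along_def by (simp add: B.charts_at_iff)
  have VN: "((\<lambda>s. V s d) has_vector_derivative vector_derivative (\<lambda>s. V s d) (at t within I)) (at t within N c d)"
    if "t \<in> N c d" "c \<in> A" "d \<in> B" for t c d
    using dV[OF N_D(1)[OF that(1)] that(3) N_D(2)[OF that(1)]]
    unfolding at_within_N[OF that(2,3,1)] vector_derivative_works .
  have LieN: "Lie V t d = vector_derivative (\<lambda>s. V s d) (at t within I) - fd (\<xi>c d) (snd d (\<gamma> t)) (V t d)"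
    if "t \<in> N c d" "d \<in> B" for t c d
    using N_D[OF that(1)] that(2) by (simp add: Lie_def B.charts_at_iff)
  have cV: "cjac (metric_in_chart B gt d) (N c d) (\<lambda>t. snd d (\<gamma> t)) (\<lambda>t. \<xi>c d (snd d (\<gamma> t))) (\<lambda>t. V t d)"
    if "c \<in> A" "d \<in> B" for c d
    using jacobi_field_imp_B[OF V(1) that] unfolding chart_jacobi_B[OF that] .
  have LieT: "Lie V t \<in> tangent_space B (\<gamma> t)" if "t \<in> I" for t
    by (rule Lie_in[OF VT dV[OF that] that])
  \<comment> \<open>The Lie derivative W of \<open>V\<close>, regarded as a field in the ambient
    manifold.\<close>
  define J1 where "J1 t = (if t \<in> I then di (\<gamma> t) (Lie V t) else 0)" for t
  have J1N: "J1 t c = fd (F c d) (snd d (\<gamma> t)) (Lie V t d)" if "t \<in> N c d" "c \<in> A" "d \<in> B" for t c d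
    using di_apply[OF that(2) N_D(3)[OF that(1)] that(3) N_D(2)[OF that(1)] LieT[OF N_D(1)[OF that(1)]]] N_D(1)[OF that(1)]
    by (simp add: J1_def)
  have J1T: "J1 t \<in> tangent_space A ((i \<circ> \<gamma>) t)" if "t \<in> I" for t
    using di_in[OF \<gamma>_in[OF that] LieT[OF that]] that by (simp add: J1_def)
  \<comment> \<open>In its first-order form the rigged Jacobi equation provides the derivative of W;
    the image under dF inherits differentiability.\<close>
  have dJ1: "(\<lambda>s. J1 s c) differentiable (at t within I)" if t: "t \<in> I" and c: "c \<in> A" "(i \<circ> \<gamma>) t \<in> fst c" for t c
  proof -
    let ?d = "chart_at B (\<gamma> t)"
    note d = B.chart_at[OF \<gamma>_in[OF t]]
    have tN: "t \<in> N c ?d" using t c d by (simp add: N_iff)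
    interpret R: rigged_coords "snd c ` (U \<inter> fst c)" "metric_in_chart A g c" "dom c ?d" "F c ?d" "\<xi>c ?d" "N c ?d"
      "\<lambda>s. snd ?d (\<gamma> s)" "Z c" "\<omega>c ?d" "metric_in_chart B gt ?d"
      by (rule rigged_curve_coords[OF c(1) d(1)])
    have "((\<lambda>s. Lie V s ?d) has_vector_derivative 0 - chris (metric_in_chart B gt ?d) (snd ?d (\<gamma> t)) (\<xi>c ?d (snd ?d (\<gamma> t))) (Lie V t ?d)
        - R.B.K (snd ?d (\<gamma> t)) (Lie V t ?d)) (at t within N c ?d)"
      by (rule R.rigged_cjac_Lie(1)[OF cV[OF c(1) d(1)] VN[OF _ c(1) d(1)] LieN[OF _ d(1)] tN])
    from R.covariant_derivative_eq_Lie[OF tN this]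
    have "(\<lambda>s. fd (F c ?d) (snd ?d (\<gamma> s)) (Lie V s ?d)) differentiable (at t within N c ?d)"
      by (rule differentiableI_vector)
    then have "(\<lambda>s. J1 s c) differentiable (at t within N c ?d)"
      by (rule differentiable_eq_on[OF tN, rotated]) (rule J1N[OF _ c(1) d(1)])
    then show ?thesis unfolding at_within_N[OF c(1) d(1) tN] .
  qed
  define D where "D = cov_deriv_along A g I (i \<circ> \<gamma>) J1"
  have DT: "D t \<in> tangent_space A (i (\<gamma> t))" if "t \<in> I" for t
    unfolding D_def using Ac.cov_deriv_along_tangent[OF J1T dJ1[OF that] that] by simp
  have DN: "((\<lambda>s. fd (F c d) (snd d (\<gamma> s)) (Lie V s d)) has_vector_derivative
        D t c - chris (metric_in_chart A g c) (F c d (snd d (\<gamma> t))) (Xc c d (snd d (\<gamma> t))) (fd (F c d) (snd d (\<gamma> t)) (Lie V t d)))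
      (at t within N c d)"
    if tN: "t \<in> N c d" and c: "c \<in> A" and d: "d \<in> B" for t c d
  proof -
    note t = N_D[OF tN]
    have "((\<lambda>s. J1 s c) has_vector_derivative D t c
        - chris (metric_in_chart A g c) (snd c ((i \<circ> \<gamma>) t)) (velocity A I (i \<circ> \<gamma>) t c) (J1 t c)) (at t within I)"
      unfolding D_def
      by (rule Ac.cov_deriv_along_has_vector_derivative[where X = J1]) (use t c dJ1 in auto)
    then have "((\<lambda>s. J1 s c) has_vector_derivative D t c
        - chris (metric_in_chart A g c) (F c d (snd d (\<gamma> t))) (Xc c d (snd d (\<gamma> t))) (fd (F c d) (snd d (\<gamma> t)) (Lie V t d))) (at t within N c d)"
      unfolding at_within_N[OF c d tN]
      using F_apply[OF d t(2), of c] velocity_A[OF t(1) c t(3)] X_apply[OF c d t(2,3)] J1N[OF tN c d] by simp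
    then show ?thesis
      by (rule has_vector_derivative_transform[OF tN, rotated]) (rule J1N[OF _ c d, symmetric])
  qed
  \<comment> \<open>The value that f'' must have in \<open>rigged_cjac_lift\<close>.\<close>
  define \<kappa> where "\<kappa> t = - 2 * g (i (\<gamma> t)) (\<zeta> (i (\<gamma> t))) (D t)" for t
  have \<kappa>N: "\<kappa> t = - 2 * metric_in_chart A g c (F c d (snd d (\<gamma> t))) (Z c (F c d (snd d (\<gamma> t)))) (D t c)"
    if tN: "t \<in> N c d" and c: "c \<in> A" and d: "d \<in> B" for t c d
  proof -
    note t = N_D[OF tN]
    show ?thesis
      using g_coords[OF c t(3) \<zeta>_in[OF i_in(2)[OF \<gamma>_in[OF t(1)]]] DT[OF t(1)]] F_apply[OF d t(2), of c] c t
      by (simp add: \<kappa>_def Z_def)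
  qed
  \<comment> \<open>\<open>D\<close> involves a second derivative of \<open>V\<close>, yet its
    pairing with the rigging is differentiable by \<open>rigged_cjac_source\<close>.\<close>
  have "continuous (at t within I) \<kappa>" if t: "t \<in> I" for t
  proof -
    let ?c = "chart_at A (i (\<gamma> t))" and ?d = "chart_at B (\<gamma> t)"
    note c = A.chart_at[OF i_in(1)[OF \<gamma>_in[OF t]]] and d = B.chart_at[OF \<gamma>_in[OF t]]
    have tN: "t \<in> N ?c ?d" using t c d by (simp add: N_iff)
    interpret R: rigged_coords "snd ?c ` (U \<inter> fst ?c)" "metric_in_chart A g ?c" "dom ?c ?d" "F ?c ?d" "\<xi>c ?d" "N ?c ?d"
      "\<lambda>s. snd ?d (\<gamma> s)" "Z ?c" "\<omega>c ?d" "metric_in_chart B gt ?d"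
      by (rule rigged_curve_coords[OF c(1) d(1)])
    have "(\<lambda>t. metric_in_chart A g ?c (F ?c ?d (snd ?d (\<gamma> t))) (Z ?c (F ?c ?d (snd ?d (\<gamma> t)))) (D t ?c)) differentiable (at t within N ?c ?d)"
      by (rule R.rigged_cjac_source(2)[OF cV[OF c(1) d(1)] VN[OF _ c(1) d(1)] LieN[OF _ d(1)] DN[OF _ c(1) d(1)] tN])
    then have "(\<lambda>t. - 2 * metric_in_chart A g ?c (F ?c ?d (snd ?d (\<gamma> t))) (Z ?c (F ?c ?d (snd ?d (\<gamma> t)))) (D t ?c)) differentiable (at t within N ?c ?d)"
      by (intro differentiable_mult differentiable_const)
    then have "\<kappa> differentiable (at t within N ?c ?d)"
      by (rule differentiable_eq_on[OF tN, rotated]) (rule \<kappa>N[OF _ c(1) d(1)])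
    then show ?thesis
      unfolding at_within_N[OF c(1) d(1) tN] by (rule differentiable_imp_continuous_within)
  qed
  then have "continuous_on {0..a} \<kappa>" unfolding continuous_on_eq_continuous_within I by blast
  from dirichlet_problem[OF a this] obtain f f1
    where f: "\<And>t. t \<in> {0..a} \<Longrightarrow> (f has_vector_derivative f1 t) (at t within {0..a})"
      "\<And>t. t \<in> {0..a} \<Longrightarrow> (f1 has_vector_derivative \<kappa> t) (at t within {0..a})" "f 0 = 0" "f a = 0" by blast
  have \<omega>N: "\<omega> (\<gamma> t) (V t) = \<omega>c d (snd d (\<gamma> t)) (V t d)" if "t \<in> N c d" "d \<in> B" for t c d
    using \<omega>c_apply[OF that(2) N_D(2)[OF that(1)] VT[OF N_D(1)[OF that(1)]]] by simp
  \<comment> \<open>Here both end conditions on \<open>V\<close> enter: the affine function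
    \<omega>(V) has two zeros, so \<open>V\<close> lies in the screen.\<close>
  have \<omega>V: "\<omega> (\<gamma> t) (V t) = 0" if "t \<in> I" for t
  proof (rule second_derivative_zero_imp_zero[OF a, where q = "\<lambda>t. \<omega> (\<gamma> t) (V t)"])
    have "\<omega> p 0 = 0" if "p \<in> points B" for p
      using \<omega>_combination[OF that \<xi>_in[OF that] \<xi>_in[OF that], of 0 0] by simp
    then show "\<omega> (\<gamma> 0) (V 0) = 0" "\<omega> (\<gamma> a) (V a) = 0" using V \<gamma>_in a I by simp_all
    show "t \<in> {0..a}" using that I by simp
    fix t assume "t \<in> {0..a}"
    then have t: "t \<in> I" using I by simp
    let ?c = "chart_at A (i (\<gamma> t))" and ?d = "chart_at B (\<gamma> t)"
    note c = A.chart_at[OF i_in(1)[OF \<gamma>_in[OF t]]] and d = B.chart_at[OF \<gamma>_in[OF t]]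
    have tN: "t \<in> N ?c ?d" using t c d by (simp add: N_iff)
    obtain T where T: "open T" "N ?c ?d = I \<inter> T" using N_open[OF c(1) d(1)] .
    interpret R: rigged_coords "snd ?c ` (U \<inter> fst ?c)" "metric_in_chart A g ?c" "dom ?c ?d" "F ?c ?d" "\<xi>c ?d" "N ?c ?d"
      "\<lambda>s. snd ?d (\<gamma> s)" "Z ?c" "\<omega>c ?d" "metric_in_chart B gt ?d"
      by (rule rigged_curve_coords[OF c(1) d(1)])
    from R.rigged_cjac_\<omega>[OF cV[OF c(1) d(1)]] obtain r where
      r: "\<And>s. s \<in> N ?c ?d \<Longrightarrow> ((\<lambda>s. \<omega>c ?d (snd ?d (\<gamma> s)) (V s ?d)) has_vector_derivative r s) (at s within N ?c ?d)"
        "\<And>s. s \<in> N ?c ?d \<Longrightarrow> (r has_vector_derivative 0) (at s within N ?c ?d)" by blast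
    have "((\<lambda>t. \<omega> (\<gamma> t) (V t)) has_vector_derivative r s) (at s within N ?c ?d)" if "s \<in> N ?c ?d" for s
      by (rule has_vector_derivative_transform[OF that _ r(1)[OF that]]) (rule \<omega>N[OF _ d(1)])
    then show "\<exists>T r. open T \<and> t \<in> T \<and> (\<forall>s\<in>{0..a} \<inter> T. ((\<lambda>t. \<omega> (\<gamma> t) (V t)) has_vector_derivative r s) (at s within {0..a} \<inter> T) \<and>
         (r has_vector_derivative 0) (at s within {0..a} \<inter> T))"
      using T tN r(2) I by (intro exI[of _ T] exI[of _ r]) simp
  qed
  define V1 where "V1 t = V t + f t *\<^sub>R \<xi> (\<gamma> t)" for t
  have V1T: "V1 t \<in> tangent_space B (\<gamma> t)" if "t \<in> I" for t
    unfolding V1_def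
    by (intro subspace_add[OF subB] subspace_scale[OF subB] VT[OF that] \<xi>_in[OF \<gamma>_in[OF that]])
  define J where "J t = (if t \<in> I then di (\<gamma> t) (V1 t) else 0)" for t
  have J: "jacobi_field A g I (i \<circ> \<gamma>) J"
  proof (rule Ac.jacobi_fieldI)
    show "J t = 0" if "t \<notin> I" for t using that by (simp add: J_def)
    show "J t \<in> tangent_space A ((i \<circ> \<gamma>) t)" if "t \<in> I" for t
      using di_in[OF \<gamma>_in[OF that] V1T[OF that]] that by (simp add: J_def)
    fix t c assume t: "t \<in> I" and c: "c \<in> A" "(i \<circ> \<gamma>) t \<in> fst c"
    let ?d = "chart_at B (\<gamma> t)"
    note d = B.chart_at[OF \<gamma>_in[OF t]]
    have tN: "t \<in> N c ?d" using t c d by (simp add: N_iff)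
    obtain T where T: "open T" "N c ?d = I \<inter> T" using N_open[OF c(1) d(1)] .
    interpret R: rigged_coords "snd c ` (U \<inter> fst c)" "metric_in_chart A g c" "dom c ?d" "F c ?d" "\<xi>c ?d" "N c ?d"
      "\<lambda>s. snd ?d (\<gamma> s)" "Z c" "\<omega>c ?d" "metric_in_chart B gt ?d"
      by (rule rigged_curve_coords[OF c(1) d(1)])
    have "cjac (metric_in_chart A g c) (N c ?d) (\<lambda>t. F c ?d (snd ?d (\<gamma> t))) (\<lambda>t. R.X (snd ?d (\<gamma> t)))
      (\<lambda>t. fd (F c ?d) (snd ?d (\<gamma> t)) (V t ?d + f t *\<^sub>R \<xi>c ?d (snd ?d (\<gamma> t))))"
    proof (rule R.rigged_cjac_lift[OF VN[OF _ c(1) d(1)] LieN[OF _ d(1)] cV[OF c(1) d(1)] _ DN[OF _ c(1) d(1)]])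
      fix s assume s: "s \<in> N c ?d"
      show "\<omega>c ?d (snd ?d (\<gamma> s)) (V s ?d) = 0" using \<omega>N[OF s d(1)] \<omega>V[OF N_D(1)[OF s]] by simp
      show "(f has_vector_derivative f1 s) (at s within N c ?d)"
        using f(1)[of s] N_D(1)[OF s] I unfolding at_within_N[OF c(1) d(1) s] by simp
      show "(f1 has_vector_derivative - 2 * metric_in_chart A g c (F c ?d (snd ?d (\<gamma> s))) (Z c (F c ?d (snd ?d (\<gamma> s)))) (D s c)) (at s within N c ?d)"
        using f(2)[of s] N_D(1)[OF s] I unfolding at_within_N[OF c(1) d(1) s] \<kappa>N[OF s c(1) d(1)] by simp
    qed
    then have "cjac (metric_in_chart A g c) (N c ?d) (\<lambda>t. F c ?d (snd ?d (\<gamma> t))) (\<lambda>t. R.X (snd ?d (\<gamma> t)))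
      (\<lambda>t. fd (F c ?d) (snd ?d (\<gamma> t)) (V1 t ?d))"
    proof (rule cjac_cong[THEN iffD1, rotated -1])
      fix s assume s: "s \<in> N c ?d"
      show "fd (F c ?d) (snd ?d (\<gamma> s)) (V s ?d + f s *\<^sub>R \<xi>c ?d (snd ?d (\<gamma> s))) = fd (F c ?d) (snd ?d (\<gamma> s)) (V1 s ?d)"
        using d(1) N_D(2)[OF s] by (simp add: V1_def scaleR_fun_apply \<xi>c_def)
    qed simp_all
    then have "Ac.chart_jacobi c (N c ?d) J"
      by (subst chart_jacobi_tangent[OF c(1) d(1) V1T[OF N_D(1)]]) (simp_all add: J_def N_D(1))
    moreover have "(i \<circ> \<gamma>) ` N c ?d \<subseteq> fst c" using N_D(3) by (simp add: image_subset_iff)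
    ultimately show "\<exists>T. open T \<and> t \<in> T \<and> (i \<circ> \<gamma>) ` (I \<inter> T) \<subseteq> fst c \<and> Ac.chart_jacobi c (I \<inter> T) J"
      using T tN by (intro exI[of _ T]) simp
  qed
  have Jend: "J t = 0" if "t \<in> I" "V t = 0" "f t = 0" for t
    using di_0[OF \<gamma>_in[OF that(1)]] that by (simp add: J_def V1_def)
  \<comment> \<open>The projection removes exactly the added term, because \<omega>(V) = 0 and
    \<omega>(\<xi>) = 1 give \<omega>(V1) = f.\<close>
  have "proj J t = V t" for t
  proof (cases "t \<in> I")
    case True
    have "proj J t = V1 t - \<omega> (\<gamma> t) (V1 t) *\<^sub>R \<xi> (\<gamma> t)"
      by (rule proj_eq[where J = J, OF True V1T[OF True]]) (simp add: J_def True)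
    moreover have "\<omega> (\<gamma> t) (V1 t) = f t"
      using \<omega>_combination[OF \<gamma>_in[OF True] VT[OF True] \<xi>_in[OF \<gamma>_in[OF True]], of 1 "f t"] \<omega>V[OF True] \<omega>_\<xi>[OF \<gamma>_in[OF True]]
      by (simp add: V1_def)
    ultimately show ?thesis by (simp add: V1_def)
  next
    case False
    then show ?thesis using Bc.jacobi_fieldD(1)[OF V(1)] by (simp add: screen_projection_def)
  qed
  then have "proj J = V" by (rule ext)
  moreover have "\<forall>t\<in>I. J t \<in> hypersurface_tangent A B i (\<gamma> t)"
    using V1T by (simp add: J_def hypersurface_tangent_def)
  ultimately show thesis
    using J Jend V f a I by (intro that[of J]) simp_all
qed

text \<open>Restricted to tangent fields, where the inverse of the differential is genuine;
  elsewhere \<open>inv_into\<close> returns an unspecified vector.\<close>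

lemma proj_combination:
  assumes J1: "\<forall>t\<in>I. J1 t \<in> hypersurface_tangent A B i (\<gamma> t)" and J2: "\<forall>t\<in>I. J2 t \<in> hypersurface_tangent A B i (\<gamma> t)"
  shows "proj (r *\<^sub>R J1 + s *\<^sub>R J2) = r *\<^sub>R proj J1 + s *\<^sub>R proj J2"
proof
  fix t
  obtain V1 where V1: "\<And>t. t \<in> I \<Longrightarrow> V1 t \<in> tangent_space B (\<gamma> t)" "\<And>t. t \<in> I \<Longrightarrow> J1 t = di (\<gamma> t) (V1 t)"
    using tangent_field[OF J1] by blast
  obtain V2 where V2: "\<And>t. t \<in> I \<Longrightarrow> V2 t \<in> tangent_space B (\<gamma> t)" "\<And>t. t \<in> I \<Longrightarrow> J2 t = di (\<gamma> t) (V2 t)"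
    using tangent_field[OF J2] by blast
  note sub = B.subspace_tangent_space
  show "proj (r *\<^sub>R J1 + s *\<^sub>R J2) t = (r *\<^sub>R proj J1 + s *\<^sub>R proj J2) t"
  proof (cases "t \<in> I")
    case True
    note p = \<gamma>_in[OF True] and T1 = V1(1)[OF True] and T2 = V2(1)[OF True]
    have "proj (r *\<^sub>R J1 + s *\<^sub>R J2) t = (r *\<^sub>R V1 t + s *\<^sub>R V2 t) - \<omega> (\<gamma> t) (r *\<^sub>R V1 t + s *\<^sub>R V2 t) *\<^sub>R \<xi> (\<gamma> t)"
    proof (rule proj_eq[OF True])
      show "r *\<^sub>R V1 t + s *\<^sub>R V2 t \<in> tangent_space B (\<gamma> t)"
        by (intro subspace_add[OF sub] subspace_scale[OF sub] T1 T2)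
      show "(r *\<^sub>R J1 + s *\<^sub>R J2) t = di (\<gamma> t) (r *\<^sub>R V1 t + s *\<^sub>R V2 t)"
        using di_combination[OF p T1 T2] V1(2)[OF True] V2(2)[OF True] by (simp add: scaleR_fun_apply)
    qed
    also have "\<dots> = r *\<^sub>R proj J1 t + s *\<^sub>R proj J2 t"
      unfolding proj_eq[where J = J1, OF True T1 V1(2)[OF True]] proj_eq[where J = J2, OF True T2 V2(2)[OF True]]
        \<omega>_combination[OF p T1 T2]
      by (simp add: algebra_simps)
    finally show ?thesis by (simp add: scaleR_fun_apply)
  next
    case False
    then show ?thesis by (simp add: screen_projection_def scaleR_fun_apply)
  qed
qed

text \<open>Fields vanishing at both ends are tangent, so the projection is linear on them.
  Injectivity is \<open>proj_0_imp_0\<close> applied to a difference, surjectivity is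
  \<open>jacobi_lift\<close>.\<close>

lemma jacobi_fields_vanishing_iso:
  assumes I: "I = {0..a}"
  shows "subspace (jacobi_fields_vanishing A g (i \<circ> \<gamma>) a)"
    and "inj_on proj (jacobi_fields_vanishing A g (i \<circ> \<gamma>) a)"
    and "proj ` jacobi_fields_vanishing A g (i \<circ> \<gamma>) a = jacobi_fields_vanishing B gt \<gamma> a"
    and "J1 \<in> jacobi_fields_vanishing A g (i \<circ> \<gamma>) a \<Longrightarrow> J2 \<in> jacobi_fields_vanishing A g (i \<circ> \<gamma>) a \<Longrightarrow>
      proj (r *\<^sub>R J1 + s *\<^sub>R J2) = r *\<^sub>R proj J1 + s *\<^sub>R proj J2"
proof -
  let ?S = "jacobi_fields_vanishing A g (i \<circ> \<gamma>) a"
  have S: "J \<in> ?S \<longleftrightarrow> jacobi_field A g I (i \<circ> \<gamma>) J \<and> J 0 = 0 \<and> J a = 0" for J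
    by (simp add: jacobi_fields_vanishing_def I)
  have SB: "V \<in> jacobi_fields_vanishing B gt \<gamma> a \<longleftrightarrow> jacobi_field B gt I \<gamma> V \<and> V 0 = 0 \<and> V a = 0" for V
    by (simp add: jacobi_fields_vanishing_def I)
  have tangent: "\<forall>t\<in>I. J t \<in> hypersurface_tangent A B i (\<gamma> t)" if "J \<in> ?S" for J
    using vanishing_imp_tangent[OF I] that by (simp add: S)
  have comb: "r *\<^sub>R J1 + s *\<^sub>R J2 \<in> ?S" if "J1 \<in> ?S" "J2 \<in> ?S" for J1 J2 r s
    using that Ac.jacobi_field_combination[of J1 J2 r s] by (simp add: S scaleR_fun_apply)
  show lin: "proj (r *\<^sub>R J1 + s *\<^sub>R J2) = r *\<^sub>R proj J1 + s *\<^sub>R proj J2" if "J1 \<in> ?S" "J2 \<in> ?S" for J1 J2 r s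
    by (rule proj_combination[OF tangent[OF that(1)] tangent[OF that(2)]])
  have end_in: "0 \<in> I" "a \<in> I" using a_pos[OF I] I by simp_all
  have proj_end: "proj J t = 0" if "t \<in> I" "J t = 0" for J t
    using proj_eq[where J = J, OF that(1) subspace_0[OF B.subspace_tangent_space]] that di_0[OF \<gamma>_in[OF that(1)]]
      \<omega>_combination[OF \<gamma>_in[OF that(1)] \<xi>_in[OF \<gamma>_in[OF that(1)]] \<xi>_in[OF \<gamma>_in[OF that(1)]], of 0 0] by simp
  show image: "proj ` ?S = jacobi_fields_vanishing B gt \<gamma> a"
  proof (rule set_eqI, rule iffI)
    fix V assume "V \<in> proj ` ?S"
    then obtain J where J: "J \<in> ?S" "V = proj J" by auto
    then show "V \<in> jacobi_fields_vanishing B gt \<gamma> a"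
      using proj_jacobi[OF _ tangent[OF J(1)]] proj_end end_in by (simp add: S SB)
  next
    fix V assume "V \<in> jacobi_fields_vanishing B gt \<gamma> a"
    then have V: "jacobi_field B gt I \<gamma> V" "V 0 = 0" "V a = 0" by (simp_all add: SB)
    obtain J where "jacobi_field A g I (i \<circ> \<gamma>) J" "J 0 = 0" "J a = 0" "proj J = V"
      using jacobi_lift[OF I V] by metis
    then show "V \<in> proj ` ?S" by (intro image_eqI[of _ _ J]) (simp_all add: S)
  qed
  show "subspace ?S"
  proof (rule subspaceI)
    show "0 \<in> ?S" using Ac.jacobi_field_0 by (simp add: S)
    show "x + y \<in> ?S" if "x \<in> ?S" "y \<in> ?S" for x y using comb[OF that, of 1 1] by simp
    show "c *\<^sub>R x \<in> ?S" if "x \<in> ?S" for c x using comb[OF that that, of c 0] by simp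
  qed
  show "inj_on proj ?S"
  proof (rule inj_onI)
    fix J1 J2 assume J: "J1 \<in> ?S" "J2 \<in> ?S" and eq: "proj J1 = proj J2"
    have "J1 - J2 \<in> ?S" using comb[OF J, of 1 "-1"] by simp
    moreover have "proj (J1 - J2) = 0" using lin[OF J, of 1 "-1"] eq by simp
    ultimately have "J1 - J2 = 0" using proj_0_imp_0[OF I, of "J1 - J2"] by (simp add: S)
    then show "J1 = J2" by simp
  qed
qed

lemma conjugate_iff:
  assumes I: "I = {0..a}"
  shows "conjugate_point A g (i \<circ> \<gamma>) a \<longleftrightarrow> conjugate_point B gt \<gamma> a"
    and "conjugate_multiplicity A g (i \<circ> \<gamma>) a = conjugate_multiplicity B gt \<gamma> a"
proof -
  note iso = jacobi_fields_vanishing_iso[OF I]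
  let ?S = "jacobi_fields_vanishing A g (i \<circ> \<gamma>) a"
  have proj0: "proj 0 = 0" using iso(4)[of 0 0 0 0] subspace_0[OF iso(1)] by simp
  have "J = 0 \<longleftrightarrow> proj J = 0" if "J \<in> ?S" for J
    using inj_onD[OF iso(2), of J 0] that subspace_0[OF iso(1)] proj0 by auto
  then show "conjugate_point A g (i \<circ> \<gamma>) a \<longleftrightarrow> conjugate_point B gt \<gamma> a"
    unfolding conjugate_point_def iso(3)[symmetric] by auto
  show "conjugate_multiplicity A g (i \<circ> \<gamma>) a = conjugate_multiplicity B gt \<gamma> a"
    unfolding conjugate_multiplicity_def iso(3)[symmetric]
    by (rule dim_image_eq_on[OF iso(1,2), symmetric]) (rule iso(4))
qed

end

text \<open>For V \<noteq> 0, requiring the lift \<open>J\<close> to project to \<open>V\<close>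
  excludes the trivial witness \<open>J = 0\<close>, and it makes the lift an inverse of the
  projection.\<close>

theorem proposition31:
  fixes A :: "('a::{second_countable_topology, t2_space}, 'e::euclidean_space) chart set"
    and g :: "('a, 'e) form2"
    and B :: "('b::{second_countable_topology, t2_space}, 'f::euclidean_space) chart set"
    and i :: "'b \<Rightarrow> 'a"
    and U :: "'a set"
    and \<zeta> :: "'a \<Rightarrow> ('a, 'e) tvec"
    and \<xi> :: "'b \<Rightarrow> ('b, 'f) tvec"
    and I :: "real set"
    and \<gamma> :: "real \<Rightarrow> 'b"
  assumes "lorentzian_manifold A g"
    and "time_orientable A g"
    and "null_hypersurface A g B i"
    and "closed_rigging A g B i U \<zeta>"
    and "rigged_vector_field A g B i \<zeta> \<xi>"
    and "ambient_geodesic_field A g B i \<xi>"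
    and "integral_curve B \<xi> I \<gamma>"
  shows
    "(\<forall>J. jacobi_field A g I (i \<circ> \<gamma>) J \<and> (\<forall>t\<in>I. J t \<in> hypersurface_tangent A B i (\<gamma> t)) \<longrightarrow>
        jacobi_field B (rigged_metric A g B i \<zeta>) I \<gamma> (screen_projection A g B i \<zeta> I \<gamma> J)) \<and>
     (\<forall>a. I = {0..a} \<longrightarrow>
        (\<forall>V. jacobi_field B (rigged_metric A g B i \<zeta>) I \<gamma> V \<and> V 0 = 0 \<and> V a = 0 \<longrightarrow>
           (\<exists>J. jacobi_field A g I (i \<circ> \<gamma>) J \<and>
                (\<forall>t\<in>I. J t \<in> hypersurface_tangent A B i (\<gamma> t)) \<and> J 0 = 0 \<and> J a = 0 \<and>
                screen_projection A g B i \<zeta> I \<gamma> J = V)) \<and>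
        (conjugate_point A g (i \<circ> \<gamma>) a \<longleftrightarrow> conjugate_point B (rigged_metric A g B i \<zeta>) \<gamma> a) \<and>
        conjugate_multiplicity A g (i \<circ> \<gamma>) a =
          conjugate_multiplicity B (rigged_metric A g B i \<zeta>) \<gamma> a)"
proof -
  interpret rigged_null_curve A g B i U \<zeta> \<xi> I \<gamma>
    by unfold_locales (use assms in auto)
  show ?thesis
  proof (intro conjI allI impI)
    show "jacobi_field B gt I \<gamma> (proj J)"
      if "jacobi_field A g I (i \<circ> \<gamma>) J \<and> (\<forall>t\<in>I. J t \<in> hypersurface_tangent A B i (\<gamma> t))" for J
      using that proj_jacobi by blast
    fix a assume I: "I = {0..a}"
    show "\<exists>J. jacobi_field A g I (i \<circ> \<gamma>) J \<and> (\<forall>t\<in>I. J t \<in> hypersurface_tangent A B i (\<gamma> t)) \<and>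
        J 0 = 0 \<and> J a = 0 \<and> proj J = V" if "jacobi_field B gt I \<gamma> V \<and> V 0 = 0 \<and> V a = 0" for V
      using jacobi_lift[OF I, of V] that by metis
    show "conjugate_point A g (i \<circ> \<gamma>) a \<longleftrightarrow> conjugate_point B gt \<gamma> a"
      "conjugate_multiplicity A g (i \<circ> \<gamma>) a = conjugate_multiplicity B gt \<gamma> a"
      by (rule conjugate_iff[OF I])+
  qed
qed

end
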